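(* For every instance $(\lambda,L_1,L_2,K_1,K_2,h_1,h_2,p)$ of the two-stage serial system described in the context (all parameters finite and nonnegative), $$L_{\rm two}:=\max\left\{\frac{B_1(2k_1)+B_2(2k_2)}2,\ \ \frac{V_0}2+\frac{B_1(4k_1)+B_2(4k_2)}4\right\}\ \le\ \mathrm{LB}^{\mathrm{SP}}\ \le\ \mathrm{OPT}^{\mathrm{sh}} .$$
   Context: Notation: $x^+=\max(x,0)$, $x^-=\max(-x,0)$, $\mathbb N=\{1,2,\dots\}$. **System.** Stage 1 serves customers and is replenished by Stage 2; Stage 2 is replenished by an external supplier with unlimited supply. Parameters: demand rate $\lambda\ge0$; lead times $L_1,L_2\in[0,\infty)$; setup charges $K_1,K_2\ge0$; echelon holding rates $h_1,h_2\ge0$; backlog rate $p\ge0$. Put $k_i=\lambda K_i$ and $L_\Sigma=L_1+L_2$. $N(t)$ counts unit customer demands (a Poisson process of rate $\lambda$; its origin is immaterial). $U_i(t)$ is the cumulative number of units physically dispatched into echelon $i$ ($i=2$: orders from the supplier; $i=1$: shipments from Stage 2 to Stage 1); values of $U_i$ at times before $0$ are given by the initial history. A policy uses only information available at the time of each decision (future demand increments are independent of it) and may use independent private randomization; each $U_i$ is nondecreasing, right-continuous, integer valued, with finitely many dispatches on each finite interval. With integer constants $x_i$ determined by the initial history, $$\mathit{IP}_i(t)=x_i+U_i(t)-N(t),\quad \mathit{IL}_i(t)=x_i+U_i(t-L_i)-N(t),\quad P_i(t)=U_i(t)-U_i(t-L_i)\ge0,$$ and material feasibility requires $\mathit{IP}_1(t)\le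 \mathit{IL}_2(t)$. Backlog is filled as soon as stock is available at Stage 1: $I_1=\mathit{IL}_1^+$, $\mathsf B=\mathit{IL}_1^-$, $I_2=\mathit{IL}_2+\mathsf B$, and the inventory cost rate is $c_I=h_1I_1+h_2I_2+p\mathsf B$. $U_0$ counts customer deliveries, $U_0(T)=N(T)-N(0)-\mathsf B(T)+\mathsf B(0)$. Initial inventory levels and pipelines have finite first moments. At coincident events: first receive shipments whose positive lead times expire, then process customer demand, then make ordering and dispatch decisions; a zero-lead-time shipment is received at the decision epoch. **Admissibility.** A policy is admissible if its decisions use only information available at the time of each decision (possibly together with independent private randomization), each $U_i$ ($i=1,2$) is nondecreasing, right-continuous and integer valued with finitely many dispatches on each finite interval, $P_i(t)\ge0$ ($i=1,2$) and $\mathit{IP}_1(t)\le\mathit{IL}_2(t)$ hold at all times, backlog is filled as soon as stock is available at Stage 1, initial inventory levels and pipelines have finite first moments, coincident events are processed in the order receipts of shipments whose positive lead times expire, then customer demand, then ordering and dispatch decisions (with zero-lead-time shipments received at the decision epoch), it has finite expected costs on finite horizons, and as $T\to\infty$: $\mathbb E U_j(T)/T\to\lambda$ ($j=0,1,2$); $T^{-1}\mathbb E\{|\mathit{IL}_i(T)|+P_i(T)\}\to0$ ($i=1,2$); $T^{-1}\mathbb E\int_T^{T+L_\Sigma}c_I(t)\,dt\to0$; $T^{-1}\mathbb E[U_i(T+L_\Sigma)-U_i(T)]\to0$ ($i=1,2$); and the unfinished-path condition: for $i=1,2$, take the chronological path of states of $\mathit{IP}_i$ on $[0,T]$ (each demand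 is a step $-1$, each positive dispatch an upward step; at a coincident time the demand step is recorded before the dispatch step) and apply chronological loop erasure (whenever the path returns to a state of the retained path, delete the segment from the earlier visit through the return, keeping the repeated state once). If $r_{i,T}$ is the number of downward demand transitions in the retained path, then $\mathbb E r_{i,T}=o(T)$. **Cost.** $Z_i^{\rm sh}(T)$ is the number of positive aggregate dispatches into echelon $i$ up to time $T$, $$C^{\mathrm{sh}}(\Pi)=\limsup_{T\to\infty}\frac1T\mathbb E_\Pi\Big[\int_0^Tc_I(t)\,dt+\sum_{i=1}^2K_iZ_i^{\rm sh}(T)\Big],$$ and $\mathrm{OPT}^{\mathrm{sh}}$ is the infimum of $C^{\mathrm{sh}}$ over all admissible policies. **Bounds.** $D_1,D_2$ are independent, $D_i\sim\mathrm{Poisson}(\lambda L_i)$; $\phi_{a,b}(x)=ax^++bx^-$; $H_0=h_2\lambda L_1$; $G_0(x)=H_0+\mathbb E\phi_{h_1+h_2,p}(x-D_1)$. For a function $F$, $$\mathcal H_j(F)=\inf_{s\in\mathbb R}\frac1j\sum_{v=0}^{j-1}F(s-v),\qquad \mathcal C_F(k)=\inf_{j\in\mathbb N}\{k/j+\mathcal H_j(F)\}.$$ $$V_0=\inf_{r,y\in\mathbb R}\mathbb E\big[G_0\big(r-(y-D_2)^-\big)+h_2(y-D_2)^+\big].$$ For $\eta,\zeta\in[0,1]$, $F_1^{\eta,\zeta}(x)=\mathbb E\phi_{h_1+\eta h_2,\zeta p}(x-D_1)$, $F_2^{\eta,\zeta}(x)=\mathbb E\phi_{(1-\eta)h_2,(1-\zeta)p}(x-D_1-D_2)$,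 and $$\mathcal A(a_1,a_2)=\sup_{0\le\eta,\zeta\le1}\{\eta H_0+\mathcal C_{F_1^{\eta,\zeta}}(a_1)+\mathcal C_{F_2^{\eta,\zeta}}(a_2)\},\qquad \mathrm{LB}^{\mathrm{SP}}=\sup_{0<u\le1}\{(1-u)V_0+u\,\mathcal A(k_1/u,k_2/u)\}.$$ $B_1(k)=H_0+\mathcal C_{F}(k)$ for $F(x)=\mathbb E\phi_{h_1+h_2,p}(x-D_1)$, and $B_2(k)=\mathcal C_{F}(k)$ for $F(x)=\mathbb E\phi_{h_2,p}(x-D_2)$. *)

theory Defs
  imports "HOL-Probability.Probability"
begin

section \<open>Instances\<close>

datatype stage = Stage1 | Stage2

record instance_data =
  rate :: real
  lead :: "stage \<Rightarrow> real"
  setup_cost :: "stage \<Rightarrow> real"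
  hold :: "stage \<Rightarrow> real"
  backlog_cost :: real

definition valid_instance :: "instance_data \<Rightarrow> bool" where
  "valid_instance S \<longleftrightarrow> 0 \<le> rate S \<and> 0 \<le> backlog_cost S \<and>
     (\<forall>i. 0 \<le> lead S i \<and> 0 \<le> setup_cost S i \<and> 0 \<le> hold S i)"

definition scaled_setup :: "instance_data \<Rightarrow> stage \<Rightarrow> real" where
  "scaled_setup S i = rate S * setup_cost S i"

definition total_lead :: "instance_data \<Rightarrow> real" where
  "total_lead S = lead S Stage1 + lead S Stage2"

text \<open>The library's \<^const>\<open>poisson_pmf\<close> is specified for positive rates only.\<close>

definition poisson :: "real \<Rightarrow> nat pmf" where
  "poisson m = (if 0 < m then poisson_pmf m else return_pmf 0)"

section \<open>Controlled systems\<close>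

text \<open>
  A policy comes with the stochastic system it is run in.  The \<open>\<sigma>\<close>-algebra \<^term>\<open>info P t\<close> is the
  information on which decisions at time \<open>t\<close> may depend: initial history, past demand, and any
  private randomization.  Only the values of \<^term>\<open>demand P\<close> at times \<open>t \<ge> 0\<close> are used, whereas
  \<^term>\<open>dispatched P i\<close> at times \<open>t < 0\<close> is the initial history; it may be random, and so may the
  constants \<^term>\<open>offset P i\<close> determined by it.
\<close>

record 'w policy =
  prob_of :: "'w measure"
  info :: "real \<Rightarrow> 'w measure"
  demand :: "real \<Rightarrow> 'w \<Rightarrow> int"
  offset :: "stage \<Rightarrow> 'w \<Rightarrow> int"
  dispatched :: "stage \<Rightarrow> real \<Rightarrow> 'w \<Rightarrow> int"

text \<open>
  All processes are right-continuous and are evaluated after the events at time \<open>t\<close>: receipts,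
  then demand, then dispatches (with immediate receipt if the lead time is zero).  Left limits give
  the values before these events.
\<close>

definition left_lim :: "(real \<Rightarrow> int) \<Rightarrow> real \<Rightarrow> int" where
  "left_lim f t = Lim (at_left t) f"

definition jump :: "(real \<Rightarrow> int) \<Rightarrow> real \<Rightarrow> int" where
  "jump f t = f t - left_lim f t"

definition inv_position :: "'w policy \<Rightarrow> stage \<Rightarrow> real \<Rightarrow> 'w \<Rightarrow> int" where
  "inv_position P i t \<omega> = offset P i \<omega> + dispatched P i t \<omega> - demand P t \<omega>"

definition inv_level :: "instance_data \<Rightarrow> 'w policy \<Rightarrow> stage \<Rightarrow> real \<Rightarrow> 'w \<Rightarrow> int" where
  "inv_level S P i t \<omega> =
     offset P i \<omega> + dispatched P i (t - lead S i) \<omega> - demand P t \<omega>"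

definition pipeline :: "instance_data \<Rightarrow> 'w policy \<Rightarrow> stage \<Rightarrow> real \<Rightarrow> 'w \<Rightarrow> int" where
  "pipeline S P i t \<omega> = dispatched P i t \<omega> - dispatched P i (t - lead S i) \<omega>"

definition backlog :: "instance_data \<Rightarrow> 'w policy \<Rightarrow> real \<Rightarrow> 'w \<Rightarrow> int" where
  "backlog S P t \<omega> = max (- inv_level S P Stage1 t \<omega>) 0"

fun inventory :: "instance_data \<Rightarrow> 'w policy \<Rightarrow> stage \<Rightarrow> real \<Rightarrow> 'w \<Rightarrow> int" where
  "inventory S P Stage1 t \<omega> = max (inv_level S P Stage1 t \<omega>) 0"
| "inventory S P Stage2 t \<omega> = inv_level S P Stage2 t \<omega> + backlog S P t \<omega>"

definition delivered :: "instance_data \<Rightarrow> 'w policy \<Rightarrow> real \<Rightarrow> 'w \<Rightarrow> int" where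
  "delivered S P T \<omega> =
     demand P T \<omega> - demand P 0 \<omega> - backlog S P T \<omega> + backlog S P 0 \<omega>"

text \<open>
  Under material feasibility the cost rate is nonnegative, so truncation by \<^const>\<open>ennreal\<close> in the
  integrals below is immaterial.
\<close>

definition cost_rate :: "instance_data \<Rightarrow> 'w policy \<Rightarrow> real \<Rightarrow> 'w \<Rightarrow> real" where
  "cost_rate S P t \<omega> =
     hold S Stage1 * of_int (inventory S P Stage1 t \<omega>) +
     hold S Stage2 * of_int (inventory S P Stage2 t \<omega>) +
     backlog_cost S * of_int (backlog S P t \<omega>)"

definition dispatch_at :: "'w policy \<Rightarrow> stage \<Rightarrow> 'w \<Rightarrow> real \<Rightarrow> bool" where
  "dispatch_at P i \<omega> t \<longleftrightarrow> 0 < jump (\<lambda>s. dispatched P i s \<omega>) t"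

definition demand_at :: "'w policy \<Rightarrow> 'w \<Rightarrow> real \<Rightarrow> bool" where
  "demand_at P \<omega> t \<longleftrightarrow> 0 < t \<and> 0 < jump (\<lambda>s. demand P s \<omega>) t"

definition num_dispatches :: "'w policy \<Rightarrow> stage \<Rightarrow> real \<Rightarrow> 'w \<Rightarrow> nat" where
  "num_dispatches P i T \<omega> = card {t \<in> {0..T}. dispatch_at P i \<omega> t}"

definition exp_inv_cost :: "instance_data \<Rightarrow> 'w policy \<Rightarrow> real \<Rightarrow> real \<Rightarrow> ennreal" where
  "exp_inv_cost S P a b =
     (\<integral>\<^sup>+\<omega>. (\<integral>\<^sup>+t\<in>{a..b}. ennreal (cost_rate S P t \<omega>) \<partial>lborel) \<partial>prob_of P)"

definition exp_total_cost :: "instance_data \<Rightarrow> 'w policy \<Rightarrow> real \<Rightarrow> ennreal" where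
  "exp_total_cost S P T =
     (\<integral>\<^sup>+\<omega>. (\<integral>\<^sup>+t\<in>{0..T}. ennreal (cost_rate S P t \<omega>) \<partial>lborel) +
       (\<Sum>i\<in>{Stage1, Stage2}. ennreal (setup_cost S i) * of_nat (num_dispatches P i T \<omega>))
       \<partial>prob_of P)"

section \<open>Loop erasure\<close>

text \<open>In \<open>loop_erase_from r xs\<close>, the list \<open>r\<close> is the path retained so far.\<close>

fun loop_erase_from :: "'s list \<Rightarrow> 's list \<Rightarrow> 's list" where
  "loop_erase_from r [] = r"
| "loop_erase_from r (x # xs) = loop_erase_from (takeWhile (\<lambda>y. y \<noteq> x) r @ [x]) xs"

definition loop_erase :: "'s list \<Rightarrow> 's list" where
  "loop_erase xs = loop_erase_from [] xs"

text \<open>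
  The path starts in the state before a possible dispatch at time 0.  At a coincident time, the
  state after the demand step is recorded before the state after the dispatch.
\<close>

definition position_path :: "'w policy \<Rightarrow> stage \<Rightarrow> real \<Rightarrow> 'w \<Rightarrow> int list" where
  "position_path P i T \<omega> =
     (let before = (\<lambda>t. inv_position P i t \<omega> - jump (\<lambda>s. dispatched P i s \<omega>) t);
          events = {t \<in> {0..T}. demand_at P \<omega> t \<or> dispatch_at P i \<omega> t}
      in before 0 # concat (map (\<lambda>t.
           (if demand_at P \<omega> t then [before t] else []) @
           (if dispatch_at P i \<omega> t then [inv_position P i t \<omega>] else []))
         (sorted_list_of_set events)))"

text \<open>
  Each step of a retained path is a step of the original path, and demands are its only downward
  steps.
\<close>

definition num_down_steps :: "int list \<Rightarrow> nat" where
  "num_down_steps xs = card {n. Suc n < length xs \<and> xs ! Suc n < xs ! n}"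

definition unfinished_demands :: "'w policy \<Rightarrow> stage \<Rightarrow> real \<Rightarrow> 'w \<Rightarrow> nat" where
  "unfinished_demands P i T \<omega> = num_down_steps (loop_erase (position_path P i T \<omega>))"

section \<open>Admissibility\<close>

text \<open>
  Demand is a Poisson process relative to the filtration \<^term>\<open>info P\<close>, so future demand increments
  are independent of the available information, whatever randomization the latter includes.
\<close>

definition poisson_demand :: "instance_data \<Rightarrow> 'w policy \<Rightarrow> bool" where
  "poisson_demand S P \<longleftrightarrow>
     (\<forall>t\<ge>0. demand P t \<in> info P t \<rightarrow>\<^sub>M count_space UNIV) \<and>
     (\<forall>\<omega>\<in>space (prob_of P).
        mono_on {0..} (\<lambda>t. demand P t \<omega>) \<and>
        (\<forall>t\<ge>0. continuous (at_right t) (\<lambda>s. demand P s \<omega>)) \<and>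
        (\<forall>t>0. jump (\<lambda>s. demand P s \<omega>) t \<in> {0, 1})) \<and>
     (\<forall>s t. 0 \<le> s \<longrightarrow> s \<le> t \<longrightarrow>
        distr (prob_of P) (count_space UNIV) (\<lambda>\<omega>. demand P t \<omega> - demand P s \<omega>) =
          measure_pmf (map_pmf int (poisson (rate S * (t - s)))) \<and>
        prob_space.indep_set (prob_of P) (sets (info P s))
          (sets (vimage_algebra (space (prob_of P))
            (\<lambda>\<omega>. demand P t \<omega> - demand P s \<omega>) (count_space UNIV))))"

definition nonanticipating :: "'w policy \<Rightarrow> bool" where
  "nonanticipating P \<longleftrightarrow>
     filtration (space (prob_of P)) (info P) \<and>
     (\<forall>t. sets (info P t) \<subseteq> sets (prob_of P)) \<and>
     (\<forall>i. offset P i \<in> info P 0 \<rightarrow>\<^sub>M count_space UNIV) \<and>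
     (\<forall>i t. dispatched P i t \<in> info P t \<rightarrow>\<^sub>M count_space UNIV)"

definition feasible_paths :: "instance_data \<Rightarrow> 'w policy \<Rightarrow> bool" where
  "feasible_paths S P \<longleftrightarrow> (\<forall>\<omega>\<in>space (prob_of P).
     (\<forall>i. mono (\<lambda>t. dispatched P i t \<omega>) \<and>
          (\<forall>t. continuous (at_right t) (\<lambda>s. dispatched P i s \<omega>)) \<and>
          (\<forall>a b. finite {t \<in> {a..b}. dispatch_at P i \<omega> t}) \<and>
          (\<forall>t\<ge>0. 0 \<le> pipeline S P i t \<omega>)) \<and>
     (\<forall>t\<ge>0. inv_position P Stage1 t \<omega> \<le> inv_level S P Stage2 t \<omega>))"

text \<open>The initial state is the left limit at time 0, so it precedes all time-0 events.\<close>

definition finite_initial_moments :: "instance_data \<Rightarrow> 'w policy \<Rightarrow> bool" where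
  "finite_initial_moments S P \<longleftrightarrow> (\<forall>i.
     integrable (prob_of P) (\<lambda>\<omega>. real_of_int (offset P i \<omega> +
       left_lim (\<lambda>s. dispatched P i s \<omega>) (- lead S i) - demand P 0 \<omega>)) \<and>
     integrable (prob_of P) (\<lambda>\<omega>. real_of_int (
       left_lim (\<lambda>s. dispatched P i s \<omega>) 0 -
       left_lim (\<lambda>s. dispatched P i s \<omega>) (- lead S i))))"

definition mean_rate :: "'w measure \<Rightarrow> (real \<Rightarrow> 'w \<Rightarrow> int) \<Rightarrow> real \<Rightarrow> bool" where
  "mean_rate M X m \<longleftrightarrow>
     (\<forall>T\<ge>0. integrable M (\<lambda>\<omega>. real_of_int (X T \<omega>))) \<and>
     ((\<lambda>T. (\<integral>\<omega>. real_of_int (X T \<omega>) \<partial>M) / T) \<longlongrightarrow> m) at_top"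

definition asymptotic_conditions :: "instance_data \<Rightarrow> 'w policy \<Rightarrow> bool" where
  "asymptotic_conditions S P \<longleftrightarrow>
     mean_rate (prob_of P) (delivered S P) (rate S) \<and>
     (\<forall>i. mean_rate (prob_of P) (dispatched P i) (rate S)) \<and>
     (\<forall>i. ((\<lambda>T. (\<integral>\<^sup>+\<omega>. ennreal (real_of_int (\<bar>inv_level S P i T \<omega>\<bar> + pipeline S P i T \<omega>))
             \<partial>prob_of P) / ennreal T) \<longlongrightarrow> 0) at_top) \<and>
     ((\<lambda>T. exp_inv_cost S P T (T + total_lead S) / ennreal T) \<longlongrightarrow> 0) at_top \<and>
     (\<forall>i. ((\<lambda>T. (\<integral>\<^sup>+\<omega>. ennreal (real_of_int
             (dispatched P i (T + total_lead S) \<omega> - dispatched P i T \<omega>))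
             \<partial>prob_of P) / ennreal T) \<longlongrightarrow> 0) at_top) \<and>
     (\<forall>i. ((\<lambda>T. (\<integral>\<^sup>+\<omega>. of_nat (unfinished_demands P i T \<omega>) \<partial>prob_of P) / ennreal T)
             \<longlongrightarrow> 0) at_top)"

definition admissible :: "instance_data \<Rightarrow> 'w policy \<Rightarrow> bool" where
  "admissible S P \<longleftrightarrow>
     prob_space (prob_of P) \<and> nonanticipating P \<and> poisson_demand S P \<and>
     feasible_paths S P \<and> finite_initial_moments S P \<and>
     (\<forall>T\<ge>0. exp_total_cost S P T < \<infinity>) \<and> asymptotic_conditions S P"

definition long_run_cost :: "instance_data \<Rightarrow> 'w policy \<Rightarrow> ennreal" where
  "long_run_cost S P = Limsup at_top (\<lambda>T. exp_total_cost S P T / ennreal T)"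

text \<open>
  A definition cannot range over all probability spaces at once, so the type of sample points is a
  parameter.  A claim about the optimal cost that is polymorphic in this type concerns
  policies on arbitrary probability spaces.
\<close>

definition opt_cost :: "'w itself \<Rightarrow> instance_data \<Rightarrow> ennreal" where
  "opt_cost _ S = (INF P\<in>{P :: 'w policy. admissible S P}. long_run_cost S P)"

section \<open>Bounds\<close>

text \<open>
  All infima and suprema below are over nonempty bounded sets of reals for nonnegative parameters.
\<close>

definition phi :: "real \<Rightarrow> real \<Rightarrow> real \<Rightarrow> real" where
  "phi a b x = a * max x 0 + b * max (- x) 0"

definition D1 :: "instance_data \<Rightarrow> nat pmf" where
  "D1 S = poisson (rate S * lead S Stage1)"

definition D2 :: "instance_data \<Rightarrow> nat pmf" where
  "D2 S = poisson (rate S * lead S Stage2)"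

definition H0 :: "instance_data \<Rightarrow> real" where
  "H0 S = hold S Stage2 * rate S * lead S Stage1"

definition G0 :: "instance_data \<Rightarrow> real \<Rightarrow> real" where
  "G0 S x = H0 S + measure_pmf.expectation (D1 S)
     (\<lambda>d. phi (hold S Stage1 + hold S Stage2) (backlog_cost S) (x - real d))"

definition HH :: "nat \<Rightarrow> (real \<Rightarrow> real) \<Rightarrow> real" where
  "HH j F = (INF s. (\<Sum>v<j. F (s - real v)) / real j)"

definition CC :: "(real \<Rightarrow> real) \<Rightarrow> real \<Rightarrow> real" where
  "CC F k = (INF j\<in>{1..}. k / real j + HH j F)"

definition V0 :: "instance_data \<Rightarrow> real" where
  "V0 S = (INF (r, y)\<in>UNIV. measure_pmf.expectation (D2 S)
     (\<lambda>d. G0 S (r - max (- (y - real d)) 0) + hold S Stage2 * max (y - real d) 0))"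

definition F1 :: "instance_data \<Rightarrow> real \<Rightarrow> real \<Rightarrow> real \<Rightarrow> real" where
  "F1 S \<eta> \<zeta> x = measure_pmf.expectation (D1 S)
     (\<lambda>d. phi (hold S Stage1 + \<eta> * hold S Stage2) (\<zeta> * backlog_cost S) (x - real d))"

definition F2 :: "instance_data \<Rightarrow> real \<Rightarrow> real \<Rightarrow> real \<Rightarrow> real" where
  "F2 S \<eta> \<zeta> x = measure_pmf.expectation (pair_pmf (D1 S) (D2 S))
     (\<lambda>(d1, d2). phi ((1 - \<eta>) * hold S Stage2) ((1 - \<zeta>) * backlog_cost S)
        (x - real d1 - real d2))"

definition AA :: "instance_data \<Rightarrow> real \<Rightarrow> real \<Rightarrow> real" where
  "AA S a1 a2 = (SUP (\<eta>, \<zeta>)\<in>{0..1} \<times> {0..1}.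
     \<eta> * H0 S + CC (F1 S \<eta> \<zeta>) a1 + CC (F2 S \<eta> \<zeta>) a2)"

definition LB_SP :: "instance_data \<Rightarrow> real" where
  "LB_SP S = (SUP u\<in>{0<..1}. (1 - u) * V0 S +
     u * AA S (scaled_setup S Stage1 / u) (scaled_setup S Stage2 / u))"

definition B1 :: "instance_data \<Rightarrow> real \<Rightarrow> real" where
  "B1 S k = H0 S + CC (\<lambda>x. measure_pmf.expectation (D1 S)
     (\<lambda>d. phi (hold S Stage1 + hold S Stage2) (backlog_cost S) (x - real d))) k"

definition B2 :: "instance_data \<Rightarrow> real \<Rightarrow> real" where
  "B2 S k = CC (\<lambda>x. measure_pmf.expectation (D2 S)
     (\<lambda>d. phi (hold S Stage2) (backlog_cost S) (x - real d))) k"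

definition L_two :: "instance_data \<Rightarrow> real" where
  "L_two S = (let k1 = scaled_setup S Stage1; k2 = scaled_setup S Stage2 in
     max ((B1 S (2 * k1) + B2 S (2 * k2)) / 2)
         (V0 S / 2 + (B1 S (4 * k1) + B2 S (4 * k2)) / 4))"

end

theory Submission
  imports Defs "HOL-Real_Asymp.Real_Asymp"
begin

text \<open>
  The long-run cost is bounded below by splitting it as \<open>(1 - u)\<close> times the inventory cost plus \<open>u\<close>
  times the inventory cost with setup costs \<open>K / u\<close>. The first part is at least \<open>V0\<close>: given the
  stock \<open>x\<close> at Stage 2, the convexity of \<open>G0\<close> makes a base-stock position \<open>min x R\<close> at Stage 1 nearly
  optimal. The second part is split between the echelons with weights \<open>\<eta>\<close>, \<open>\<zeta>\<close>. For each stage, a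
  PASTA-type inequality bounds the cost rate integral from below by a cost per demand that depends on
  the position just before the demand. Loop erasure then cuts the path of positions into simple
  cycles, and since demands lower the position by one, a simple cycle contains a block
  \<open>s, s - 1, \<dots>, s - j + 1\<close> of demands and at least one dispatch, hence costs at least \<open>CC\<close> per demand.
  The inequality between the bounds is the choice \<open>\<eta> = \<zeta> = 1/2\<close> with \<open>u = 1\<close> and \<open>u = 1/2\<close>.
\<close>

section \<open>Loop erasure\<close>

text \<open>The cost of a position is paid after a lead time, so positions on a shortened horizon
  are compared with costs on \<open>{0..T}\<close>; the shifts are bounded and vanish after division
  by \<open>T\<close>. The PASTA-type inequality is derived without stochastic integration. The
  position at time \<open>t\<close> is known at \<open>t\<close>, while a demand within the next
  \<delta> time units is independent of it and has probability at most \<open>rate S\<close> times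
  \<delta>; Fatou's lemma then lets \<delta> tend to 0. Expectations of path functionals need a
  measurable path. Since the path depends on the whole history up to \<open>T\<close>, it is read on
  ever finer time grids. The constant \<open>H0\<close> is Little's law: the units in transit to
  Stage 1 number \<open>rate S * lead S Stage1\<close> on average and cost
  \<open>hold S Stage2\<close> each. In the \<open>V0\<close> part \<open>H0\<close> sits inside
  \<open>G0\<close> and cancels asymptotically against the pipeline cost. Costs take values in
  \<open>ennreal\<close>, where subtraction truncates, so error terms stay on the larger side until
  the costs are compared as reals.\<close>

definition path_weight :: "(int \<Rightarrow> int \<Rightarrow> real) \<Rightarrow> int list \<Rightarrow> real" where
  "path_weight w xs = (\<Sum>n<length xs - 1. w (xs ! n) (xs ! Suc n))"

abbreviation path_step :: "int \<Rightarrow> int \<Rightarrow> bool" where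
  "path_step x y \<equiv> y = x - 1 \<or> x < y"

text \<open>A downward step is a demand and is charged at the state it leaves, the position just
  before the demand; an upward step is a dispatch and costs \<open>\<kappa>\<close>. With
  \<open>f = 0\<close> and \<open>\<kappa> = 1\<close> the path weight counts dispatches.\<close>

definition step_cost :: "(int \<Rightarrow> real) \<Rightarrow> real \<Rightarrow> int \<Rightarrow> int \<Rightarrow> real" where
  "step_cost f \<kappa> x y = (if y < x then f x else \<kappa>)"

lemma path_weight_single [simp]: "path_weight w [x] = 0"
  by (simp add: path_weight_def)

lemma path_weight_snoc:
  assumes "xs \<noteq> []"
  shows "path_weight w (xs @ [x]) = path_weight w xs + w (last xs) x"
proof -
  obtain m where m: "length xs = Suc m"
    using assms by (cases xs) auto
  have "(\<Sum>n<m. w ((xs @ [x]) ! n) ((xs @ [x]) ! Suc n)) = (\<Sum>n<m. w (xs ! n) (xs ! Suc n))"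
    by (intro sum.cong) (auto simp: nth_append m)
  then show ?thesis
    using assms by (simp add: path_weight_def m nth_append last_conv_nth)
qed

text \<open>The cut state is kept in both pieces, because weights sit on steps and not on states.
  This is what makes the excision of a loop additive.\<close>

lemma path_weight_append:
  "path_weight w (xs @ x # ys) = path_weight w (xs @ [x]) + path_weight w (x # ys)"
proof (induction ys rule: rev_induct)
  case Nil
  show ?case by simp
next
  case (snoc y ys)
  have "path_weight w ((xs @ x # ys) @ [y]) =
      path_weight w (xs @ x # ys) + w (last (x # ys)) y"
    by (subst path_weight_snoc) auto
  moreover have "path_weight w ((x # ys) @ [y]) = path_weight w (x # ys) + w (last (x # ys)) y"
    by (subst path_weight_snoc) auto
  ultimately show ?case
    using snoc by simp
qed

lemma path_weight_linear:
  "path_weight (\<lambda>x y. a * v x y + b * w x y) xs = a * path_weight v xs + b * path_weight w xs"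
  by (simp add: path_weight_def sum.distrib sum_distrib_left)

lemma path_weight_nonneg: "(\<And>x y. 0 \<le> w x y) \<Longrightarrow> 0 \<le> path_weight w xs"
  by (simp add: path_weight_def sum_nonneg)

lemma num_down_steps_eq: "real (num_down_steps xs) = path_weight (\<lambda>x y. of_bool (y < x)) xs"
proof -
  have "{n. Suc n < length xs \<and> xs ! Suc n < xs ! n} =
      {..<length xs - 1} \<inter> {n. xs ! Suc n < xs ! n}"
    by auto
  then show ?thesis
    unfolding num_down_steps_def path_weight_def of_bool_def
    by (subst sum.If_cases) auto
qed

text \<open>
  A simple cycle descends by unit steps, so it leaves each state above its minimum downwards
  exactly once, and it has at least one upward step.
\<close>

lemma simple_cycle_cost:
  fixes f :: "int \<Rightarrow> real"
  assumes dist: "distinct (x # ys)" and "ys \<noteq> []"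
    and steps: "successively path_step (x # ys @ [x])"
    and \<kappa>: "0 \<le> \<kappa>"
    and block: "\<And>s j. 1 \<le> j \<Longrightarrow> C * real j \<le> (\<Sum>v<j. f (s - int v)) + \<kappa>"
  shows "C * path_weight (\<lambda>x y. of_bool (y < x)) (x # ys @ [x]) \<le>
    path_weight (step_cost f \<kappa>) (x # ys @ [x])"
proof -
  define c where "c = x # ys @ [x]"
  define N where "N = Suc (length ys)"
  have lenc: "length c = Suc N" by (simp add: c_def N_def)
  have c0: "c ! 0 = x" and cN: "c ! N = x"
    by (simp_all add: c_def N_def nth_append)
  have cx: "c ! n = (x # ys) ! n" if "n < N" for n
    using that by (cases n) (auto simp: c_def N_def nth_append)
  have inj: "inj_on ((!) c) {..<N}"
    using dist by (intro inj_onI) (metis N_def cx distinct_conv_nth length_Cons lessThan_iff)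
  have step: "path_step (c ! n) (c ! Suc n)" if "n < N" for n
    using steps that lenc unfolding c_def[symmetric] by (simp add: successively_conv_nth)
  define I where "I = {n. n < N \<and> c ! Suc n < c ! n}"
  have finI: "finite I" by (simp add: I_def)
  have N2: "2 \<le> N" using \<open>ys \<noteq> []\<close> by (cases ys) (auto simp: N_def)
  define V where "V = (!) c ` {..<N}"
  have Vne: "finite V" "V \<noteq> {}" using N2 by (auto simp: V_def lessThan_empty_iff)
  have VN: "c ! n \<in> V" if "n \<le> N" for n
  proof (cases "n = N")
    case True
    then have "c ! n = c ! 0" using c0 cN by simp
    then show ?thesis using N2 unfolding V_def by (intro image_eqI[of _ _ 0]) auto
  qed (use that in \<open>simp add: V_def\<close>)
  define m M where "m = Min V" and "M = Max V"
  have range: "m \<le> c ! n" "c ! n \<le> M" if "n \<le> N" for n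
    using Vne VN[OF that] by (simp_all add: m_def M_def)
  obtain n1 where n1: "n1 < N" "c ! n1 = m"
    using Min_in[OF Vne] by (auto simp: m_def V_def)
  obtain n2 where n2: "n2 < N" "c ! n2 = M"
    using Max_in[OF Vne] by (auto simp: M_def V_def)
  have "m < M"
  proof (rule ccontr)
    assume "\<not> m < M"
    then have "c ! 0 = c ! 1" using range[of 0] range[of 1] N2 by linarith
    then show False using inj_onD[OF inj, of 0 1] N2 by simp
  qed
  have cross: "\<exists>n\<in>I. c ! n = v" if v: "m < v" "v \<le> M" for v
  proof (rule ccontr)
    assume no: "\<not> (\<exists>n\<in>I. c ! n = v)"
    \<comment> \<open>Downward steps have size one, so the path cannot get below \<open>v\<close>
      without leaving \<open>v\<close> itself downwards.\<close>
    have inv: "v \<le> c ! Suc n" if "n < N" "v \<le> c ! n" for n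
    proof (rule ccontr)
      assume "\<not> v \<le> c ! Suc n"
      then have "n \<in> I" "c ! n = v" using step[OF that(1)] that by (auto simp: I_def)
      then show False using no by blast
    qed
    have up: "v \<le> c ! n'" if "n \<le> n'" "n' \<le> N" "v \<le> c ! n" for n n'
      using that by (induction n' rule: dec_induct) (simp_all add: inv)
    \<comment> \<open>From the maximum at \<open>n2\<close> the path would stay at or above
      \<open>v\<close> to the end of the cycle, hence also from its start to the minimum at
      \<open>n1\<close>, which lies below \<open>v\<close>.\<close>
    have "v \<le> c ! N" using up[of n2 N] n2 v by simp
    then have "v \<le> c ! 0" using c0 cN by simp
    then have "v \<le> c ! n1" using up[of 0 n1] n1 by simp
    then show False using n1 v by simp
  qed
  have img: "(!) c ` I = {m<..M}"
  proof (intro equalityI subsetI)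
    fix v assume "v \<in> (!) c ` I"
    then obtain n where "n < N" "c ! Suc n < c ! n" "v = c ! n"
      by (auto simp: I_def)
    then show "v \<in> {m<..M}" using range[of n] range[of "Suc n"] by auto
  next
    fix v assume "v \<in> {m<..M}"
    then show "v \<in> (!) c ` I" using cross[of v] by auto
  qed
  have injI: "inj_on ((!) c) I"
    using inj by (rule inj_on_subset) (auto simp: I_def)
  define j where "j = nat (M - m)"
  have cardI: "card I = j"
    using card_image[OF injI] img by (simp add: j_def)
  \<comment> \<open>The descents are listed from the top: the block starts at \<open>s = M\<close>
    and has length \<open>j = M - m\<close>.\<close>
  have bij: "bij_betw (\<lambda>v. M - int v) {..<j} {m<..M}"
    by (rule bij_betwI[where g="\<lambda>a. nat (M - a)"]) (auto simp: j_def)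
  have "(\<Sum>n\<in>I. f (c ! n)) = (\<Sum>a\<in>{m<..M}. f a)"
    using sum.reindex[OF injI, of f] img by simp
  also have "\<dots> = (\<Sum>v<j. f (M - int v))"
    using sum.reindex_bij_betw[OF bij, of f] by simp
  finally have sumI: "(\<Sum>n\<in>I. f (c ! n)) = (\<Sum>v<j. f (M - int v))" .
  \<comment> \<open>Without an upward step the cycle would lose at least one unit at each of its
    \<open>N\<close> steps and could not return to \<open>x\<close>.\<close>
  have "\<exists>n<N. c ! n < c ! Suc n"
  proof (rule ccontr)
    assume no: "\<not> (\<exists>n<N. c ! n < c ! Suc n)"
    then have "c ! Suc n < c ! n" if "n < N" for n
      using step[OF that] that by auto
    then have *: "c ! Suc n + 1 \<le> c ! n" if "n < N" for n
      using that by fastforce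
    have "c ! n + int n \<le> c ! 0" if "n \<le> N" for n
      using that
    proof (induction n)
      case (Suc n)
      then show ?case using *[of n] by linarith
    qed simp
    from this[of N] show False using c0 cN N2 by simp
  qed
  then obtain n3 where n3: "n3 < N" "c ! n3 < c ! Suc n3" by blast
  have "path_weight (step_cost f \<kappa>) c = (\<Sum>n<N. step_cost f \<kappa> (c ! n) (c ! Suc n))"
    by (simp add: path_weight_def lenc)
  also have "\<dots> = (\<Sum>n\<in>I. step_cost f \<kappa> (c ! n) (c ! Suc n)) +
      (\<Sum>n\<in>{..<N} - I. step_cost f \<kappa> (c ! n) (c ! Suc n))"
    by (subst add.commute, rule sum.subset_diff) (auto simp: I_def)
  also have "(\<Sum>n\<in>I. step_cost f \<kappa> (c ! n) (c ! Suc n)) = (\<Sum>v<j. f (M - int v))"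
    unfolding sumI[symmetric] by (intro sum.cong) (auto simp: I_def step_cost_def)
  finally have 1: "path_weight (step_cost f \<kappa>) c = (\<Sum>v<j. f (M - int v)) +
      (\<Sum>n\<in>{..<N} - I. step_cost f \<kappa> (c ! n) (c ! Suc n))" .
  have "\<kappa> = (\<Sum>n\<in>{n3}. step_cost f \<kappa> (c ! n) (c ! Suc n))"
    using n3 by (simp add: step_cost_def)
  also have "\<dots> \<le> (\<Sum>n\<in>{..<N} - I. step_cost f \<kappa> (c ! n) (c ! Suc n))"
    using n3 \<kappa> by (intro sum_mono2) (auto simp: I_def step_cost_def)
  finally have 2: "\<kappa> \<le> (\<Sum>n\<in>{..<N} - I. step_cost f \<kappa> (c ! n) (c ! Suc n))" .
  have "path_weight (\<lambda>x y. of_bool (y < x)) c = real (num_down_steps c)"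
    by (simp add: num_down_steps_eq)
  also have "num_down_steps c = card I"
    by (simp add: num_down_steps_def I_def lenc)
  finally have 3: "path_weight (\<lambda>x y. of_bool (y < x)) c = real j"
    by (simp add: cardI)
  have "C * real j \<le> (\<Sum>v<j. f (M - int v)) + \<kappa>"
    using \<open>m < M\<close> by (intro block) (simp add: j_def)
  then show ?thesis
    using 1 2 3 by (simp add: c_def)
qed

text \<open>Every deleted segment is a simple cycle, since the retained path \<open>r\<close> has no
  repetition. If simple cycles have nonnegative weight, each deletion can only lower the weight of
  retained path plus remaining input.\<close>

lemma loop_erase_from_weight:
  fixes w :: "int \<Rightarrow> int \<Rightarrow> real"
  assumes cycle: "\<And>x ys. distinct (x # ys) \<Longrightarrow> ys \<noteq> [] \<Longrightarrow>
      successively path_step (x # ys @ [x]) \<Longrightarrow> 0 \<le> path_weight w (x # ys @ [x])"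
    and "r \<noteq> []" "distinct r" "successively path_step (r @ xs)"
  shows "path_weight w (loop_erase_from r xs) \<le> path_weight w (r @ xs)"
  using assms(2-)
proof (induction xs arbitrary: r)
  case Nil
  then show ?case by simp
next
  case (Cons x xs)
  show ?case
  proof (cases "x \<in> set r")
    case False
    then have t: "takeWhile (\<lambda>y. y \<noteq> x) r = r"
      by (auto simp: takeWhile_eq_all_conv)
    have "path_weight w (loop_erase_from (r @ [x]) xs) \<le> path_weight w ((r @ [x]) @ xs)"
      using Cons.prems False by (intro Cons.IH) auto
    then show ?thesis by (simp add: t)
  next
    case True
    then obtain a b where r: "r = a @ x # b" and xa: "x \<notin> set a"
      by (meson split_list_first)
    have t: "takeWhile (\<lambda>y. y \<noteq> x) r = a"
      unfolding r using xa by (subst takeWhile_append2) auto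
    have suc: "successively path_step (a @ (x # b @ [x]) @ xs)"
      using Cons.prems(3) by (simp add: r)
    have "successively path_step ((a @ [x]) @ xs)"
      using suc by (cases xs) (auto simp: successively_append_iff successively_Cons)
    moreover have "distinct (a @ [x])"
      using Cons.prems(2) by (simp add: r)
    ultimately have "path_weight w (loop_erase_from (a @ [x]) xs) \<le> path_weight w ((a @ [x]) @ xs)"
      by (intro Cons.IH) auto
    also have "\<dots> = path_weight w (a @ [x]) + path_weight w (x # xs)"
      using path_weight_append[of w a x xs] by simp
    also have "\<dots> \<le> path_weight w (a @ [x]) + path_weight w (x # b @ [x]) + path_weight w (x # xs)"
    proof -
      have sc: "successively path_step (x # b @ [x])"
        using suc by (simp only: successively_append_iff)
      \<comment> \<open>No path step leads from a state to itself, so the excised loop has an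
        interior state.\<close>
      then have "b \<noteq> []" by (auto simp: successively_Cons)
      then have "0 \<le> path_weight w (x # b @ [x])"
        using sc Cons.prems(2) by (intro cycle) (auto simp: r)
      then show ?thesis by simp
    qed
    also have "\<dots> = path_weight w (r @ x # xs)"
      using path_weight_append[of w a x "b @ x # xs"] path_weight_append[of w "x # b" x xs]
      by (simp add: r)
    finally show ?thesis by (simp add: t)
  qed
qed

text \<open>The weight that loop erasure cannot increase is the cost minus \<open>C\<close> per
  downward step, nonnegative on simple cycles by \<open>simple_cycle_cost\<close>. On the retained
  path the cost is merely nonnegative, so its downward steps survive as the error term.\<close>

theorem loop_erasure_bound:
  fixes f :: "int \<Rightarrow> real"
  assumes "xs \<noteq> []" "successively path_step xs" "0 \<le> \<kappa>" "\<And>x. 0 \<le> f x"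
    and block: "\<And>s j. 1 \<le> j \<Longrightarrow> C * real j \<le> (\<Sum>v<j. f (s - int v)) + \<kappa>"
  shows "C * num_down_steps xs \<le>
    path_weight (step_cost f \<kappa>) xs + C * num_down_steps (loop_erase xs)"
proof -
  define w where "w = (\<lambda>x y. 1 * step_cost f \<kappa> x y + (- C) * of_bool (y < x))"
  have w: "path_weight w ys = path_weight (step_cost f \<kappa>) ys - C * num_down_steps ys" for ys
    unfolding w_def path_weight_linear num_down_steps_eq by simp
  obtain x ys where xs: "xs = x # ys" using assms(1) by (cases xs) auto
  have "path_weight w (loop_erase_from [x] ys) \<le> path_weight w ([x] @ ys)"
  proof (rule loop_erase_from_weight)
    fix x ys assume *: "distinct (x # ys)" "ys \<noteq> []" "successively path_step (x # ys @ [x])"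
    show "0 \<le> path_weight w (x # ys @ [x])"
      using simple_cycle_cost[OF * assms(3) block] by (simp add: w num_down_steps_eq)
  qed (use assms(2) in \<open>simp_all add: xs\<close>)
  then have "path_weight w (loop_erase xs) \<le> path_weight w xs"
    by (simp add: loop_erase_def xs)
  moreover have "0 \<le> path_weight (step_cost f \<kappa>) (loop_erase xs)"
    by (rule path_weight_nonneg) (simp add: step_cost_def assms)
  ultimately show ?thesis by (simp add: w)
qed

section \<open>Sample paths\<close>

lemma right_continuous_int:
  fixes f :: "real \<Rightarrow> int"
  assumes "continuous (at_right t) f"
  obtains b where "t < b" "\<And>s. t \<le> s \<Longrightarrow> s < b \<Longrightarrow> f s = f t"
proof -
  have "\<forall>\<^sub>F s in at_right t. f s = f t"
    using assms by (simp add: continuous_within tendsto_discrete)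
  then obtain b where "t < b" "\<And>s. t < s \<Longrightarrow> s < b \<Longrightarrow> f s = f t"
    unfolding eventually_at_right_field by blast
  then show ?thesis
    using that[of b] by (metis order_le_less)
qed

lemma left_lim_eqI:
  fixes f :: "real \<Rightarrow> int"
  assumes "a < t" "\<And>s. a \<le> s \<Longrightarrow> s < t \<Longrightarrow> f s = v"
  shows "left_lim f t = v"
  unfolding left_lim_def
proof (rule tendsto_Lim)
  have "\<forall>\<^sub>F s in at_left t. f s = v"
    unfolding eventually_at_left_field using assms by (intro exI[of _ a]) auto
  then show "(f \<longlongrightarrow> v) (at_left t)"
    by (simp add: tendsto_discrete)
qed simp

text \<open>On \<open>{c..<t}\<close> the values lie between \<open>f c\<close> and
  \<open>f t\<close>, so they form a finite set and the maximum is attained; from there on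
  \<open>f\<close> is constant up to \<open>t\<close>. Monotonicity is asked on \<open>{c..}\<close>
  only, because demand is specified only from time 0 on.\<close>

lemma mono_int_left_lim:
  fixes f :: "real \<Rightarrow> int"
  assumes mono: "mono_on {c..} f" and "c < t"
  obtains a where "c \<le> a" "a < t" "\<And>s. a \<le> s \<Longrightarrow> s < t \<Longrightarrow> f s = left_lim f t"
proof -
  have *: "f ` {c..<t} \<subseteq> {f c..f t}"
    using mono_onD[OF mono] \<open>c < t\<close> by auto
  then have fin: "finite (f ` {c..<t})" by (rule finite_subset) simp
  have ne: "f ` {c..<t} \<noteq> {}" using \<open>c < t\<close> by auto
  obtain a where a: "c \<le> a" "a < t" "f a = Max (f ` {c..<t})"
    using Max_in[OF fin ne] by auto
  have eq: "f s = f a" if "a \<le> s" "s < t" for s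
  proof (rule antisym)
    show "f s \<le> f a" using that a fin by (simp add: a(3))
    show "f a \<le> f s" using mono_onD[OF mono, of a s] that a by simp
  qed
  have lim: "left_lim f t = f a"
    by (rule left_lim_eqI[OF a(2) eq])
  show ?thesis
  proof (rule that[OF a(1,2)])
    show "f s = left_lim f t" if "a \<le> s" "s < t" for s
      using eq[OF that] lim by simp
  qed
qed

text \<open>The time is the infimum of the times at which \<open>f\<close> exceeds
  \<open>f a\<close>. Right-continuity puts the increase at the infimum itself, so it is a
  jump.\<close>

lemma mono_int_first_increase:
  fixes f :: "real \<Rightarrow> int"
  assumes mono: "mono_on {c..} f" and rc: "\<And>t. c \<le> t \<Longrightarrow> continuous (at_right t) f"
    and ab: "c \<le> a" "a < b" "f a < f b"
  obtains \<tau> where "a < \<tau>" "\<tau> \<le> b" "0 < jump f \<tau>" "\<And>s. a \<le> s \<Longrightarrow> s < \<tau> \<Longrightarrow> f s = f a"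
proof -
  define A where "A = {t\<in>{a..b}. f a < f t}"
  have A: "b \<in> A" "bdd_below A"
    using ab by (auto simp: A_def bdd_below_def)
  define \<tau> where "\<tau> = Inf A"
  have \<tau>: "a \<le> \<tau>" "\<tau> \<le> b"
    using A by (auto simp: \<tau>_def A_def intro!: cInf_greatest cInf_lower)
  have below: "f s = f a" if "a \<le> s" "s < \<tau>" for s
  proof -
    have "s \<notin> A" using that A cInf_lower[of s A] by (auto simp: \<tau>_def)
    then have "f s \<le> f a" using that \<tau> by (auto simp: A_def)
    moreover have "f a \<le> f s" using mono_onD[OF mono, of a s] that ab by simp
    ultimately show ?thesis by simp
  qed
  have inc: "f a < f \<tau>"
  proof (rule ccontr)
    assume "\<not> f a < f \<tau>"
    obtain b' where b': "\<tau> < b'" "\<And>s. \<tau> \<le> s \<Longrightarrow> s < b' \<Longrightarrow> f s = f \<tau>"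
      using right_continuous_int[OF rc[of \<tau>]] \<tau> ab by auto
    have "b' \<le> t" if "t \<in> A" for t
    proof (rule ccontr)
      assume "\<not> b' \<le> t"
      moreover have "\<tau> \<le> t" using cInf_lower[OF that A(2)] by (simp add: \<tau>_def)
      ultimately have "f t = f \<tau>" using b'(2)[of t] by linarith
      then show False using that \<open>\<not> f a < f \<tau>\<close> by (simp add: A_def)
    qed
    then have "b' \<le> \<tau>" unfolding \<tau>_def using A by (intro cInf_greatest) auto
    then show False using b' by simp
  qed
  then have "a < \<tau>" using \<tau> by (cases "a = \<tau>") auto
  moreover have "left_lim f \<tau> = f a"
    by (rule left_lim_eqI[OF \<open>a < \<tau>\<close> below])
  then have "0 < jump f \<tau>" using inc by (simp add: jump_def)
  ultimately show ?thesis
    by (rule that[OF _ \<tau>(2) _ below])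
qed

text \<open>Each positive jump raises \<open>f\<close> by at least one, so splitting off the first
  jump after \<open>a\<close> decreases \<open>f b - f a\<close>.\<close>

lemma finite_jumps_mono_int:
  fixes f :: "real \<Rightarrow> int"
  assumes mono: "mono_on {c..} f" and rc: "\<And>t. c \<le> t \<Longrightarrow> continuous (at_right t) f"
    and "c \<le> a"
  shows "finite {t\<in>{a<..b}. 0 < jump f t}"
  using \<open>c \<le> a\<close>
proof (induction "nat (f b - f a)" arbitrary: a rule: less_induct)
  case less
  show ?case
  proof (cases "a < b \<and> f a < f b")
    case True
    obtain \<tau> where \<tau>: "a < \<tau>" "\<tau> \<le> b" "0 < jump f \<tau>" "\<And>s. a \<le> s \<Longrightarrow> s < \<tau> \<Longrightarrow> f s = f a"
      using mono_int_first_increase[OF mono rc \<open>c \<le> a\<close>, of b] True by auto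
    have const: "jump f s = 0" if "a < s" "s < \<tau>" for s
    proof -
      have "left_lim f s = f a" using that by (intro left_lim_eqI[of a] \<tau>(4)) auto
      then show ?thesis using \<tau>(4)[of s] that by (simp add: jump_def)
    qed
    have "left_lim f \<tau> = f a" using \<tau>(1,4) by (rule left_lim_eqI)
    then have "f a < f \<tau>" using \<tau>(3) by (simp add: jump_def)
    then have "finite {t\<in>{\<tau><..b}. 0 < jump f t}"
      using less.prems \<tau>(1,2) mono_onD[OF mono, of \<tau> b] by (intro less.hyps) auto
    then have fin: "finite (insert \<tau> {t\<in>{\<tau><..b}. 0 < jump f t})" by simp
    have "t = \<tau> \<or> \<tau> < t" if "a < t" "0 < jump f t" for t
      using const[of t] that by (cases t \<tau> rule: linorder_cases) auto
    then have "{t\<in>{a<..b}. 0 < jump f t} \<subseteq> insert \<tau> {t\<in>{\<tau><..b}. 0 < jump f t}"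
      by auto
    then show ?thesis using fin by (rule finite_subset)
  next
    case False
    have "jump f t = 0" if "a < t" "t \<le> b" for t
    proof -
      have const: "f s = f b" if "a \<le> s" "s \<le> b" for s
        using mono_onD[OF mono, of a s] mono_onD[OF mono, of s b] that less.prems
          False \<open>a < t\<close> \<open>t \<le> b\<close> by auto
      have "left_lim f t = f b" using that by (intro left_lim_eqI[of a] const) auto
      then show ?thesis using const[of t] that by (simp add: jump_def)
    qed
    then have "{t\<in>{a<..b}. 0 < jump f t} = {}" by auto
    then show ?thesis by (simp only: finite.emptyI)
  qed
qed

section \<open>The position path of one sample point and its recursion along event times\<close>

locale sample_path =
  fixes P :: "'w policy" and i :: stage and \<omega> :: 'w
  assumes demand_mono: "mono_on {0..} (\<lambda>t. demand P t \<omega>)"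
    and demand_right_continuous: "0 \<le> t \<Longrightarrow> continuous (at_right t) (\<lambda>s. demand P s \<omega>)"
    and demand_unit_jumps: "0 < t \<Longrightarrow> jump (\<lambda>s. demand P s \<omega>) t \<in> {0, 1}"
    and dispatched_mono: "mono (\<lambda>t. dispatched P i t \<omega>)"
    and dispatched_right_continuous: "continuous (at_right t) (\<lambda>s. dispatched P i s \<omega>)"
    and finite_dispatches: "finite {t\<in>{a..b}. dispatch_at P i \<omega> t}"
begin

abbreviation "N t \<equiv> demand P t \<omega>"
abbreviation "U t \<equiv> dispatched P i t \<omega>"
abbreviation "position t \<equiv> inv_position P i t \<omega>"

definition "event t \<longleftrightarrow> demand_at P \<omega> t \<or> dispatch_at P i \<omega> t"

lemma dispatched_mono_on: "mono_on {c..} U"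
  by (rule monotone_on_subset[OF dispatched_mono]) simp

lemma jump_dispatched_nonneg: "0 \<le> jump U t"
proof -
  have "t - 1 < t" by simp
  then obtain a where a: "a < t" "\<And>s. a \<le> s \<Longrightarrow> s < t \<Longrightarrow> U s = left_lim U t"
    using mono_int_left_lim[OF dispatched_mono_on] by blast
  have "left_lim U t \<le> U t"
    using monoD[OF dispatched_mono, of a t] a(2)[OF order.refl a(1)] a(1) by simp
  then show ?thesis by (simp add: jump_def)
qed

lemma finite_events: "finite {t\<in>{0..b}. event t}"
proof (rule finite_subset)
  show "{t\<in>{0..b}. event t} \<subseteq> {t\<in>{0<..b}. 0 < jump N t} \<union> {t\<in>{0..b}. dispatch_at P i \<omega> t}"
    by (auto simp: event_def demand_at_def)
  show "finite ({t\<in>{0<..b}. 0 < jump N t} \<union> {t\<in>{0..b}. dispatch_at P i \<omega> t})"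
    using finite_jumps_mono_int[OF demand_mono demand_right_continuous] finite_dispatches by simp
qed

lemma constant_between_events:
  assumes "0 \<le> a" "a \<le> t" "\<forall>s\<in>{a<..t}. \<not> event s"
  shows "N t = N a" "U t = U a"
proof -
  show "N t = N a"
  proof (rule ccontr)
    assume "N t \<noteq> N a"
    then have "a < t" using assms(2) by (cases "a = t") auto
    moreover have "N a < N t"
      using mono_onD[OF demand_mono, of a t] assms(1,2) \<open>N t \<noteq> N a\<close> by simp
    ultimately obtain \<tau> where "a < \<tau>" "\<tau> \<le> t" "0 < jump N \<tau>"
      using mono_int_first_increase[OF demand_mono demand_right_continuous assms(1)] by blast
    then show False using assms by (auto simp: event_def demand_at_def)
  qed
  show "U t = U a"
  proof (rule ccontr)
    assume "U t \<noteq> U a"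
    then have "a < t" using assms(2) by (cases "a = t") auto
    moreover have "U a < U t"
      using monoD[OF dispatched_mono, of a t] assms(2) \<open>U t \<noteq> U a\<close> by simp
    ultimately obtain \<tau> where "a < \<tau>" "\<tau> \<le> t" "0 < jump U \<tau>"
      using mono_int_first_increase[OF dispatched_mono_on dispatched_right_continuous order.refl]
      by blast
    then show False using assms by (auto simp: event_def dispatch_at_def)
  qed
qed

text \<open>With no event strictly inside the interval, every change on \<open>{a<..b}\<close> takes
  place at \<open>b\<close>, so left limits at \<open>b\<close> are values at
  \<open>a\<close>.\<close>

lemma jumps_after_gap:
  assumes "0 \<le> a" "a < b" "\<forall>s\<in>{a<..<b}. \<not> event s"
  shows "jump N b = N b - N a" "jump U b = U b - U a"
    "N b - N a \<in> {0, 1}" "U a \<le> U b"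
proof -
  have "left_lim N b = N a" "left_lim U b = U a"
    using assms by (intro left_lim_eqI[of a] constant_between_events; auto)+
  then show 1: "jump N b = N b - N a" "jump U b = U b - U a"
    by (simp_all add: jump_def)
  show "N b - N a \<in> {0, 1}"
    using demand_unit_jumps[of b] assms 1 by auto
  show "U a \<le> U b" using monoD[OF dispatched_mono, of a b] assms by simp
qed

lemma events_after_gap:
  assumes "0 \<le> a" "a < b" "\<forall>s\<in>{a<..<b}. \<not> event s"
  shows "demand_at P \<omega> b \<longleftrightarrow> N a < N b" "dispatch_at P i \<omega> b \<longleftrightarrow> U a < U b"
  using jumps_after_gap[OF assms] assms by (auto simp: demand_at_def dispatch_at_def)

lemma position_path_0:
  "position_path P i 0 \<omega> =
    (position 0 - jump U 0) # (if dispatch_at P i \<omega> 0 then [position 0] else [])"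
proof -
  have "{t\<in>{0..0}. demand_at P \<omega> t \<or> dispatch_at P i \<omega> t} =
      (if dispatch_at P i \<omega> 0 then {0} else {})"
    by (auto simp: demand_at_def)
  moreover have "\<not> demand_at P \<omega> 0" by (simp add: demand_at_def)
  ultimately show ?thesis by (simp add: position_path_def)
qed

lemma sorted_events_after_gap:
  assumes "0 \<le> a" "a < b" "\<forall>s\<in>{a<..<b}. \<not> event s"
  shows "sorted_list_of_set {t\<in>{0..b}. event t} =
    sorted_list_of_set {t\<in>{0..a}. event t} @ (if event b then [b] else [])"
proof (rule sorted_distinct_set_unique)
  have fin: "set (sorted_list_of_set {t\<in>{0..c}. event t}) = {t\<in>{0..c}. event t}" for c
    by (rule set_sorted_list_of_set[OF finite_events])
  show "set (sorted_list_of_set {t\<in>{0..b}. event t}) =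
      set (sorted_list_of_set {t\<in>{0..a}. event t} @ (if event b then [b] else []))"
  proof (intro set_eqI)
    fix t
    have "t \<le> b \<longleftrightarrow> t \<le> a \<or> t = b" if "event t"
      using assms that by (cases t b rule: linorder_cases) force+
    then show "t \<in> set (sorted_list_of_set {t\<in>{0..b}. event t}) \<longleftrightarrow>
        t \<in> set (sorted_list_of_set {t\<in>{0..a}. event t} @ (if event b then [b] else []))"
      unfolding set_append fin using assms(1,2) by auto
  qed
  show "sorted (sorted_list_of_set {t\<in>{0..a}. event t} @ (if event b then [b] else []))"
    unfolding sorted_append fin using assms(1,2) by auto
  show "distinct (sorted_list_of_set {t\<in>{0..a}. event t} @ (if event b then [b] else []))"
    unfolding distinct_append fin using assms(1,2) by auto
qed simp_all

text \<open>This recursion replaces the sorted list of events in all later arguments. A demand at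
  \<open>b\<close> has size one and precedes the dispatch, so the state recorded for it is
  \<open>position a - 1\<close>.\<close>

lemma position_path_step:
  assumes "0 \<le> a" "a < b" "\<forall>s\<in>{a<..<b}. \<not> event s"
  shows "position_path P i b \<omega> = position_path P i a \<omega> @
    (if N a < N b then [position a - 1] else []) @ (if U a < U b then [position b] else [])"
proof -
  have "position b - jump U b = position a - 1" if "N a < N b"
    using jumps_after_gap[OF assms] that by (auto simp: inv_position_def)
  moreover have "event b \<longleftrightarrow> N a < N b \<or> U a < U b"
    using events_after_gap[OF assms] by (simp add: event_def)
  ultimately show ?thesis
    using events_after_gap[OF assms]
    unfolding position_path_def event_def[symmetric] sorted_events_after_gap[OF assms] Let_def
    by simp
qed

text \<open>In a grid cell the single event time need not be the right endpoint. Nothing changes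
  after it, so the values at the two endpoints determine the same recorded states.\<close>

lemma position_path_step_one_event:
  assumes "0 \<le> a" "a < b"
    and one: "\<And>s t. a < s \<Longrightarrow> s \<le> b \<Longrightarrow> event s \<Longrightarrow> a < t \<Longrightarrow> t \<le> b \<Longrightarrow> event t \<Longrightarrow> s = t"
  shows "position_path P i b \<omega> = position_path P i a \<omega> @
    (if N a < N b then [position a - 1] else []) @ (if U a < U b then [position b] else [])"
proof (cases "\<exists>\<tau>. a < \<tau> \<and> \<tau> < b \<and> event \<tau>")
  case True
  then obtain \<tau> where \<tau>: "a < \<tau>" "\<tau> < b" "event \<tau>" by blast
  have no: "\<not> event s" if "a < s" "s \<le> b" "s \<noteq> \<tau>" for s
    using one[of s \<tau>] \<tau> that by auto
  have eq: "N b = N \<tau>" "U b = U \<tau>"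
    using \<tau> assms(1) by (intro constant_between_events ballI no; simp)+
  have "position_path P i \<tau> \<omega> = position_path P i a \<omega> @
      (if N a < N \<tau> then [position a - 1] else []) @ (if U a < U \<tau> then [position \<tau>] else [])"
    using \<tau> assms(1) by (intro position_path_step ballI no) auto
  moreover have "position_path P i b \<omega> = position_path P i \<tau> \<omega> @
      (if N \<tau> < N b then [position \<tau> - 1] else []) @ (if U \<tau> < U b then [position b] else [])"
    using \<tau> assms(1) by (intro position_path_step ballI no) auto
  ultimately show ?thesis using eq by (simp add: inv_position_def)
next
  case False
  then show ?thesis using assms(1,2) by (intro position_path_step) auto
qed

text \<open>Only finitely many events precede \<open>T\<close>, so one may pass from the last event
  before \<open>T\<close> to \<open>T\<close> and induct on their number. The endpoint
  \<open>b\<close> of a step may or may not be an event.\<close>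

lemma event_induct [consumes 1, case_names zero step]:
  assumes "0 \<le> T" and zero: "Q 0"
    and step: "\<And>a b. 0 \<le> a \<Longrightarrow> a < b \<Longrightarrow> \<forall>s\<in>{a<..<b}. \<not> event s \<Longrightarrow> Q a \<Longrightarrow> Q b"
  shows "Q T"
  using assms(1)
proof (induction "card {t\<in>{0<..<T}. event t}" arbitrary: T rule: less_induct)
  case less
  define E where "E b = {t\<in>{0<..<b}. event t}" for b
  have finE: "finite (E b)" for b
    using finite_events[of b] by (rule finite_subset[rotated]) (auto simp: E_def)
  show ?case
  proof (cases "T = 0")
    case False
    show ?thesis
    proof (cases "E T = {}")
      case True
      then show ?thesis using False less.prems zero by (intro step[of 0 T]) (auto simp: E_def)
    next
      case ne: False
      define a where "a = Max (E T)"
      have a: "a \<in> E T" "\<And>s. s \<in> E T \<Longrightarrow> s \<le> a"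
        using finE ne by (auto simp: a_def)
      have "E a \<subset> E T" using a by (auto simp: E_def)
      then have "card (E a) < card (E T)" using finE by (rule psubset_card_mono[rotated])
      then have "Q a" using a by (intro less.hyps) (auto simp: E_def)
      moreover have "\<not> event s" if "a < s" "s < T" for s
      proof
        assume "event s"
        then have "s \<in> E T" using that a(1) by (simp add: E_def)
        then show False using a(2)[of s] that by simp
      qed
      ultimately show ?thesis
        using a(1) by (intro step[of a T]) (auto simp: E_def)
    qed
  qed (simp add: zero)
qed

lemma num_dispatches_step:
  assumes "0 \<le> a" "a < b" "\<forall>s\<in>{a<..<b}. \<not> event s"
  shows "num_dispatches P i b \<omega> = num_dispatches P i a \<omega> + of_bool (U a < U b)"
proof -
  have "t \<le> a" if "t \<noteq> b" "t \<le> b" "dispatch_at P i \<omega> t" for t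
    using assms(3) that by (force simp: event_def)
  then have "{t\<in>{0..b}. dispatch_at P i \<omega> t} =
      (if dispatch_at P i \<omega> b then insert b else id) {t\<in>{0..a}. dispatch_at P i \<omega> t}"
    using assms(1,2) by (auto simp: less_imp_le) (metis less_le_trans order_le_less)+
  then show ?thesis
    using events_after_gap[OF assms] assms(2) finite_dispatches[of 0 a]
    by (auto simp: num_dispatches_def)
qed

text \<open>Besides the hypotheses of \<open>loop_erasure_bound\<close>, this expresses the number
  of demands and the number of dispatches as functionals of the path. The last state is part of the
  induction because the next step starts from it.\<close>

lemma position_path_facts:
  assumes "0 \<le> T"
  shows "position_path P i T \<omega> \<noteq> [] \<and> last (position_path P i T \<omega>) = position T \<and>
    successively path_step (position_path P i T \<omega>) \<and>
    num_down_steps (position_path P i T \<omega>) = real_of_int (N T - N 0) \<and>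
    path_weight (step_cost (\<lambda>_. 0) 1) (position_path P i T \<omega>) = num_dispatches P i T \<omega>"
  using assms
proof (induction rule: event_induct)
  case zero
  have "{t\<in>{0..0}. dispatch_at P i \<omega> t} = (if dispatch_at P i \<omega> 0 then {0} else {})"
    by auto
  moreover note jump_dispatched_nonneg[of 0]
  moreover have "path_weight w [x, y] = w x y" for w x y
    using path_weight_snoc[of "[x]" w y] by simp
  ultimately show ?case
    by (auto simp: position_path_0 num_down_steps_eq step_cost_def num_dispatches_def dispatch_at_def)
next
  case (step a b)
  then have *: "position_path P i a \<omega> \<noteq> []" "last (position_path P i a \<omega>) = position a"
    "successively path_step (position_path P i a \<omega>)" by auto
  note 1 = jumps_after_gap[OF step(1-3)]
  show ?case
    unfolding position_path_step[OF step(1-3)] num_dispatches_step[OF step(1-3)]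
    using step(4) 1 *
    by (auto simp: path_weight_snoc num_down_steps_eq successively_append_iff inv_position_def
        step_cost_def append_assoc[symmetric] simp del: append_assoc)
qed

section \<open>Reading the position path on a time grid\<close>

lemma grid_eventually_fine:
  assumes "0 < T"
  shows "\<forall>\<^sub>F n in sequentially. 0 < n \<and>
    (\<forall>s\<in>{0..T}. \<forall>t\<in>{0..T}. event s \<longrightarrow> event t \<longrightarrow> s < t \<longrightarrow> T / real n < t - s)"
proof -
  define E where "E = {t\<in>{0..T}. event t}"
  have "finite E" unfolding E_def by (rule finite_events)
  then have "finite ((E \<times> E) \<inter> {(s, t). s < t})" by simp
  moreover have "\<forall>\<^sub>F n in sequentially. T / real n < t - s" if "s < t" for s t
  proof -
    have "(\<lambda>n. T / real n) \<longlonglongrightarrow> 0"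
      by (rule lim_const_over_n)
    then show ?thesis using that by (intro order_tendstoD) auto
  qed
  ultimately have "\<forall>\<^sub>F n in sequentially. \<forall>(s, t)\<in>(E \<times> E) \<inter> {(s, t). s < t}. T / real n < t - s"
    by (intro eventually_ball_finite) auto
  then show ?thesis
    using eventually_gt_at_top[of 0]
    by eventually_elim (force simp: E_def)
qed

end

text \<open>The path as reconstructed from the processes at grid times and the initial segment at
  time 0. It depends on finitely many random variables, hence is measurable, and on a fine enough
  grid it is the true path.\<close>

primrec grid_path :: "'w policy \<Rightarrow> stage \<Rightarrow> real \<Rightarrow> nat \<Rightarrow> 'w \<Rightarrow> int list" where
  "grid_path P i h 0 \<omega> = position_path P i 0 \<omega>"
| "grid_path P i h (Suc n) \<omega> = grid_path P i h n \<omega> @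
    (if demand P (real n * h) \<omega> < demand P (real (Suc n) * h) \<omega>
     then [inv_position P i (real n * h) \<omega> - 1] else []) @
    (if dispatched P i (real n * h) \<omega> < dispatched P i (real (Suc n) * h) \<omega>
     then [inv_position P i (real (Suc n) * h) \<omega>] else [])"

lemma (in sample_path) grid_path_eventually:
  assumes "0 < T"
  shows "\<forall>\<^sub>F n in sequentially. grid_path P i (T / n) n \<omega> = position_path P i T \<omega>"
  using grid_eventually_fine[OF assms]
proof eventually_elim
  case (elim n)
  define h where "h = T / real n"
  have h: "0 < h" "real n * h = T" using elim assms by (simp_all add: h_def)
  have "grid_path P i h k \<omega> = position_path P i (real k * h) \<omega>" if "k \<le> n" for k
    using that
  proof (induction k)
    case 0
    then show ?case by simp
  next
    case (Suc k)
    have le: "real (Suc k) * h \<le> T"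
      using Suc.prems h by (metis mult_right_mono of_nat_mono less_imp_le)
    \<comment> \<open>Two distinct event times in one cell would be less than \<open>h\<close>
      apart, against the fineness of the grid.\<close>
    have "s = t" if st: "real k * h < s" "s \<le> real (Suc k) * h" "event s"
        "real k * h < t" "t \<le> real (Suc k) * h" "event t" for s t
    proof -
      have *: False if "real k * h < s" "s \<le> real (Suc k) * h" "event s"
        "real k * h < t" "t \<le> real (Suc k) * h" "event t" "s < t" for s t
      proof -
        have "0 \<le> real k * h" using h by simp
        then have "T / real n < t - s" using elim that le by auto
        moreover have "t - s < h" using that by (simp add: algebra_simps)
        ultimately show False by (simp add: h_def)
      qed
      show ?thesis using *[of s t] *[of t s] st by (cases s t rule: linorder_cases) auto
    qed
    then have "position_path P i (real (Suc k) * h) \<omega> = position_path P i (real k * h) \<omega> @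
      (if N (real k * h) < N (real (Suc k) * h) then [position (real k * h) - 1] else []) @
      (if U (real k * h) < U (real (Suc k) * h) then [position (real (Suc k) * h)] else [])"
      using h by (intro position_path_step_one_event) auto
    then show ?case using Suc by simp
  qed
  from this[of n] show ?case by (simp add: h(2)) (simp add: h_def)
qed

section \<open>The bounds\<close>

lemma nn_integral_poisson:
  assumes "0 \<le> m"
  shows "(\<integral>\<^sup>+n. ennreal (real n) \<partial>measure_pmf (poisson m)) = ennreal m"
proof (cases "m = 0")
  case True
  then show ?thesis by (simp add: poisson_def)
next
  case False
  then have m: "0 < m" using assms by simp
  define g where "g n = m ^ n / fact n * exp (- m) * real n" for n
  have "(\<lambda>n. m ^ n /\<^sub>R fact n * (exp (- m) * m)) sums (exp m * (exp (- m) * m))"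
    by (intro sums_mult2 exp_converges)
  moreover have "m ^ n /\<^sub>R fact n * (exp (- m) * m) = g (Suc n)" for n
    by (simp add: g_def field_simps del: of_nat_Suc)
  moreover have "exp m * (exp (- m) * m) = m"
    by (simp add: exp_minus field_simps)
  ultimately have "(\<lambda>n. g (Suc n)) sums m" by simp
  then have sums: "g sums m"
    by (subst (asm) sums_Suc_iff) (simp add: g_def)
  have "(\<integral>\<^sup>+n. ennreal (real n) \<partial>measure_pmf (poisson m)) =
      (\<integral>\<^sup>+n. ennreal (g n) \<partial>count_space UNIV)"
    using m by (subst nn_integral_measure_pmf)
      (auto simp: poisson_def g_def ennreal_mult[symmetric] intro!: nn_integral_cong)
  also have "\<dots> = (\<Sum>n. ennreal (g n))"
    by (rule nn_integral_count_space_nat)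
  also have "\<dots> = ennreal m"
    using m by (intro suminf_ennreal_eq sums) (simp add: g_def)
  finally show ?thesis .
qed

lemma integrable_poisson:
  assumes "0 \<le> m"
  shows "integrable (measure_pmf (poisson m)) real"
  using nn_integral_poisson[OF assms] by (intro integrableI_bounded) auto

lemma phi_nonneg: "0 \<le> a \<Longrightarrow> 0 \<le> b \<Longrightarrow> 0 \<le> phi a b x"
  by (simp add: phi_def)

lemma phi_mono: "a \<le> a' \<Longrightarrow> b \<le> b' \<Longrightarrow> phi a b x \<le> phi a' b' x"
  by (simp add: phi_def add_mono mult_right_mono)

lemma phi_scale: "phi (c * a) (c * b) x = c * phi a b x"
  by (simp add: phi_def algebra_simps)

lemma phi_le: "0 \<le> a \<Longrightarrow> 0 \<le> b \<Longrightarrow> phi a b x \<le> (a + b) * \<bar>x\<bar>"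
  by (cases "0 \<le> x") (auto simp: phi_def distrib_right mult_nonneg_nonneg mult_nonneg_nonpos)

lemma phi_convex:
  assumes "0 \<le> a" "0 \<le> b" "0 \<le> t" "t \<le> 1"
  shows "phi a b ((1 - t) * x + t * y) \<le> (1 - t) * phi a b x + t * phi a b y"
proof -
  have *: "max ((1 - t) * x + t * y) 0 \<le> (1 - t) * max x 0 + t * max y 0" for x y :: real
    using assms by (auto intro!: add_mono mult_left_mono add_nonneg_nonneg)
  have "phi a b ((1 - t) * x + t * y) \<le>
      a * ((1 - t) * max x 0 + t * max y 0) + b * ((1 - t) * max (- x) 0 + t * max (- y) 0)"
    unfolding phi_def using *[of x y] *[of "- x" "- y"] assms
    by (intro add_mono mult_left_mono) (auto simp: algebra_simps)
  then show ?thesis by (simp add: phi_def algebra_simps)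
qed

lemma integrable_phi:
  assumes "0 \<le> a" "0 \<le> b" "integrable (measure_pmf p) g"
  shows "integrable (measure_pmf p) (\<lambda>d. phi a b (x - g d))"
proof (rule Bochner_Integration.integrable_bound)
  show "integrable (measure_pmf p) (\<lambda>d. (a + b) * (\<bar>x\<bar> + \<bar>g d\<bar>))"
    using assms by simp
  have "phi a b (x - g d) \<le> (a + b) * (\<bar>x\<bar> + \<bar>g d\<bar>)" for d
    by (rule order.trans[OF phi_le mult_left_mono]) (use assms in auto)
  then show "AE d in measure_pmf p. norm (phi a b (x - g d)) \<le> norm ((a + b) * (\<bar>x\<bar> + \<bar>g d\<bar>))"
    using assms by (simp add: phi_nonneg)
qed simp

lemma CC_le:
  assumes "\<And>x. 0 \<le> F x" "0 \<le> k" "1 \<le> j"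
  shows "CC F k \<le> k / real j + (\<Sum>v<j. F (s - real v)) / real j"
proof -
  have HH0: "0 \<le> HH j F" for j
    unfolding HH_def using assms by (intro cINF_greatest) (auto intro!: divide_nonneg_nonneg sum_nonneg)
  have "CC F k \<le> k / real j + HH j F"
    unfolding CC_def using assms HH0
    by (intro cINF_lower bdd_belowI2[where m=0]) auto
  moreover have "HH j F \<le> (\<Sum>v<j. F (s - real v)) / real j"
    unfolding HH_def using assms
    by (intro cINF_lower bdd_belowI2[where m=0] divide_nonneg_nonneg sum_nonneg) auto
  ultimately show ?thesis by simp
qed

lemma CC_greatest:
  assumes "\<And>j s. 1 \<le> j \<Longrightarrow> c \<le> k / real j + (\<Sum>v<j. F (s - real v)) / real j"
  shows "c \<le> CC F k"
  unfolding CC_def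
proof (rule cINF_greatest)
  fix j :: nat assume j: "j \<in> {1..}"
  have "c - k / real j \<le> HH j F"
    unfolding HH_def using assms[of j] j by (intro cINF_greatest) (auto simp: algebra_simps)
  then show "c \<le> k / real j + HH j F" by simp
qed auto

lemma CC_nonneg: "(\<And>x. 0 \<le> F x) \<Longrightarrow> 0 \<le> k \<Longrightarrow> 0 \<le> CC F k"
  by (intro CC_greatest add_nonneg_nonneg divide_nonneg_nonneg sum_nonneg) auto

text \<open>This is the multiplied-out form required of \<open>C\<close> in
  \<open>loop_erasure_bound\<close>: one dispatch cost \<open>k\<close> together with a block of
  \<open>j\<close> consecutive positions pays \<open>CC F k\<close> for each of the \<open>j\<close>
  demands.\<close>

lemma CC_block:
  assumes "\<And>x. 0 \<le> F x" "0 \<le> k" "1 \<le> j"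
  shows "CC F k * real j \<le> (\<Sum>v<j. F (s - real v)) + k"
  using CC_le[OF assms, where s=s] assms(3) by (simp add: field_simps)

text \<open>Newsvendor cost after a random lead-time demand; \<open>F1\<close>, \<open>G0\<close>,
  \<open>B1\<close>, \<open>B2\<close> and, after conditioning on \<open>D1\<close>,
  \<open>F2\<close> are all built from it.\<close>

definition exp_phi :: "nat pmf \<Rightarrow> real \<Rightarrow> real \<Rightarrow> real \<Rightarrow> real" where
  "exp_phi p a b x = measure_pmf.expectation p (\<lambda>d. phi a b (x - real d))"

lemma exp_phi_nonneg: "0 \<le> a \<Longrightarrow> 0 \<le> b \<Longrightarrow> 0 \<le> exp_phi p a b x"
  unfolding exp_phi_def by (intro Bochner_Integration.integral_nonneg) (simp add: phi_nonneg)

lemma exp_phi_mono: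
  assumes "0 \<le> a" "0 \<le> b" "a \<le> a'" "b \<le> b'" "integrable (measure_pmf p) real"
  shows "exp_phi p a b x \<le> exp_phi p a' b' x"
  unfolding exp_phi_def using assms by (intro integral_mono integrable_phi phi_mono) auto

lemma exp_phi_scale: "exp_phi p (c * a) (c * b) x = c * exp_phi p a b x"
  by (simp add: exp_phi_def phi_scale)

lemma nn_integral_phi:
  assumes "0 \<le> a" "0 \<le> b" "integrable (measure_pmf p) real"
  shows "(\<integral>\<^sup>+d. ennreal (phi a b (x - real d)) \<partial>measure_pmf p) = ennreal (exp_phi p a b x)"
  unfolding exp_phi_def using assms
  by (intro nn_integral_eq_integral integrable_phi) (auto simp: phi_nonneg)

lemma exp_phi_convex:
  assumes "0 \<le> a" "0 \<le> b" "0 \<le> t" "t \<le> 1" and p: "integrable (measure_pmf p) real"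
  shows "exp_phi p a b ((1 - t) * x + t * y) \<le> (1 - t) * exp_phi p a b x + t * exp_phi p a b y"
proof -
  have "exp_phi p a b ((1 - t) * x + t * y) \<le> measure_pmf.expectation p
      (\<lambda>d. (1 - t) * phi a b (x - real d) + t * phi a b (y - real d))"
    unfolding exp_phi_def
  proof (rule integral_mono)
    show "phi a b ((1 - t) * x + t * y - real d) \<le>
        (1 - t) * phi a b (x - real d) + t * phi a b (y - real d)" for d
      using phi_convex[OF assms(1-4), of "x - real d" "y - real d"] by (simp add: algebra_simps)
  qed (use assms in \<open>simp_all add: integrable_phi\<close>)
  also have "\<dots> = (1 - t) * exp_phi p a b x + t * exp_phi p a b y"
    unfolding exp_phi_def using assms by (simp add: integrable_phi)
  finally show ?thesis .
qed

text \<open>A supporting line through the positive part, with any slope between 0 and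
  \<open>a\<close>. It bounds \<open>G0 S x - h2 * x\<close> from below.\<close>

lemma exp_phi_ge_linear:
  assumes "0 \<le> c" "c \<le> a" "0 \<le> b" and p: "integrable (measure_pmf p) real"
  shows "c * (x - measure_pmf.expectation p real) \<le> exp_phi p a b x"
proof -
  have "c * (x - real d) \<le> phi a b (x - real d)" for d
  proof -
    have "c * (x - real d) \<le> c * max (x - real d) 0" using assms by (intro mult_left_mono) auto
    also have "\<dots> \<le> a * max (x - real d) 0" using assms by (intro mult_right_mono) auto
    also have "\<dots> \<le> phi a b (x - real d)" using assms by (simp add: phi_def)
    finally show ?thesis .
  qed
  then have "measure_pmf.expectation p (\<lambda>d. c * (x - real d)) \<le> exp_phi p a b x"
    unfolding exp_phi_def using assms by (intro integral_mono integrable_phi) auto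
  then show ?thesis using p by simp
qed

text \<open>Conditioning on the first demand turns the cost of the sum of two lead-time demands into
  a mixture of shifted one-stage costs. Integrability of the mixture is read off from Tonelli, as
  the joint integral is finite.\<close>

lemma expectation_pair_phi:
  assumes "0 \<le> a" "0 \<le> b" and p: "integrable (measure_pmf p) real" and q: "integrable (measure_pmf q) real"
  shows "integrable (measure_pmf p) (\<lambda>d. exp_phi q a b (x - real d))"
    and "measure_pmf.expectation (pair_pmf p q) (\<lambda>(d, e). phi a b (x - real d - real e)) =
      measure_pmf.expectation p (\<lambda>d. exp_phi q a b (x - real d))" (is "?E = ?R")
    and "(\<integral>\<^sup>+z. (case z of (d, e) \<Rightarrow> ennreal (phi a b (x - real d - real e))) \<partial>measure_pmf (pair_pmf p q)) =
      ennreal (measure_pmf.expectation (pair_pmf p q) (\<lambda>(d, e). phi a b (x - real d - real e)))" (is ?nn)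
proof -
  have "integrable (measure_pmf (pair_pmf p q)) (\<lambda>z. real (fst z))"
    using p by (subst integrable_map_pmf_eq[of fst, symmetric]) (simp add: map_fst_pair_pmf)
  moreover have "integrable (measure_pmf (pair_pmf p q)) (\<lambda>z. real (snd z))"
    using q by (subst integrable_map_pmf_eq[of snd, symmetric]) (simp add: map_snd_pair_pmf)
  ultimately have "integrable (measure_pmf (pair_pmf p q)) (\<lambda>z. phi a b (x - (real (fst z) + real (snd z))))"
    using assms by (intro integrable_phi) auto
  then have int: "integrable (measure_pmf (pair_pmf p q)) (\<lambda>(d, e). phi a b (x - real d - real e))"
    by (simp add: case_prod_unfold diff_diff_add)
  show nn: ?nn
    using nn_integral_eq_integral[OF int] assms by (simp add: phi_nonneg case_prod_beta)
  have iter: "(\<integral>\<^sup>+d. ennreal (exp_phi q a b (x - real d)) \<partial>measure_pmf p) = ennreal ?E"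
    unfolding nn[symmetric] using assms by (simp add: nn_integral_pair_pmf' nn_integral_phi)
  show 1: "integrable (measure_pmf p) (\<lambda>d. exp_phi q a b (x - real d))"
    using iter assms by (intro integrableI_bounded) (auto simp: exp_phi_nonneg)
  have "ennreal ?R = ennreal ?E"
    using nn_integral_eq_integral[OF 1] iter assms by (simp add: exp_phi_nonneg)
  moreover have "0 \<le> ?R" "0 \<le> ?E"
    using assms by (auto intro!: Bochner_Integration.integral_nonneg simp: exp_phi_nonneg phi_nonneg)
  ultimately show "?E = ?R" by simp
qed

section \<open>Comparison of the deterministic bounds and properties of \<open>V0\<close>\<close>

context
  fixes S :: instance_data
  assumes valid: "valid_instance S"
begin

abbreviation "h1 \<equiv> hold S Stage1"
abbreviation "h2 \<equiv> hold S Stage2"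
abbreviation "pc \<equiv> backlog_cost S"

lemma params: "0 \<le> rate S" "0 \<le> lead S i" "0 \<le> setup_cost S i" "0 \<le> hold S i" "0 \<le> pc"
  "0 \<le> scaled_setup S i" "0 \<le> H0 S"
  using valid by (auto simp: valid_instance_def scaled_setup_def H0_def)

lemma integrable_lead_demand: "integrable (measure_pmf (D1 S)) real" "integrable (measure_pmf (D2 S)) real"
  unfolding D1_def D2_def by (intro integrable_poisson mult_nonneg_nonneg params)+

lemma F1_eq: "F1 S \<eta> \<zeta> x = exp_phi (D1 S) (h1 + \<eta> * h2) (\<zeta> * pc) x"
  by (simp add: F1_def exp_phi_def)

lemma G0_eq: "G0 S x = H0 S + exp_phi (D1 S) (h1 + h2) pc x"
  by (simp add: G0_def exp_phi_def)

lemma B1_eq: "B1 S k = H0 S + CC (exp_phi (D1 S) (h1 + h2) pc) k"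
  by (simp add: B1_def exp_phi_def[abs_def])

lemma B2_eq: "B2 S k = CC (exp_phi (D2 S) h2 pc) k"
  by (simp add: B2_def exp_phi_def[abs_def])

lemma F1_nonneg: "0 \<le> \<eta> \<Longrightarrow> 0 \<le> \<zeta> \<Longrightarrow> 0 \<le> F1 S \<eta> \<zeta> x"
  unfolding F1_eq using params by (intro exp_phi_nonneg) auto

lemma F2_nonneg: "\<eta> \<le> 1 \<Longrightarrow> \<zeta> \<le> 1 \<Longrightarrow> 0 \<le> F2 S \<eta> \<zeta> x"
  unfolding F2_def using params by (intro Bochner_Integration.integral_nonneg) (auto simp: phi_nonneg)

lemma F2_eq:
  assumes "\<eta> \<le> 1" "\<zeta> \<le> 1"
  shows "F2 S \<eta> \<zeta> x = measure_pmf.expectation (D1 S)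
    (\<lambda>d. exp_phi (D2 S) ((1 - \<eta>) * h2) ((1 - \<zeta>) * pc) (x - real d))"
  unfolding F2_def using params assms integrable_lead_demand by (intro expectation_pair_phi) auto

text \<open>At weights 1/2 the holding rate \<open>h1 + h2 / 2\<close> is at least half of
  \<open>h1 + h2\<close> and the backlog rate is exactly half, so \<open>F1\<close> dominates half
  the full cost. Halving a block cost with setup \<open>2 * k\<close> leaves the setup
  \<open>k\<close>.\<close>

lemma CC_F1_half: "CC (exp_phi (D1 S) (h1 + h2) pc) (2 * k) / 2 \<le> CC (F1 S (1/2) (1/2)) k"
  if "0 \<le> k"
proof (rule CC_greatest)
  fix j :: nat and s :: real assume j: "1 \<le> j"
  let ?F = "exp_phi (D1 S) (h1 + h2) pc"
  have *: "?F x / 2 \<le> F1 S (1/2) (1/2) x" for x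
  proof -
    have "?F x / 2 = exp_phi (D1 S) (1/2 * (h1 + h2)) (1/2 * pc) x"
      by (simp only: exp_phi_scale)
    also have "\<dots> \<le> F1 S (1/2) (1/2) x"
      unfolding F1_eq using params integrable_lead_demand
      by (intro exp_phi_mono) (auto simp: field_simps)
    finally show ?thesis .
  qed
  have "(\<Sum>v<j. ?F (s - real v)) / 2 \<le> (\<Sum>v<j. F1 S (1/2) (1/2) (s - real v))"
    unfolding sum_divide_distrib by (intro sum_mono *)
  then have "(\<Sum>v<j. ?F (s - real v)) / 2 / real j \<le> (\<Sum>v<j. F1 S (1/2) (1/2) (s - real v)) / real j"
    by (intro divide_right_mono) auto
  moreover have "CC ?F (2 * k) \<le> 2 * k / real j + (\<Sum>v<j. ?F (s - real v)) / real j"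
    using that j params by (intro CC_le exp_phi_nonneg) auto
  ultimately show "CC ?F (2 * k) / 2 \<le> k / real j + (\<Sum>v<j. F1 S (1/2) (1/2) (s - real v)) / real j"
    by (simp add: field_simps)
qed

text \<open>At weights 1/2, \<open>F2\<close> is half the \<open>D1\<close>-average of the one-stage
  cost shifted by the demand \<open>d\<close>. The block bound holds for every shifted starting
  point \<open>s - d\<close>, so it survives averaging.\<close>

lemma CC_F2_half: "CC (exp_phi (D2 S) h2 pc) (2 * k) / 2 \<le> CC (F2 S (1/2) (1/2)) k"
  if "0 \<le> k"
proof (rule CC_greatest)
  fix j :: nat and s :: real assume j: "1 \<le> j"
  let ?F = "exp_phi (D2 S) h2 pc"
  let ?c = "CC ?F (2 * k)"
  have int: "integrable (measure_pmf (D1 S)) (\<lambda>d. ?F (x - real d))" for x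
    using params integrable_lead_demand by (intro expectation_pair_phi) auto
  have F2: "F2 S (1/2) (1/2) x = measure_pmf.expectation (D1 S) (\<lambda>d. ?F (x - real d)) / 2" for x
  proof -
    have *: "exp_phi (D2 S) ((1 - 1/2) * h2) ((1 - 1/2) * pc) y = ?F y / 2" for y
      using exp_phi_scale[of "D2 S" "1/2" h2 pc y] by simp
    have "(\<lambda>d. exp_phi (D2 S) ((1 - 1/2) * h2) ((1 - 1/2) * pc) (x - real d)) =
        (\<lambda>d. ?F (x - real d) / 2)" by (intro ext) (rule *)
    moreover have "(1::real) / 2 \<le> 1" by simp
    ultimately show ?thesis by (simp only: F2_eq integral_divide_zero)
  qed
  have "?c * real j - 2 * k = measure_pmf.expectation (D1 S) (\<lambda>_. ?c * real j - 2 * k)"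
    by simp
  also have "\<dots> \<le> measure_pmf.expectation (D1 S) (\<lambda>d. \<Sum>v<j. ?F (s - real v - real d))"
  proof (rule integral_mono)
    fix d :: nat
    have "?c * real j \<le> (\<Sum>v<j. ?F ((s - real d) - real v)) + 2 * k"
      using that j params by (intro CC_block exp_phi_nonneg) auto
    moreover have "s - real d - real v = s - real v - real d" for v by simp
    ultimately show "?c * real j - 2 * k \<le> (\<Sum>v<j. ?F (s - real v - real d))"
      by (simp only: diff_le_eq)
  qed (use int in auto)
  also have "\<dots> = 2 * (\<Sum>v<j. F2 S (1/2) (1/2) (s - real v))"
    using int by (simp add: F2 sum_distrib_left)
  finally show "?c / 2 \<le> k / real j + (\<Sum>v<j. F2 S (1/2) (1/2) (s - real v)) / real j"
    using j by (simp add: field_simps)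
qed

text \<open>Real suprema need boundedness. The trial block \<open>j = 1\<close>,
  \<open>s = 0\<close> suffices, with \<open>F1\<close> largest at weights 1 and \<open>F2\<close>
  largest at weights 0. Linear growth in \<open>a1\<close> and \<open>a2\<close> keeps
  \<open>u * AA S (k1 / u) (k2 / u)\<close> bounded as \<open>u\<close> tends to 0.\<close>

lemma AA_term_le:
  assumes a: "0 \<le> a1" "0 \<le> a2" and \<eta>: "0 \<le> \<eta>" "\<eta> \<le> 1" "0 \<le> \<zeta>" "\<zeta> \<le> 1"
  shows "\<eta> * H0 S + CC (F1 S \<eta> \<zeta>) a1 + CC (F2 S \<eta> \<zeta>) a2 \<le>
    a1 + a2 + (H0 S + F1 S 1 1 0 + F2 S 0 0 0)"
proof -
  have "\<eta> * H0 S \<le> H0 S"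
    using \<eta> params by (simp add: mult_left_le_one_le)
  moreover have "CC (F1 S \<eta> \<zeta>) a1 \<le> a1 + F1 S \<eta> \<zeta> 0"
    using CC_le[of "F1 S \<eta> \<zeta>" a1 1 0] a \<eta> F1_nonneg by simp
  moreover have "CC (F2 S \<eta> \<zeta>) a2 \<le> a2 + F2 S \<eta> \<zeta> 0"
    using CC_le[of "F2 S \<eta> \<zeta>" a2 1 0] a \<eta> F2_nonneg by simp
  moreover have "F1 S \<eta> \<zeta> 0 \<le> F1 S 1 1 0"
    unfolding F1_eq using \<eta> params integrable_lead_demand
    by (intro exp_phi_mono) (auto simp: mult_left_le_one_le)
  moreover have "F2 S \<eta> \<zeta> 0 \<le> F2 S 0 0 0"
  proof -
    have "exp_phi (D2 S) ((1 - \<eta>) * h2) ((1 - \<zeta>) * pc) y \<le> exp_phi (D2 S) ((1 - 0) * h2) ((1 - 0) * pc) y" for y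
      using \<eta> params integrable_lead_demand by (intro exp_phi_mono) (auto simp: mult_left_le_one_le)
    moreover have "integrable (measure_pmf (D1 S)) (\<lambda>d. exp_phi (D2 S) ((1 - \<eta>) * h2) ((1 - \<zeta>) * pc) (0 - real d))"
      if "\<eta> \<le> 1" "\<zeta> \<le> 1" for \<eta> \<zeta>
      using that params integrable_lead_demand by (intro expectation_pair_phi) auto
    ultimately show ?thesis
      using \<eta> unfolding F2_eq[OF \<eta>(2,4)] F2_eq[OF zero_le_one zero_le_one]
      by (intro integral_mono) (simp_all only: zero_le_one)
  qed
  ultimately show ?thesis by linarith
qed

lemma AA_ge_half:
  assumes "0 \<le> a1" "0 \<le> a2"
  shows "(B1 S (2 * a1) + B2 S (2 * a2)) / 2 \<le> AA S a1 a2"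
proof -
  define K where "K = H0 S + F1 S 1 1 0 + F2 S 0 0 0"
  note K = AA_term_le[folded K_def]
  have "(B1 S (2 * a1) + B2 S (2 * a2)) / 2 \<le>
      1/2 * H0 S + CC (F1 S (1/2) (1/2)) a1 + CC (F2 S (1/2) (1/2)) a2"
    using CC_F1_half[OF assms(1)] CC_F2_half[OF assms(2)] unfolding B1_eq B2_eq
    by (simp add: field_simps)
  also have "\<dots> \<le> AA S a1 a2"
  proof -
    have "bdd_above ((\<lambda>(\<eta>, \<zeta>). \<eta> * H0 S + CC (F1 S \<eta> \<zeta>) a1 + CC (F2 S \<eta> \<zeta>) a2) ` ({0..1} \<times> {0..1}))"
      using K assms by (intro bdd_aboveI2[where M="a1 + a2 + K"]) auto
    then show ?thesis
      unfolding AA_def by (rule cSUP_upper2[where x="(1/2, 1/2)"]) simp_all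
  qed
  finally show ?thesis .
qed

lemma L_two_le_LB_SP: "L_two S \<le> LB_SP S"
proof -
  define k1 k2 where "k1 = scaled_setup S Stage1" and "k2 = scaled_setup S Stage2"
  have k: "0 \<le> k1" "0 \<le> k2" by (simp_all add: k1_def k2_def params)
  define K where "K = H0 S + F1 S 1 1 0 + F2 S 0 0 0"
  note K = AA_term_le[folded K_def]
  have K0: "0 \<le> K"
    unfolding K_def using params F1_nonneg F2_nonneg by (intro add_nonneg_nonneg) auto
  have AA: "AA S a1 a2 \<le> a1 + a2 + K" if "0 \<le> a1" "0 \<le> a2" for a1 a2
    unfolding AA_def using K that by (intro cSUP_least) auto
  let ?f = "\<lambda>u. (1 - u) * V0 S + u * AA S (k1 / u) (k2 / u)"
  have "?f u \<le> \<bar>V0 S\<bar> + (k1 + k2 + K)" if "u \<in> {0<..1}" for u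
  proof -
    have "(1 - u) * V0 S \<le> 1 * \<bar>V0 S\<bar>"
      using that by (intro order.trans[OF mult_left_mono[of _ "\<bar>V0 S\<bar>"] mult_right_mono]) auto
    moreover have "u * AA S (k1 / u) (k2 / u) \<le> u * (k1 / u + k2 / u + K)"
      using that k by (intro mult_left_mono AA) auto
    moreover have "u * (k1 / u + k2 / u + K) = k1 + k2 + u * K"
      using that by (simp add: field_simps)
    moreover have "u * K \<le> K" using that K0 by (simp add: mult_left_le_one_le)
    ultimately show ?thesis by linarith
  qed
  then have bdd: "bdd_above (?f ` {0<..1})" by (rule bdd_aboveI2)
  have LB: "LB_SP S = (SUP u\<in>{0<..1}. ?f u)"
    by (simp add: LB_SP_def k1_def k2_def)
  have "(B1 S (2 * k1) + B2 S (2 * k2)) / 2 \<le> ?f 1"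
    using AA_ge_half[OF k] by simp
  also have "\<dots> \<le> LB_SP S"
    unfolding LB by (rule cSUP_upper[OF _ bdd]) simp
  finally have 1: "(B1 S (2 * k1) + B2 S (2 * k2)) / 2 \<le> LB_SP S" .
  \<comment> \<open>At \<open>u = 1/2\<close> the setup parameters double to \<open>2 * k1\<close>
    and \<open>2 * k2\<close>; the split with weights 1/2 doubles them once more.\<close>
  have "V0 S / 2 + (B1 S (4 * k1) + B2 S (4 * k2)) / 4 \<le> ?f (1/2)"
    using AA_ge_half[of "2 * k1" "2 * k2"] k by (simp add: mult.commute)
  also have "\<dots> \<le> LB_SP S"
    unfolding LB by (rule cSUP_upper[OF _ bdd]) simp
  finally have "V0 S / 2 + (B1 S (4 * k1) + B2 S (4 * k2)) / 4 \<le> LB_SP S" .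
  with 1 show ?thesis
    by (simp add: L_two_def k1_def k2_def Let_def)
qed

lemma LB_SP_least:
  assumes "\<And>u \<eta> \<zeta>. 0 < u \<Longrightarrow> u \<le> 1 \<Longrightarrow> 0 \<le> \<eta> \<Longrightarrow> \<eta> \<le> 1 \<Longrightarrow> 0 \<le> \<zeta> \<Longrightarrow> \<zeta> \<le> 1 \<Longrightarrow>
    (1 - u) * V0 S + u * (\<eta> * H0 S + CC (F1 S \<eta> \<zeta>) (scaled_setup S Stage1 / u) +
      CC (F2 S \<eta> \<zeta>) (scaled_setup S Stage2 / u)) \<le> c"
  shows "LB_SP S \<le> c"
  unfolding LB_SP_def
proof (rule cSUP_least)
  fix u :: real assume u: "u \<in> {0<..1}"
  have "AA S (scaled_setup S Stage1 / u) (scaled_setup S Stage2 / u) \<le> (c - (1 - u) * V0 S) / u"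
    unfolding AA_def using assms[of u] u
    by (intro cSUP_least) (auto simp: pos_le_divide_eq algebra_simps)
  then show "(1 - u) * V0 S + u * AA S (scaled_setup S Stage1 / u) (scaled_setup S Stage2 / u) \<le> c"
    using u by (simp add: pos_le_divide_eq algebra_simps)
qed auto

text \<open>
  \<open>R\<close> is a near-minimizer of the convex function \<open>q x = G0 S x - h2 * x\<close>, so reducing the
  position of Stage 1 from the available stock \<open>x\<close> to \<open>min x R\<close> is nearly optimal.
\<close>

lemma near_optimal_base_stock:
  assumes "0 < \<epsilon>"
  obtains R where
    "\<And>x z. z \<le> x \<Longrightarrow> G0 S (min x R) + h2 * max (x - R) 0 \<le> G0 S z + h2 * (x - z) + \<epsilon>"
    "\<And>y. ennreal (V0 S) \<le>
      (\<integral>\<^sup>+d. ennreal (G0 S (min (y - real d) R) + h2 * max (y - real d - R) 0) \<partial>measure_pmf (D2 S))"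
proof -
  define q where "q x = G0 S x - h2 * x" for x
  \<comment> \<open>The linear bound with slope \<open>h2\<close>, which is at most
    \<open>h1 + h2\<close>, cancels the term \<open>- h2 * x\<close>.\<close>
  have "- h2 * measure_pmf.expectation (D1 S) real \<le> q x" for x
    using exp_phi_ge_linear[of h2 "h1 + h2" pc "D1 S" x] params integrable_lead_demand
    unfolding q_def G0_eq by (simp add: algebra_simps add_increasing)
  then have bdd: "bdd_below (range q)" by (rule bdd_belowI2)
  \<comment> \<open>For \<open>h1 = 0\<close> the infimum of \<open>q\<close> need not be attained,
    hence the slack \<open>\<epsilon>\<close>.\<close>
  obtain R where R: "q R < Inf (range q) + \<epsilon>"
    using cInf_lessD[of "range q" "Inf (range q) + \<epsilon>"] assms by auto
  have qR: "q R \<le> q z + \<epsilon>" for z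
    using R cInf_lower[OF _ bdd, of "q z"] by simp
  \<comment> \<open>A convex function between \<open>z\<close> and \<open>R\<close> stays below the
    larger endpoint value. So for \<open>x \<le> R\<close>, lowering the position from
    \<open>x\<close> to \<open>z\<close> gains at most \<open>\<epsilon>\<close>.\<close>
  have conv: "q x \<le> max (q z) (q R)" if "z \<le> x" "x \<le> R" for x z
  proof (cases "z = R")
    case False
    define t where "t = (x - z) / (R - z)"
    have t: "0 \<le> t" "t \<le> 1" using that False by (auto simp: t_def)
    have x: "x = (1 - t) * z + t * R"
    proof -
      have "t * (R - z) = x - z" using False that by (simp add: t_def)
      then show ?thesis by (simp add: algebra_simps)
    qed
    have "q x \<le> (1 - t) * q z + t * q R"
      using exp_phi_convex[OF _ _ t integrable_lead_demand(1), of "h1 + h2" pc z R] params x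
      unfolding q_def G0_eq x by (simp add: algebra_simps)
    also have "\<dots> \<le> (1 - t) * max (q z) (q R) + t * max (q z) (q R)"
      using t by (intro add_mono mult_left_mono) auto
    finally show ?thesis by (simp add: algebra_simps)
  qed (use that in auto)
  show ?thesis
  proof (rule that)
    fix x z :: real assume "z \<le> x"
    show "G0 S (min x R) + h2 * max (x - R) 0 \<le> G0 S z + h2 * (x - z) + \<epsilon>"
    proof (cases "x \<le> R")
      case True
      have "q x \<le> q z + \<epsilon>" using conv[OF \<open>z \<le> x\<close> True] qR[of z] assms by simp
      then show ?thesis using True by (simp add: q_def min_def max_def algebra_simps)
    next
      case False
      then show ?thesis using qR[of z] by (simp add: q_def min_def max_def algebra_simps)
    qed
  next
    fix y :: real
    define f where "f d = G0 S (min (y - real d) R) + h2 * max (y - real d - R) 0" for d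
    have f: "0 \<le> f d" for d
      using params by (auto simp: f_def G0_eq exp_phi_nonneg intro!: add_nonneg_nonneg)
    \<comment> \<open>Trial values for the infimum: with \<open>r = R\<close> and local base stock
      \<open>y - R\<close>, the argument of \<open>G0\<close> becomes \<open>min (y - d) R\<close>
      and the stock left at Stage 2 becomes the excess over \<open>R\<close>.\<close>
    have "V0 S \<le> (case (R, y - R) of (r, y) \<Rightarrow> measure_pmf.expectation (D2 S)
       (\<lambda>d. G0 S (r - max (- (y - real d)) 0) + h2 * max (y - real d) 0))"
      unfolding V0_def
    proof (rule cINF_lower)
      show "bdd_below (range (\<lambda>(r, y). measure_pmf.expectation (D2 S)
       (\<lambda>d. G0 S (r - max (- (y - real d)) 0) + h2 * max (y - real d) 0)))"
        using params by (intro bdd_belowI2[where m=0])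
          (auto simp: G0_eq exp_phi_nonneg intro!: Bochner_Integration.integral_nonneg add_nonneg_nonneg)
    qed simp
    also have "\<dots> = measure_pmf.expectation (D2 S) f"
    proof -
      have "R - max (- (y - R - real d)) 0 = min (y - real d) R" for d
        by (simp add: min_def max_def)
      moreover have "y - R - real d = y - real d - R" for d by simp
      ultimately show ?thesis by (simp only: f_def[abs_def] case_prod_conv)
    qed
    finally have V: "V0 S \<le> measure_pmf.expectation (D2 S) f" .
    show "ennreal (V0 S) \<le> (\<integral>\<^sup>+d. ennreal (f d) \<partial>measure_pmf (D2 S))"
    proof (cases "integrable (measure_pmf (D2 S)) f")
      case True
      then show ?thesis using V f by (simp add: nn_integral_eq_integral ennreal_leI)
    next
      case False
      \<comment> \<open>The Bochner integral of a non-integrable function is 0, so here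
        \<open>V0 S \<le> 0\<close> and its \<open>ennreal\<close> value is 0.\<close>
      then show ?thesis using V by (simp add: not_integrable_integral_eq ennreal_neg)
    qed
  qed
qed

end

section \<open>Demand windows\<close>

lemma measurable_count_space2:
  fixes X :: "'a \<Rightarrow> 'b::countable"
  assumes "X \<in> M \<rightarrow>\<^sub>M count_space UNIV" "Y \<in> M \<rightarrow>\<^sub>M count_space UNIV" "\<And>x y. h x y \<in> space L"
  shows "(\<lambda>\<omega>. h (X \<omega>) (Y \<omega>)) \<in> M \<rightarrow>\<^sub>M L"
  by (rule measurable_compose_countable[OF _ assms(1)])
    (rule measurable_compose[OF assms(2)], use assms(3) in simp)

text \<open>The level sets of the limit are the limits inferior of the level sets of the
  approximations.\<close>

lemma measurable_eventually_eq:
  fixes f :: "'a \<Rightarrow> 'b::countable"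
  assumes g: "\<And>n. g n \<in> M \<rightarrow>\<^sub>M count_space UNIV"
    and ev: "\<And>\<omega>. \<omega> \<in> space M \<Longrightarrow> \<forall>\<^sub>F n in sequentially. g n \<omega> = f \<omega>"
  shows "f \<in> M \<rightarrow>\<^sub>M count_space UNIV"
proof -
  have "f -` {y} \<inter> space M \<in> sets M" for y
  proof -
    have "f -` {y} \<inter> space M = (\<Union>m. \<Inter>n\<in>{m..}. g n -` {y} \<inter> space M)"
    proof (intro equalityI subsetI)
      fix \<omega> assume \<omega>: "\<omega> \<in> f -` {y} \<inter> space M"
      then obtain m where "\<And>n. m \<le> n \<Longrightarrow> g n \<omega> = f \<omega>"
        using ev unfolding eventually_sequentially by blast
      then show "\<omega> \<in> (\<Union>m. \<Inter>n\<in>{m..}. g n -` {y} \<inter> space M)"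
        using \<omega> by auto
    next
      fix \<omega> assume "\<omega> \<in> (\<Union>m. \<Inter>n\<in>{m..}. g n -` {y} \<inter> space M)"
      then obtain m where m: "\<And>n. m \<le> n \<Longrightarrow> g n \<omega> = y \<and> \<omega> \<in> space M" by auto
      then have "\<omega> \<in> space M" by blast
      then obtain m' where m': "\<And>n. m' \<le> n \<Longrightarrow> g n \<omega> = f \<omega>"
        using ev unfolding eventually_sequentially by blast
      show "\<omega> \<in> f -` {y} \<inter> space M"
        using m[of "max m m'"] m'[of "max m m'"] by auto
    qed
    moreover have "(\<Union>m. \<Inter>n\<in>{m..}. g n -` {y} \<inter> space M) \<in> sets M"
      using measurable_sets[OF g, of "{y}"]
      by (intro sets.countable_UN sets.countable_INT image_subsetI) auto
    ultimately show ?thesis by simp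
  qed
  then show ?thesis by (subst measurable_count_space_eq2_countable) auto
qed

text \<open>Time is replaced by the next multiple of \<open>1 / (n + 1)\<close> strictly to its
  right. The approximation is a countable gluing of fixed-time variables, and right-continuity makes
  it eventually exact.\<close>

lemma measurable_right_continuous_process:
  fixes X :: "real \<Rightarrow> 'a \<Rightarrow> int"
  assumes X: "\<And>t. X t \<in> M \<rightarrow>\<^sub>M count_space UNIV"
    and rc: "\<And>\<omega> t. \<omega> \<in> space M \<Longrightarrow> continuous (at_right t) (\<lambda>s. X s \<omega>)"
  shows "(\<lambda>z. X (fst z) (snd z)) \<in> borel \<Otimes>\<^sub>M M \<rightarrow>\<^sub>M count_space UNIV"
proof (rule measurable_eventually_eq)
  let ?g = "\<lambda>n t. (of_int \<lfloor>t * real (Suc n)\<rfloor> + 1) / real (Suc n)"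
  fix n
  have 1: "(\<lambda>z. \<lfloor>fst z * real (Suc n)\<rfloor>) \<in> borel \<Otimes>\<^sub>M M \<rightarrow>\<^sub>M count_space UNIV" by measurable
  have 2: "(\<lambda>z. X ((of_int k + 1) / real (Suc n)) (snd z)) \<in> borel \<Otimes>\<^sub>M M \<rightarrow>\<^sub>M count_space UNIV" for k
    using X by measurable
  show "(\<lambda>z. X (?g n (fst z)) (snd z)) \<in> borel \<Otimes>\<^sub>M M \<rightarrow>\<^sub>M count_space UNIV"
    by (rule measurable_compose_countable[OF 2 1])
next
  let ?g = "\<lambda>n t. (of_int \<lfloor>t * real (Suc n)\<rfloor> + 1) / real (Suc n)"
  fix z :: "real \<times> 'a"
  assume "z \<in> space (borel \<Otimes>\<^sub>M M)"
  then have "snd z \<in> space M" by (auto simp: space_pair_measure)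
  then obtain b where b: "fst z < b" "\<And>s. fst z \<le> s \<Longrightarrow> s < b \<Longrightarrow> X s (snd z) = X (fst z) (snd z)"
    using right_continuous_int[OF rc] by metis
  have "\<forall>\<^sub>F n in sequentially. inverse (real (Suc n)) < b - fst z"
    using b(1) by (intro order_tendstoD(2)[OF LIMSEQ_inverse_real_of_nat]) simp
  then show "\<forall>\<^sub>F n in sequentially. X (?g n (fst z)) (snd z) = X (fst z) (snd z)"
  proof eventually_elim
    case (elim n)
    have "fst z * real (Suc n) < of_int \<lfloor>fst z * real (Suc n)\<rfloor> + 1"
      by linarith
    then have "fst z \<le> ?g n (fst z)"
      by (simp add: pos_le_divide_eq del: of_nat_Suc)
    moreover have "?g n (fst z) \<le> (fst z * real (Suc n) + 1) / real (Suc n)"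
      by (intro divide_right_mono) auto
    then have "?g n (fst z) \<le> fst z + inverse (real (Suc n))"
      by (simp add: add_divide_distrib inverse_eq_divide del: of_nat_Suc)
    ultimately show ?case using elim by (intro b(2)) linarith+
  qed
qed

text \<open>Freezing a path before time 0 turns demand into a process on the whole line without
  changing it on nonnegative times.\<close>

lemma right_continuous_max_0:
  fixes f :: "real \<Rightarrow> int"
  assumes "\<And>t. 0 \<le> t \<Longrightarrow> continuous (at_right t) f"
  shows "continuous (at_right t) (\<lambda>t. f (max 0 t))"
proof -
  have "\<exists>b>t. \<forall>s. t < s \<longrightarrow> s < b \<longrightarrow> f (max 0 s) = f (max 0 t)"
  proof (cases "0 \<le> t")
    case True
    obtain b where "t < b" and b: "\<And>s. t \<le> s \<Longrightarrow> s < b \<Longrightarrow> f s = f t"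
      using right_continuous_int[OF assms[OF True]] by metis
    show ?thesis
    proof (intro exI[of _ b] conjI allI impI)
      show "f (max 0 s) = f (max 0 t)" if "t < s" "s < b" for s
        using True that b[of s] by simp
    qed fact
  next
    case False
    then show ?thesis by (intro exI[of _ 0]) (auto simp: max_def)
  qed
  then show ?thesis
    by (simp add: continuous_within tendsto_discrete eventually_at_right_field)
qed

lemma borel_measurable_right_continuous_int:
  fixes f :: "real \<Rightarrow> int"
  assumes "\<And>t. 0 \<le> t \<Longrightarrow> continuous (at_right t) f"
  shows "(\<lambda>t. f (max 0 t)) \<in> borel \<rightarrow>\<^sub>M count_space UNIV"
proof -
  \<comment> \<open>A single path is treated as a process on a one-point sample space.\<close>
  have "(\<lambda>z. (\<lambda>t _. f (max 0 t)) (fst z) (snd z)) \<in> borel \<Otimes>\<^sub>M count_space (UNIV :: unit set) \<rightarrow>\<^sub>M count_space UNIV"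
    by (rule measurable_right_continuous_process) (auto intro: right_continuous_max_0 assms)
  from measurable_compose[OF measurable_Pair2'[of "()"] this] show ?thesis by simp
qed

context sample_path
begin

text \<open>The cost at the current position, charged if a demand occurs in
  \<open>{t<..t + \<delta>}\<close>. Divided by \<open>\<delta>\<close> and integrated over time, it
  approximates the sum of \<open>f\<close> over the positions just before demands; at fixed
  \<open>t\<close> the two factors are independent.\<close>

definition window :: "(int \<Rightarrow> real) \<Rightarrow> real \<Rightarrow> real \<Rightarrow> ennreal" where
  "window f \<delta> t = ennreal (f (position t)) * of_bool (N t < N (t + \<delta>))"

lemma window_measurable:
  assumes "0 \<le> \<delta>"
  shows "(\<lambda>t. window f \<delta> t * indicator {0..b} t) \<in> borel_measurable borel"
proof -
  have N[measurable]: "(\<lambda>t. N (max 0 t)) \<in> borel \<rightarrow>\<^sub>M count_space UNIV"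
    by (rule borel_measurable_right_continuous_int) (rule demand_right_continuous)
  have U: "(\<lambda>t. U (max 0 t)) \<in> borel \<rightarrow>\<^sub>M count_space UNIV"
    by (rule borel_measurable_right_continuous_int) (rule dispatched_right_continuous)
  have N': "(\<lambda>t. N (max 0 (t + \<delta>))) \<in> borel \<rightarrow>\<^sub>M count_space UNIV"
    by measurable
  have "(\<lambda>t. ennreal (f (offset P i \<omega> + U (max 0 t) - N (max 0 t)))) \<in> borel_measurable borel"
    by (rule measurable_count_space2[OF U N]) simp
  moreover have "(\<lambda>t. of_bool (N (max 0 t) < N (max 0 (t + \<delta>))) :: ennreal) \<in> borel_measurable borel"
    by (rule measurable_count_space2[OF N N']) simp
  ultimately have "(\<lambda>t. ennreal (f (offset P i \<omega> + U (max 0 t) - N (max 0 t))) *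
      of_bool (N (max 0 t) < N (max 0 (t + \<delta>))) * indicator {0..b} t) \<in> borel_measurable borel"
    by measurable
  also have "(\<lambda>t. ennreal (f (offset P i \<omega> + U (max 0 t) - N (max 0 t))) *
      of_bool (N (max 0 t) < N (max 0 (t + \<delta>))) * indicator {0..b} t) =
      (\<lambda>t. window f \<delta> t * indicator {0..b} t)"
    using assms by (auto simp: window_def inv_position_def indicator_def)
  finally show ?thesis .
qed

text \<open>
  For small \<open>\<delta>\<close> the windows \<open>[t - \<delta>, t)\<close> before the demand times \<open>t\<close> are disjoint, and the
  position is constant on each of them.
\<close>

lemma demand_cost_le_windows:
  assumes f: "\<And>x. 0 \<le> f x" and "0 \<le> T"
  shows "\<exists>\<delta>0>0. \<forall>\<delta>. 0 < \<delta> \<longrightarrow> \<delta> < \<delta>0 \<longrightarrow>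
    ennreal (\<delta> * path_weight (step_cost f 0) (position_path P i T \<omega>)) \<le>
    (\<integral>\<^sup>+t\<in>{0..T}. window f \<delta> t \<partial>lborel)"
  using assms(2)
proof (induction rule: event_induct)
  case zero
  have "path_weight w [x, y] = w x y" for w x y
    using path_weight_snoc[of "[x]" w y] by simp
  moreover have "0 \<le> jump U 0"
    using jump_dispatched_nonneg .
  ultimately have "path_weight (step_cost f 0) (position_path P i 0 \<omega>) = 0"
    by (simp add: position_path_0 step_cost_def)
  then show ?case by (intro exI[of _ 1]) simp
next
  case (step a b)
  let ?W = "\<lambda>b. path_weight (step_cost f 0) (position_path P i b \<omega>)"
  have pa: "position_path P i a \<omega> \<noteq> []" "last (position_path P i a \<omega>) = position a"
    using position_path_facts[OF step(1)] by auto
  note gap = jumps_after_gap[OF step(1-3)]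
  have W: "?W b = ?W a + (if N a < N b then f (position a) else 0)"
    unfolding position_path_step[OF step(1-3)] using pa gap
    by (auto simp: path_weight_snoc inv_position_def step_cost_def append_assoc[symmetric]
        simp del: append_assoc)
  obtain \<delta>0 where \<delta>0: "0 < \<delta>0" and IH: "\<And>\<delta>. 0 < \<delta> \<Longrightarrow> \<delta> < \<delta>0 \<Longrightarrow>
      ennreal (\<delta> * ?W a) \<le> (\<integral>\<^sup>+t\<in>{0..a}. window f \<delta> t \<partial>lborel)"
    using step(4) by blast
  show ?case
  proof (intro exI[of _ "min \<delta>0 (b - a)"] conjI allI impI)
    show "0 < min \<delta>0 (b - a)" using \<delta>0 step(2) by simp
    fix \<delta> :: real assume \<delta>: "0 < \<delta>" "\<delta> < min \<delta>0 (b - a)"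
    define c where "c = (if N a < N b then f (position a) else 0)"
    have c: "0 \<le> c" by (simp add: c_def f)
    have Wa: "0 \<le> ?W a" by (intro path_weight_nonneg) (simp add: step_cost_def f)
    have "ennreal (\<delta> * ?W b) = ennreal (\<delta> * ?W a) + ennreal (\<delta> * c)"
      using \<delta> c Wa by (subst ennreal_plus[symmetric]) (auto simp: W c_def[symmetric] distrib_left)
    also have "\<dots> \<le> (\<integral>\<^sup>+t\<in>{0..a}. window f \<delta> t \<partial>lborel) + ennreal (\<delta> * c)"
      using IH[of \<delta>] \<delta> by (intro add_mono) auto
    also have "ennreal (\<delta> * c) = (\<integral>\<^sup>+t. ennreal c * indicator {b - \<delta>..<b} t \<partial>lborel)"
      using \<delta> c by (subst nn_integral_cmult_indicator) (auto simp: ennreal_mult mult.commute)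
    also have "(\<integral>\<^sup>+t\<in>{0..a}. window f \<delta> t \<partial>lborel) + \<dots> =
        (\<integral>\<^sup>+t. window f \<delta> t * indicator {0..a} t + ennreal c * indicator {b - \<delta>..<b} t \<partial>lborel)"
      using \<delta> by (intro nn_integral_add[symmetric]) (auto simp: window_measurable)
    also have "\<dots> \<le> (\<integral>\<^sup>+t\<in>{0..b}. window f \<delta> t \<partial>lborel)"
    proof (rule nn_integral_mono)
      fix t
      \<comment> \<open>Since \<open>\<delta> < b - a\<close>, such a \<open>t\<close> lies after
        \<open>a\<close>, where the position is still that at \<open>a\<close>; and
        \<open>t + \<delta>\<close> reaches \<open>b\<close>, so a demand at \<open>b\<close> is
        seen.\<close>
      have "ennreal c \<le> window f \<delta> t" if t: "b - \<delta> \<le> t" "t < b"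
      proof -
        have at: "a < t" using t \<delta> by simp
        have "N t = N a" "U t = U a"
          using step(1-3) t at by (intro constant_between_events; auto)+
        moreover have "N b \<le> N (t + \<delta>)"
          using mono_onD[OF demand_mono, of b "t + \<delta>"] t step(1,2) by simp
        ultimately show ?thesis
          by (auto simp: window_def c_def inv_position_def)
      qed
      then show "window f \<delta> t * indicator {0..a} t + ennreal c * indicator {b - \<delta>..<b} t
          \<le> window f \<delta> t * indicator {0..b} t"
        using \<delta> step(1,2) by (auto simp: indicator_def)
    qed
    finally show "ennreal (\<delta> * ?W b) \<le> (\<integral>\<^sup>+t\<in>{0..b}. window f \<delta> t \<partial>lborel)" .
  qed
qed

end

section \<open>Occupation costs of a policy\<close>

locale admissible_policy =
  fixes S :: instance_data and P :: "'w policy"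
  assumes valid: "valid_instance S" and admissible: "admissible S P"
begin

abbreviation "M \<equiv> prob_of P"
abbreviation "demand_rate \<equiv> rate S"

sublocale prob_space M
  using admissible by (simp add: admissible_def)

section \<open>Information and independent demand increments\<close>

lemma sample_path:
  assumes "\<omega> \<in> space M"
  shows "sample_path P i \<omega>"
  using assms admissible
  unfolding admissible_def poisson_demand_def feasible_paths_def sample_path_def by blast

lemma measurable_info:
  assumes "X \<in> info P t \<rightarrow>\<^sub>M L"
  shows "X \<in> M \<rightarrow>\<^sub>M L"
proof (rule measurable_mono[OF order.refl refl _ _, THEN subsetD, OF _ _ assms])
  show "sets (info P t) \<subseteq> sets M" "space (info P t) = space M"
    using admissible by (auto simp: admissible_def nonanticipating_def filtration_def)
qed

lemma info_mono:
  assumes "s \<le> t" "X \<in> info P s \<rightarrow>\<^sub>M L"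
  shows "X \<in> info P t \<rightarrow>\<^sub>M L"
proof (rule measurable_mono[OF order.refl refl _ _, THEN subsetD, OF _ _ assms(2)])
  show "sets (info P s) \<subseteq> sets (info P t)" "space (info P s) = space (info P t)"
    using admissible assms(1) by (auto simp: admissible_def nonanticipating_def filtration_def)
qed

lemma info_measurable:
  shows "0 \<le> t \<Longrightarrow> demand P t \<in> info P t \<rightarrow>\<^sub>M count_space UNIV"
    and "0 \<le> t \<Longrightarrow> offset P i \<in> info P t \<rightarrow>\<^sub>M count_space UNIV"
    and "dispatched P i t \<in> info P t \<rightarrow>\<^sub>M count_space UNIV"
proof -
  have *: "nonanticipating P" "poisson_demand S P"
    using admissible by (simp_all add: admissible_def)
  show "demand P t \<in> info P t \<rightarrow>\<^sub>M count_space UNIV" if "0 \<le> t"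
    using * that unfolding poisson_demand_def by blast
  show "offset P i \<in> info P t \<rightarrow>\<^sub>M count_space UNIV" if "0 \<le> t"
    using * unfolding nonanticipating_def by (intro info_mono[OF that]) blast
  show "dispatched P i t \<in> info P t \<rightarrow>\<^sub>M count_space UNIV"
    using * unfolding nonanticipating_def by blast
qed

lemma inv_position_info:
  assumes "0 \<le> t"
  shows "inv_position P i t \<in> info P t \<rightarrow>\<^sub>M count_space UNIV"
proof -
  have "(\<lambda>\<omega>. offset P i \<omega> + dispatched P i t \<omega>) \<in> info P t \<rightarrow>\<^sub>M count_space UNIV"
    by (rule measurable_count_space2[OF info_measurable(2,3)]) (use assms in auto)
  then have "(\<lambda>\<omega>. (offset P i \<omega> + dispatched P i t \<omega>) - demand P t \<omega>) \<in> info P t \<rightarrow>\<^sub>M count_space UNIV"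
    by (rule measurable_count_space2[OF _ info_measurable(1)]) (use assms in auto)
  then show ?thesis by (simp add: inv_position_def[abs_def])
qed

lemma demand_increment_measurable:
  assumes "0 \<le> t" "0 \<le> l"
  shows "(\<lambda>\<omega>. demand P (t + l) \<omega> - demand P t \<omega>) \<in> M \<rightarrow>\<^sub>M count_space UNIV"
  by (rule measurable_count_space2[OF measurable_info[OF info_measurable(1)] measurable_info[OF info_measurable(1)]])
    (use assms in auto)

lemma nn_integral_demand_increment:
  fixes g :: "int \<Rightarrow> ennreal"
  assumes "0 \<le> t" "0 \<le> l"
  shows "(\<integral>\<^sup>+\<omega>. g (demand P (t + l) \<omega> - demand P t \<omega>) \<partial>M) =
    (\<integral>\<^sup>+n. g (int n) \<partial>measure_pmf (poisson (demand_rate * l)))"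
proof -
  note D = demand_increment_measurable[OF assms]
  have "distr M (count_space UNIV) (\<lambda>\<omega>. demand P (t + l) \<omega> - demand P t \<omega>) =
      measure_pmf (map_pmf int (poisson (demand_rate * (t + l - t))))"
    using admissible assms unfolding admissible_def poisson_demand_def by (metis le_add_same_cancel1)
  then have "distr M (count_space UNIV) (\<lambda>\<omega>. demand P (t + l) \<omega> - demand P t \<omega>) =
      measure_pmf (map_pmf int (poisson (demand_rate * l)))"
    by simp
  moreover have "(\<integral>\<^sup>+\<omega>. g (demand P (t + l) \<omega> - demand P t \<omega>) \<partial>M) =
      (\<integral>\<^sup>+d. g d \<partial>distr M (count_space UNIV) (\<lambda>\<omega>. demand P (t + l) \<omega> - demand P t \<omega>))"
    by (subst nn_integral_distr[OF D]) auto
  ultimately show ?thesis by simp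
qed

text \<open>\<open>X\<close> is known at time \<open>t\<close> and the later demand increment is
  independent of it, so the joint law is a product and Tonelli integrates the increment out at
  frozen \<open>X\<close>. This takes the place of conditional expectations.\<close>

lemma nn_integral_independent_increment:
  fixes g :: "int \<Rightarrow> int \<Rightarrow> ennreal"
  assumes "0 \<le> t" "0 \<le> l" and X: "X \<in> info P t \<rightarrow>\<^sub>M count_space UNIV"
  shows "(\<integral>\<^sup>+\<omega>. g (X \<omega>) (demand P (t + l) \<omega> - demand P t \<omega>) \<partial>M) =
    (\<integral>\<^sup>+\<omega>. (\<integral>\<^sup>+n. g (X \<omega>) (int n) \<partial>measure_pmf (poisson (demand_rate * l))) \<partial>M)"
proof -
  define D where "D = (\<lambda>\<omega>. demand P (t + l) \<omega> - demand P t \<omega>)"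
  let ?c = "count_space (UNIV :: int set)"
  have D: "D \<in> M \<rightarrow>\<^sub>M ?c"
    unfolding D_def by (rule demand_increment_measurable[OF assms(1,2)])
  have XM: "X \<in> M \<rightarrow>\<^sub>M ?c" by (rule measurable_info[OF X])
  have sp: "space (info P t) = space M"
    using admissible by (simp add: admissible_def nonanticipating_def filtration_def)
  have "indep_set (sets (info P t)) (sets (vimage_algebra (space M) D ?c))"
    using admissible assms unfolding admissible_def poisson_demand_def D_def
    by (metis le_add_same_cancel1)
  then have "indep_set (sigma_sets (space M) {X -` A \<inter> space M |A. A \<in> sets ?c})
      (sigma_sets (space M) {D -` A \<inter> space M |A. A \<in> sets ?c})"
    unfolding indep_set_def
  proof (rule indep_sets_mono_sets)
    have "sigma_sets (space M) {X -` A \<inter> space M |A. A \<in> sets ?c} \<subseteq> sets (info P t)"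
      using sets.sigma_sets_subset[of "{X -` A \<inter> space M |A. A \<in> sets ?c}" "info P t"]
        measurable_sets[OF X] by (auto simp: sp)
    then show "(case b of True \<Rightarrow> sigma_sets (space M) {X -` A \<inter> space M |A. A \<in> sets ?c}
        | False \<Rightarrow> sigma_sets (space M) {D -` A \<inter> space M |A. A \<in> sets ?c}) \<subseteq>
        (case b of True \<Rightarrow> sets (info P t) | False \<Rightarrow> sets (vimage_algebra (space M) D ?c))" for b
      by (cases b) (simp_all add: sets_vimage_algebra)
  qed
  then have "indep_var ?c X ?c D"
    unfolding indep_var_eq using XM D by simp
  then have joint: "distr M ?c X \<Otimes>\<^sub>M distr M ?c D = distr M (?c \<Otimes>\<^sub>M ?c) (\<lambda>\<omega>. (X \<omega>, D \<omega>))"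
    using indep_var_distribution_eq by blast
  interpret D: prob_space "distr M ?c D" by (rule prob_space_distr[OF D])
  have g: "(\<lambda>z. g (fst z) (snd z)) \<in> borel_measurable (?c \<Otimes>\<^sub>M ?c)"
    by (simp add: pair_measure_countable)
  have g': "(\<lambda>z. g (fst z) (snd z)) \<in> borel_measurable (?c \<Otimes>\<^sub>M distr M ?c D)"
    by (subst measurable_cong_sets[OF sets_pair_measure_cong[OF refl sets_distr] refl]) (rule g)
  have g'': "(\<lambda>z. g (fst z) (snd z)) \<in> borel_measurable (distr M ?c X \<Otimes>\<^sub>M distr M ?c D)"
    by (subst measurable_cong_sets[OF sets_pair_measure_cong[OF sets_distr sets_distr] refl]) (rule g)
  have "(\<integral>\<^sup>+\<omega>. g (X \<omega>) (D \<omega>) \<partial>M) =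
      (\<integral>\<^sup>+z. g (fst z) (snd z) \<partial>distr M (?c \<Otimes>\<^sub>M ?c) (\<lambda>\<omega>. (X \<omega>, D \<omega>)))"
    using XM D g by (subst nn_integral_distr) (auto intro!: measurable_Pair)
  also have "\<dots> = (\<integral>\<^sup>+x. (\<integral>\<^sup>+d. g x d \<partial>distr M ?c D) \<partial>distr M ?c X)"
    unfolding joint[symmetric] by (subst D.nn_integral_fst[OF g'', symmetric]) simp
  also have "\<dots> = (\<integral>\<^sup>+\<omega>. (\<integral>\<^sup>+d. g (X \<omega>) d \<partial>distr M ?c D) \<partial>M)"
    by (subst nn_integral_distr[OF XM]) auto
  also have "\<dots> = (\<integral>\<^sup>+\<omega>. (\<integral>\<^sup>+n. g (X \<omega>) (int n) \<partial>measure_pmf (poisson (demand_rate * l))) \<partial>M)"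
  proof (intro nn_integral_cong)
    fix \<omega>
    have "(\<integral>\<^sup>+d. g (X \<omega>) d \<partial>distr M ?c D) = (\<integral>\<^sup>+\<omega>'. g (X \<omega>) (D \<omega>') \<partial>M)"
      by (rule nn_integral_distr[OF D]) simp
    then show "(\<integral>\<^sup>+d. g (X \<omega>) d \<partial>distr M ?c D) =
        (\<integral>\<^sup>+n. g (X \<omega>) (int n) \<partial>measure_pmf (poisson (demand_rate * l)))"
      using nn_integral_demand_increment[OF assms(1,2), of "g (X \<omega>)"] by (simp add: D_def)
  qed
  finally show ?thesis by (simp add: D_def)
qed

section \<open>Joint measurability in time and sample point\<close>

lemma demand_joint: "(\<lambda>z. demand P (max 0 (fst z)) (snd z)) \<in> borel \<Otimes>\<^sub>M M \<rightarrow>\<^sub>M count_space UNIV"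
proof (rule measurable_right_continuous_process)
  show "demand P (max 0 t) \<in> M \<rightarrow>\<^sub>M count_space UNIV" for t
    by (intro measurable_info[OF info_measurable(1)]) simp
  show "continuous (at_right t) (\<lambda>s. demand P (max 0 s) \<omega>)" if "\<omega> \<in> space M" for \<omega> t
    using sample_path.demand_right_continuous[OF sample_path[OF that]]
    by (rule right_continuous_max_0)
qed

lemma dispatched_joint: "(\<lambda>z. dispatched P i (fst z) (snd z)) \<in> borel \<Otimes>\<^sub>M M \<rightarrow>\<^sub>M count_space UNIV"
proof (rule measurable_right_continuous_process)
  show "dispatched P i t \<in> M \<rightarrow>\<^sub>M count_space UNIV" for t
    by (intro measurable_info[OF info_measurable(3)])
  show "continuous (at_right t) (\<lambda>s. dispatched P i s \<omega>)" if "\<omega> \<in> space M" for \<omega> t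
    using sample_path.dispatched_right_continuous[OF sample_path[OF that]] .
qed

lemma offset_joint: "(\<lambda>z. offset P i (snd z)) \<in> borel \<Otimes>\<^sub>M M \<rightarrow>\<^sub>M count_space UNIV"
  by (intro measurable_compose[OF measurable_snd] measurable_info[OF info_measurable(2)[of 0]]) simp

lemma demand_joint_shift:
  "(\<lambda>z. demand P (max 0 (fst z + d)) (snd z)) \<in> borel \<Otimes>\<^sub>M M \<rightarrow>\<^sub>M count_space UNIV"
  using measurable_compose[OF _ demand_joint, of "\<lambda>z. (fst z + d, snd z)" "borel \<Otimes>\<^sub>M M"] by simp

lemma dispatched_joint_shift:
  "(\<lambda>z. dispatched P i (fst z + d) (snd z)) \<in> borel \<Otimes>\<^sub>M M \<rightarrow>\<^sub>M count_space UNIV"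
  using measurable_compose[OF _ dispatched_joint, of "\<lambda>z. (fst z + d, snd z)" "borel \<Otimes>\<^sub>M M"] by simp

lemma inv_level_joint:
  "(\<lambda>z. offset P i (snd z) + dispatched P i (fst z + d) (snd z) - demand P (max 0 (fst z + e)) (snd z))
    \<in> borel \<Otimes>\<^sub>M M \<rightarrow>\<^sub>M count_space UNIV"
  by (rule measurable_count_space2[where h="(-)", OF measurable_count_space2[where h="(+)"] demand_joint_shift])
    (auto intro: offset_joint dispatched_joint_shift)

text \<open>The integrand \<open>g\<close> has to agree with the measurable \<open>h\<close> only
  for times in \<open>A\<close>. This matters because demand is jointly measurable only after
  freezing it before time 0. The three measurability facts are by-products of the same product
  function.\<close>

lemma nn_integral_swap:
  fixes h :: "real \<times> 'w \<Rightarrow> ennreal"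
  assumes h: "h \<in> borel_measurable (borel \<Otimes>\<^sub>M M)" and "A \<in> sets borel"
    and eq: "\<forall>t\<in>A. \<forall>\<omega>\<in>space M. g t \<omega> = h (t, \<omega>)"
  shows "(\<integral>\<^sup>+\<omega>. (\<integral>\<^sup>+t\<in>A. g t \<omega> \<partial>lborel) \<partial>M) = (\<integral>\<^sup>+t\<in>A. (\<integral>\<^sup>+\<omega>. g t \<omega> \<partial>M) \<partial>lborel)" (is ?swap)
    and "\<omega> \<in> space M \<Longrightarrow> (\<lambda>t. g t \<omega> * indicator A t) \<in> borel_measurable borel" (is "_ \<Longrightarrow> ?meas")
    and "(\<lambda>\<omega>. \<integral>\<^sup>+t\<in>A. g t \<omega> \<partial>lborel) \<in> borel_measurable M" (is ?measM)
    and "(\<lambda>t. (\<integral>\<^sup>+\<omega>. g t \<omega> \<partial>M) * indicator A t) \<in> borel_measurable borel" (is ?measT)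
proof -
  interpret pair_sigma_finite lborel M by unfold_locales
  note [measurable] = h assms(2)
  let ?h = "\<lambda>z. h z * indicator A (fst z)"
  have ind: "(\<lambda>z. indicator A (fst z) :: ennreal) \<in> borel_measurable (lborel \<Otimes>\<^sub>M M)"
    by measurable
  have hl: "h \<in> borel_measurable (lborel \<Otimes>\<^sub>M M)"
    by measurable
  have H: "?h \<in> borel_measurable (lborel \<Otimes>\<^sub>M M)"
    using hl ind by measurable
  have 1: "(\<integral>\<^sup>+t\<in>A. g t \<omega> \<partial>lborel) = (\<integral>\<^sup>+t. ?h (t, \<omega>) \<partial>lborel)" if "\<omega> \<in> space M" for \<omega>
    using that eq by (intro nn_integral_cong) (simp add: indicator_def)
  have 2: "(\<integral>\<^sup>+\<omega>. g t \<omega> \<partial>M) * indicator A t = (\<integral>\<^sup>+\<omega>. ?h (t, \<omega>) \<partial>M)" for t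
    using eq by (cases "t \<in> A") (auto intro!: nn_integral_cong)
  have "(\<integral>\<^sup>+\<omega>. (\<integral>\<^sup>+t\<in>A. g t \<omega> \<partial>lborel) \<partial>M) = (\<integral>\<^sup>+\<omega>. (\<integral>\<^sup>+t. ?h (t, \<omega>) \<partial>lborel) \<partial>M)"
    using 1 by (rule nn_integral_cong)
  also have "\<dots> = (\<integral>\<^sup>+t. (\<integral>\<^sup>+\<omega>. ?h (t, \<omega>) \<partial>M) \<partial>lborel)"
    by (rule Fubini[OF H])
  finally show ?swap using 2 by simp
  show ?meas if "\<omega> \<in> space M"
  proof -
    have "(\<lambda>t. ?h (t, \<omega>)) \<in> borel_measurable lborel"
      using measurable_compose[OF measurable_Pair2'[OF that] H] .
    moreover have "g t \<omega> * indicator A t = ?h (t, \<omega>)" for t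
      using eq that by (simp add: indicator_def)
    ultimately show ?thesis by simp
  qed
  have "(\<lambda>\<omega>. \<integral>\<^sup>+t. ?h (t, \<omega>) \<partial>lborel) \<in> borel_measurable M"
    using H by measurable
  then show ?measM using 1 by (subst measurable_cong) auto
  have "(\<lambda>t. \<integral>\<^sup>+\<omega>. ?h (t, \<omega>) \<partial>M) \<in> borel_measurable lborel"
    using H by measurable
  then show ?measT using 2 by simp
qed

lemma position_joint:
  "(\<lambda>z. f (offset P i (snd z) + dispatched P i (fst z + 0) (snd z) - demand P (max 0 (fst z + 0)) (snd z)))
    \<in> borel_measurable (borel \<Otimes>\<^sub>M M)" for f :: "int \<Rightarrow> ennreal"
  by (rule measurable_compose[OF inv_level_joint]) simp

section \<open>The cost bound for a single stage\<close>

definition occupation :: "(real \<Rightarrow> real) \<Rightarrow> stage \<Rightarrow> real \<Rightarrow> ennreal" where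
  "occupation F i T = (\<integral>\<^sup>+t\<in>{0..T}. (\<integral>\<^sup>+\<omega>. ennreal (F (inv_position P i t \<omega>)) \<partial>M) \<partial>lborel)"

lemma grid_path_measurable:
  assumes "0 < h"
  shows "grid_path P i h n \<in> M \<rightarrow>\<^sub>M count_space UNIV"
proof (induction n)
  case 0
  \<comment> \<open>The initial state involves the left limit at time 0, which is eventually the
    value at \<open>- inverse (real (Suc n))\<close>.\<close>
  have "(\<lambda>\<omega>. left_lim (\<lambda>s. dispatched P i s \<omega>) 0) \<in> M \<rightarrow>\<^sub>M count_space UNIV"
  proof (rule measurable_eventually_eq)
    show "dispatched P i (- inverse (real (Suc n))) \<in> M \<rightarrow>\<^sub>M count_space UNIV" for n
      by (rule measurable_info[OF info_measurable(3)])
    fix \<omega> assume \<omega>: "\<omega> \<in> space M"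
    interpret sample_path P i \<omega> by (rule sample_path[OF \<omega>])
    have "(-1::real) < 0" by simp
    then obtain a where a: "a < 0" "\<And>s. a \<le> s \<Longrightarrow> s < 0 \<Longrightarrow> U s = left_lim U 0"
      using mono_int_left_lim[OF dispatched_mono_on] by blast
    have "\<forall>\<^sub>F n in sequentially. inverse (real (Suc n)) < - a"
      using a(1) by (intro order_tendstoD(2)[OF LIMSEQ_inverse_real_of_nat]) simp
    then show "\<forall>\<^sub>F n in sequentially. U (- inverse (real (Suc n))) = left_lim U 0"
    proof eventually_elim
      case (elim n)
      have "0 < inverse (real (Suc n))" by simp
      then show ?case using elim by (intro a(2)) linarith+
    qed
  qed
  then have J: "(\<lambda>\<omega>. jump (\<lambda>s. dispatched P i s \<omega>) 0) \<in> M \<rightarrow>\<^sub>M count_space UNIV"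
    unfolding jump_def
    by (rule measurable_count_space2[OF measurable_info[OF info_measurable(3)]]) simp
  have I: "inv_position P i 0 \<in> M \<rightarrow>\<^sub>M count_space UNIV"
    by (intro measurable_info[OF inv_position_info]) simp
  have "(\<lambda>\<omega>. (inv_position P i 0 \<omega> - jump (\<lambda>s. dispatched P i s \<omega>) 0) #
      (if 0 < jump (\<lambda>s. dispatched P i s \<omega>) 0 then [inv_position P i 0 \<omega>] else []))
      \<in> M \<rightarrow>\<^sub>M count_space UNIV"
    by (rule measurable_count_space2[OF I J, where h="\<lambda>x j. (x - j) # (if 0 < j then [x] else [])"]) simp
  moreover have eq: "grid_path P i h 0 \<omega> = (inv_position P i 0 \<omega> - jump (\<lambda>s. dispatched P i s \<omega>) 0) #
      (if 0 < jump (\<lambda>s. dispatched P i s \<omega>) 0 then [inv_position P i 0 \<omega>] else [])"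
    if "\<omega> \<in> space M" for \<omega>
    using sample_path.position_path_0[OF sample_path[OF that]] by (simp add: dispatch_at_def)
  ultimately show ?case by (subst measurable_cong[OF eq])
next
  case (Suc n)
  let ?a = "real n * h" and ?b = "real (Suc n) * h"
  have t: "0 \<le> ?a" "0 \<le> ?b" using assms by auto
  note I = measurable_info[OF inv_position_info] and N = measurable_info[OF info_measurable(1)]
    and U = measurable_info[OF info_measurable(3)]
  have 1: "(\<lambda>\<omega>. demand P ?a \<omega> < demand P ?b \<omega>) \<in> M \<rightarrow>\<^sub>M count_space UNIV"
    by (rule measurable_count_space2[OF N N]) (use t in auto)
  have 2: "(\<lambda>\<omega>. dispatched P i ?a \<omega> < dispatched P i ?b \<omega>) \<in> M \<rightarrow>\<^sub>M count_space UNIV"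
    by (rule measurable_count_space2[OF U U]) auto
  have 3: "(\<lambda>\<omega>. if demand P ?a \<omega> < demand P ?b \<omega> then [inv_position P i ?a \<omega> - 1] else [])
      \<in> M \<rightarrow>\<^sub>M count_space UNIV"
    by (rule measurable_count_space2[OF 1 I, where h="\<lambda>b x. if b then [x - 1] else []"]) (use t in auto)
  have 4: "(\<lambda>\<omega>. if dispatched P i ?a \<omega> < dispatched P i ?b \<omega> then [inv_position P i ?b \<omega>] else [])
      \<in> M \<rightarrow>\<^sub>M count_space UNIV"
    by (rule measurable_count_space2[OF 2 I, where h="\<lambda>b x. if b then [x] else []"]) (use t in auto)
  have "(\<lambda>\<omega>. grid_path P i h n \<omega> @
      ((if demand P ?a \<omega> < demand P ?b \<omega> then [inv_position P i ?a \<omega> - 1] else []) @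
      (if dispatched P i ?a \<omega> < dispatched P i ?b \<omega> then [inv_position P i ?b \<omega>] else [])))
      \<in> M \<rightarrow>\<^sub>M count_space UNIV"
    by (intro measurable_count_space2[where h="(@)", OF Suc measurable_count_space2[where h="(@)", OF 3 4]]) auto
  moreover have "grid_path P i h (Suc n) = (\<lambda>\<omega>. grid_path P i h n \<omega> @
      ((if demand P ?a \<omega> < demand P ?b \<omega> then [inv_position P i ?a \<omega> - 1] else []) @
      (if dispatched P i ?a \<omega> < dispatched P i ?b \<omega> then [inv_position P i ?b \<omega>] else [])))"
    by (intro ext) (rule grid_path.simps(2))
  ultimately show ?case by (simp only:)
qed

lemma position_path_measurable:
  assumes "0 < T"
  shows "position_path P i T \<in> M \<rightarrow>\<^sub>M count_space UNIV"
proof (rule measurable_eventually_eq)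
  show "grid_path P i (T / real (Suc n)) (Suc n) \<in> M \<rightarrow>\<^sub>M count_space UNIV" for n
    using assms by (intro grid_path_measurable) simp
  show "\<forall>\<^sub>F n in sequentially. grid_path P i (T / real (Suc n)) (Suc n) \<omega> = position_path P i T \<omega>"
    if "\<omega> \<in> space M" for \<omega>
    using sample_path.grid_path_eventually[OF sample_path[OF that] assms]
    by (rule eventually_compose_filterlim[OF _ filterlim_Suc])
qed

text \<open>For fixed \<open>t\<close> the position is known at \<open>t\<close> and independent of
  the demand in \<open>{t<..t + \<delta>}\<close>; the probability of at least one demand is at most
  the mean \<open>demand_rate * \<delta>\<close>.\<close>

lemma expected_window:
  assumes f: "\<And>x. 0 \<le> F x" and "0 < \<delta>"
  shows "(\<integral>\<^sup>+\<omega>. (\<integral>\<^sup>+t\<in>{0..T}. sample_path.window P i \<omega> (\<lambda>x. F (real_of_int x)) \<delta> t \<partial>lborel) \<partial>M) \<le>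
    ennreal (demand_rate * \<delta>) * occupation F i T"
    and "(\<lambda>\<omega>. \<integral>\<^sup>+t\<in>{0..T}. sample_path.window P i \<omega> (\<lambda>x. F (real_of_int x)) \<delta> t \<partial>lborel) \<in> borel_measurable M"
proof -
  let ?w = "\<lambda>t \<omega>. ennreal (F (inv_position P i t \<omega>)) * of_bool (demand P t \<omega> < demand P (t + \<delta>) \<omega>)"
  have w: "sample_path.window P i \<omega> (\<lambda>x. F (real_of_int x)) \<delta> t = ?w t \<omega>" if "\<omega> \<in> space M" for \<omega> t
    by (rule sample_path.window_def[OF sample_path[OF that]])
  have b: "(\<lambda>z. of_bool (demand P (max 0 (fst z)) (snd z) < demand P (max 0 (fst z + \<delta>)) (snd z)) :: ennreal)
      \<in> borel_measurable (borel \<Otimes>\<^sub>M M)"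
    by (rule measurable_count_space2[OF demand_joint demand_joint_shift]) simp
  note h = borel_measurable_times_ennreal[OF position_joint[of "\<lambda>x. ennreal (F x)" i] b]
  have eq: "\<forall>t\<in>{0..T}. \<forall>\<omega>\<in>space M. ?w t \<omega> = ennreal (F (real_of_int (offset P i (snd (t, \<omega>)) + dispatched P i (fst (t, \<omega>) + 0) (snd (t, \<omega>)) -
      demand P (max 0 (fst (t, \<omega>) + 0)) (snd (t, \<omega>))))) *
      of_bool (demand P (max 0 (fst (t, \<omega>))) (snd (t, \<omega>)) < demand P (max 0 (fst (t, \<omega>) + \<delta>)) (snd (t, \<omega>)))"
    using assms(2) by (simp add: inv_position_def)
  note swap = nn_integral_swap[OF h _ eq]
  have "(\<integral>\<^sup>+\<omega>. (\<integral>\<^sup>+t\<in>{0..T}. sample_path.window P i \<omega> (\<lambda>x. F (real_of_int x)) \<delta> t \<partial>lborel) \<partial>M) =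
      (\<integral>\<^sup>+\<omega>. (\<integral>\<^sup>+t\<in>{0..T}. ?w t \<omega> \<partial>lborel) \<partial>M)"
    using w by (intro nn_integral_cong) simp
  also have "\<dots> = (\<integral>\<^sup>+t\<in>{0..T}. (\<integral>\<^sup>+\<omega>. ?w t \<omega> \<partial>M) \<partial>lborel)"
    by (rule swap(1)) auto
  also have "\<dots> \<le> (\<integral>\<^sup>+t. ennreal (demand_rate * \<delta>) *
      ((\<integral>\<^sup>+\<omega>. ennreal (F (inv_position P i t \<omega>)) \<partial>M) * indicator {0..T} t) \<partial>lborel)"
  proof (rule nn_integral_mono)
    fix t
    show "(\<integral>\<^sup>+\<omega>. ?w t \<omega> \<partial>M) * indicator {0..T} t \<le> ennreal (demand_rate * \<delta>) *
      ((\<integral>\<^sup>+\<omega>. ennreal (F (inv_position P i t \<omega>)) \<partial>M) * indicator {0..T} t)"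
    proof (cases "t \<in> {0..T}")
      case True
      then have t: "0 \<le> t" by simp
      have "(\<integral>\<^sup>+\<omega>. ?w t \<omega> \<partial>M) = (\<integral>\<^sup>+\<omega>. (\<lambda>x d. ennreal (F (real_of_int x)) * of_bool (0 < d))
          (inv_position P i t \<omega>) (demand P (t + \<delta>) \<omega> - demand P t \<omega>) \<partial>M)"
        by (intro nn_integral_cong) simp
      also have "\<dots> = (\<integral>\<^sup>+\<omega>. (\<integral>\<^sup>+n. ennreal (F (inv_position P i t \<omega>)) * of_bool (0 < int n)
          \<partial>measure_pmf (poisson (demand_rate * \<delta>))) \<partial>M)"
        using t assms(2) by (intro nn_integral_independent_increment inv_position_info) auto
      also have "\<dots> \<le> (\<integral>\<^sup>+\<omega>. ennreal (demand_rate * \<delta>) * ennreal (F (inv_position P i t \<omega>)) \<partial>M)"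
      proof (rule nn_integral_mono)
        fix \<omega>
        have "(\<integral>\<^sup>+n. ennreal (F (inv_position P i t \<omega>)) * of_bool (0 < int n) \<partial>measure_pmf (poisson (demand_rate * \<delta>))) \<le>
          (\<integral>\<^sup>+n. ennreal (F (inv_position P i t \<omega>)) * ennreal (real n) \<partial>measure_pmf (poisson (demand_rate * \<delta>)))"
          by (intro nn_integral_mono mult_left_mono) (auto simp: of_bool_def)
        also have "\<dots> = ennreal (F (inv_position P i t \<omega>)) * ennreal (demand_rate * \<delta>)"
          using params(1)[OF valid] assms(2) by (subst nn_integral_cmult) (auto simp: nn_integral_poisson)
        finally show "(\<integral>\<^sup>+n. ennreal (F (inv_position P i t \<omega>)) * of_bool (0 < int n) \<partial>measure_pmf (poisson (demand_rate * \<delta>)))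
            \<le> ennreal (demand_rate * \<delta>) * ennreal (F (inv_position P i t \<omega>))"
          by (simp add: mult.commute)
      qed
      also have "\<dots> = ennreal (demand_rate * \<delta>) * (\<integral>\<^sup>+\<omega>. ennreal (F (inv_position P i t \<omega>)) \<partial>M)"
        by (intro nn_integral_cmult measurable_compose[OF measurable_info[OF inv_position_info[OF t]]]) simp
      finally show ?thesis using True by simp
    qed simp
  qed
  also have "\<dots> = ennreal (demand_rate * \<delta>) * occupation F i T"
    unfolding occupation_def
  proof (intro nn_integral_cmult)
    have "(\<lambda>t. (\<integral>\<^sup>+\<omega>. ennreal (F (inv_position P i t \<omega>)) \<partial>M) * indicator {0..T} t) \<in> borel_measurable borel"
      by (rule nn_integral_swap(4)[OF position_joint[of "\<lambda>x. ennreal (F x)" i]]) (auto simp: inv_position_def)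
    then show "(\<lambda>t. (\<integral>\<^sup>+\<omega>. ennreal (F (inv_position P i t \<omega>)) \<partial>M) * indicator {0..T} t) \<in> borel_measurable lborel"
      by simp
  qed
  finally show "(\<integral>\<^sup>+\<omega>. (\<integral>\<^sup>+t\<in>{0..T}. sample_path.window P i \<omega> (\<lambda>x. F (real_of_int x)) \<delta> t \<partial>lborel) \<partial>M) \<le>
    ennreal (demand_rate * \<delta>) * occupation F i T" .
  have "(\<lambda>\<omega>. \<integral>\<^sup>+t\<in>{0..T}. ?w t \<omega> \<partial>lborel) \<in> borel_measurable M"
    by (rule swap(3)) auto
  then show "(\<lambda>\<omega>. \<integral>\<^sup>+t\<in>{0..T}. sample_path.window P i \<omega> (\<lambda>x. F (real_of_int x)) \<delta> t \<partial>lborel) \<in> borel_measurable M"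
    using w by (subst measurable_cong[where g="\<lambda>\<omega>. \<integral>\<^sup>+t\<in>{0..T}. ?w t \<omega> \<partial>lborel"]) auto
qed

text \<open>This is the PASTA-type inequality. Pathwise, the demand cost is eventually below the
  windows scaled by \<open>1 / \<delta>\<close> with \<open>\<delta> = 1 / (n + 1)\<close>; Fatou's
  lemma carries this to expectations, where the scaling cancels \<open>\<delta>\<close>.\<close>

lemma expected_demand_cost:
  assumes f: "\<And>x. 0 \<le> F x" and "0 < T"
  shows "(\<integral>\<^sup>+\<omega>. ennreal (path_weight (step_cost (\<lambda>x. F (real_of_int x)) 0) (position_path P i T \<omega>)) \<partial>M) \<le>
    ennreal demand_rate * occupation F i T"
proof -
  let ?c = "\<lambda>\<omega>. path_weight (step_cost (\<lambda>x. F (real_of_int x)) 0) (position_path P i T \<omega>)"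
  let ?d = "\<lambda>n. inverse (real (Suc n))"
  let ?W = "\<lambda>n \<omega>. ennreal (real (Suc n)) * (\<integral>\<^sup>+t\<in>{0..T}. sample_path.window P i \<omega> (\<lambda>x. F (real_of_int x)) (?d n) t \<partial>lborel)"
  have "(\<integral>\<^sup>+\<omega>. ennreal (?c \<omega>) \<partial>M) \<le> (\<integral>\<^sup>+\<omega>. liminf (\<lambda>n. ?W n \<omega>) \<partial>M)"
  proof (rule nn_integral_mono)
    fix \<omega> assume "\<omega> \<in> space M"
    then interpret sample_path P i \<omega> by (rule sample_path)
    obtain \<delta>0 where \<delta>0: "0 < \<delta>0" "\<And>\<delta>. 0 < \<delta> \<Longrightarrow> \<delta> < \<delta>0 \<Longrightarrow> ennreal (\<delta> * ?c \<omega>) \<le>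
        (\<integral>\<^sup>+t\<in>{0..T}. window (\<lambda>x. F (real_of_int x)) \<delta> t \<partial>lborel)"
      using demand_cost_le_windows[of "\<lambda>x. F (real_of_int x)" T] assms by auto
    have "\<forall>\<^sub>F n in sequentially. ?d n < \<delta>0"
      using \<delta>0(1) by (rule order_tendstoD(2)[OF LIMSEQ_inverse_real_of_nat])
    then have "\<forall>\<^sub>F n in sequentially. ennreal (?c \<omega>) \<le> ?W n \<omega>"
    proof eventually_elim
      case (elim n)
      have "ennreal (?c \<omega>) = ennreal (real (Suc n)) * ennreal (?d n * ?c \<omega>)"
        by (subst ennreal_mult'[symmetric]) (simp_all add: mult.assoc[symmetric] del: of_nat_Suc)
      also have "\<dots> \<le> ?W n \<omega>"
        using elim by (intro mult_left_mono \<delta>0(2)) auto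
      finally show ?case .
    qed
    then show "ennreal (?c \<omega>) \<le> liminf (\<lambda>n. ?W n \<omega>)"
      by (rule Liminf_bounded)
  qed
  also have "\<dots> \<le> liminf (\<lambda>n. \<integral>\<^sup>+\<omega>. ?W n \<omega> \<partial>M)"
    using expected_window(2)[of F "?d n" for n] f by (intro nn_integral_liminf) auto
  also have "\<dots> \<le> ennreal demand_rate * occupation F i T"
  proof (rule Liminf_le)
    show "\<forall>\<^sub>F n in sequentially. (\<integral>\<^sup>+\<omega>. ?W n \<omega> \<partial>M) \<le> ennreal demand_rate * occupation F i T"
    proof (rule always_eventually, rule allI)
      fix n
      have d: "0 < ?d n" by simp
      have "(\<integral>\<^sup>+\<omega>. ?W n \<omega> \<partial>M) \<le> ennreal (real (Suc n)) * (ennreal (demand_rate * ?d n) * occupation F i T)"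
        using expected_window(1)[of F "?d n", OF f d] expected_window(2)[of F "?d n", OF f d]
        by (subst nn_integral_cmult) (auto intro!: mult_left_mono)
      also have "\<dots> = ennreal demand_rate * occupation F i T"
      proof -
        have "real (Suc n) * (demand_rate * ?d n) = demand_rate"
          by (simp add: field_simps del: of_nat_Suc)
        then show ?thesis by (metis mult.assoc ennreal_mult' of_nat_0_le_iff)
      qed
      finally show "(\<integral>\<^sup>+\<omega>. ?W n \<omega> \<partial>M) \<le> ennreal demand_rate * occupation F i T" .
    qed
  qed simp
  finally show ?thesis .
qed

definition expected_dispatches :: "stage \<Rightarrow> real \<Rightarrow> ennreal" where
  "expected_dispatches i T = (\<integral>\<^sup>+\<omega>. of_nat (num_dispatches P i T \<omega>) \<partial>M)"

definition expected_unfinished :: "stage \<Rightarrow> real \<Rightarrow> ennreal" where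
  "expected_unfinished i T = (\<integral>\<^sup>+\<omega>. of_nat (unfinished_demands P i T \<omega>) \<partial>M)"

text \<open>The count is a weight of the position path, so it inherits the measurability of that
  path.\<close>

lemma num_dispatches_measurable:
  assumes "0 < T"
  shows "(\<lambda>\<omega>. of_nat (num_dispatches P i T \<omega>) :: ennreal) \<in> borel_measurable M"
proof -
  have "(\<lambda>\<omega>. ennreal (path_weight (step_cost (\<lambda>_. 0) 1) (position_path P i T \<omega>))) \<in> borel_measurable M"
    by (rule measurable_compose[OF position_path_measurable[OF assms]]) simp
  moreover have "of_nat (num_dispatches P i T \<omega>) =
      ennreal (path_weight (step_cost (\<lambda>_. 0) 1) (position_path P i T \<omega>))" if "\<omega> \<in> space M" for \<omega>
    using sample_path.position_path_facts[OF sample_path[OF that], of T] assms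
    by (simp add: ennreal_of_nat_eq_real_of_nat)
  ultimately show ?thesis by (subst measurable_cong) auto
qed

lemma unfinished_measurable:
  assumes "0 < T"
  shows "(\<lambda>\<omega>. of_nat (unfinished_demands P i T \<omega>) :: ennreal) \<in> borel_measurable M"
  unfolding unfinished_demands_def
  by (rule measurable_compose[OF position_path_measurable[OF assms]]) simp

text \<open>The loop erasure inequality holds on every path. In expectation the demands number
  \<open>demand_rate * T\<close>, the demand cost is bounded by the occupation cost, and the
  retained path gives the unfinished demands.\<close>

lemma cycle_bound:
  assumes F: "\<And>x. 0 \<le> F x" and T: "0 < T" and C: "0 \<le> C" "0 \<le> \<kappa>"
    and block: "\<And>s j. 1 \<le> j \<Longrightarrow> C * real j \<le> (\<Sum>v<j. F (s - real v)) + \<kappa>"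
  shows "ennreal (C * (demand_rate * T)) \<le> ennreal demand_rate * occupation F i T +
    ennreal \<kappa> * expected_dispatches i T + ennreal C * expected_unfinished i T"
proof -
  let ?f = "\<lambda>x. F (real_of_int x)"
  let ?p = "position_path P i T"
  have "ennreal (C * (demand_rate * T)) = ennreal C * (\<integral>\<^sup>+n. ennreal (real_of_int (int n)) \<partial>measure_pmf (poisson (demand_rate * T)))"
    using C T params(1)[OF valid] by (simp add: nn_integral_poisson ennreal_mult)
  also have "\<dots> = ennreal C * (\<integral>\<^sup>+\<omega>. ennreal (real_of_int (demand P (0 + T) \<omega> - demand P 0 \<omega>)) \<partial>M)"
    using T by (subst nn_integral_demand_increment) auto
  also have "\<dots> = (\<integral>\<^sup>+\<omega>. ennreal C * ennreal (real_of_int (demand P (0 + T) \<omega> - demand P 0 \<omega>)) \<partial>M)"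
  proof (rule nn_integral_cmult[symmetric])
    show "(\<lambda>\<omega>. ennreal (real_of_int (demand P (0 + T) \<omega> - demand P 0 \<omega>))) \<in> borel_measurable M"
      using T by (intro measurable_count_space2[OF measurable_info[OF info_measurable(1)] measurable_info[OF info_measurable(1)]]) auto
  qed
  also have "\<dots> \<le> (\<integral>\<^sup>+\<omega>. ennreal (path_weight (step_cost ?f 0) (?p \<omega>)) +
      ennreal \<kappa> * of_nat (num_dispatches P i T \<omega>) + ennreal C * of_nat (unfinished_demands P i T \<omega>) \<partial>M)"
  proof (rule nn_integral_mono)
    fix \<omega> assume "\<omega> \<in> space M"
    then interpret sample_path P i \<omega> by (rule sample_path)
    note facts = position_path_facts[OF less_imp_le[OF T]]
    have split: "path_weight (step_cost ?f \<kappa>) (?p \<omega>) =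
        path_weight (step_cost ?f 0) (?p \<omega>) + \<kappa> * num_dispatches P i T \<omega>"
    proof -
      have "step_cost ?f \<kappa> = (\<lambda>x y. 1 * step_cost ?f 0 x y + \<kappa> * step_cost (\<lambda>_. 0) 1 x y)"
        by (auto simp: step_cost_def fun_eq_iff)
      then show ?thesis using facts by (simp only: path_weight_linear)
    qed
    have "C * num_down_steps (?p \<omega>) \<le>
        path_weight (step_cost ?f \<kappa>) (?p \<omega>) + C * num_down_steps (loop_erase (?p \<omega>))"
    proof (rule loop_erasure_bound)
      fix s :: int and j :: nat assume "1 \<le> j"
      then show "C * real j \<le> (\<Sum>v<j. F (real_of_int (s - int v))) + \<kappa>"
        using block[of j "real_of_int s"] by simp
    qed (use facts F C in auto)
    then have "C * (N T - N 0) \<le> path_weight (step_cost ?f 0) (?p \<omega>) +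
        \<kappa> * num_dispatches P i T \<omega> + C * unfinished_demands P i T \<omega>"
      using facts split by (simp add: unfinished_demands_def)
    moreover have "0 \<le> path_weight (step_cost ?f 0) (?p \<omega>)"
      by (rule path_weight_nonneg) (simp add: step_cost_def F)
    moreover have "0 \<le> real_of_int (N T - N 0)"
      using facts by (metis of_nat_0_le_iff)
    ultimately have "ennreal (C * (N T - N 0)) \<le> ennreal (path_weight (step_cost ?f 0) (?p \<omega>)) +
        ennreal (\<kappa> * num_dispatches P i T \<omega>) + ennreal (C * unfinished_demands P i T \<omega>)"
      using C by (simp add: ennreal_plus[symmetric] ennreal_leI del: ennreal_plus)
    then show "ennreal C * ennreal (real_of_int (N (0 + T) - N 0)) \<le>
        ennreal (path_weight (step_cost ?f 0) (?p \<omega>)) +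
      ennreal \<kappa> * of_nat (num_dispatches P i T \<omega>) + ennreal C * of_nat (unfinished_demands P i T \<omega>)"
      using C by (simp add: ennreal_mult' ennreal_of_nat_eq_real_of_nat)
  qed
  also have "\<dots> = (\<integral>\<^sup>+\<omega>. ennreal (path_weight (step_cost ?f 0) (?p \<omega>)) \<partial>M) +
      ennreal \<kappa> * expected_dispatches i T + ennreal C * expected_unfinished i T"
  proof -
    have [measurable]: "(\<lambda>\<omega>. ennreal (path_weight (step_cost ?f 0) (?p \<omega>))) \<in> borel_measurable M"
      by (rule measurable_compose[OF position_path_measurable[OF T]]) simp
    note [measurable] = num_dispatches_measurable[OF T] unfinished_measurable[OF T]
    show ?thesis
      unfolding expected_dispatches_def expected_unfinished_def
      by (simp add: nn_integral_add nn_integral_cmult)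
  qed
  also have "\<dots> \<le> ennreal demand_rate * occupation F i T +
      ennreal \<kappa> * expected_dispatches i T + ennreal C * expected_unfinished i T"
    by (intro add_mono expected_demand_cost order.refl F T)
  finally show ?thesis .
qed

text \<open>For zero demand rate, division by zero makes the coefficient of the last term zero.\<close>

lemma stage_cost_bound:
  assumes F: "\<And>x. 0 \<le> F x" and T: "0 < T" and K: "0 \<le> K"
  shows "ennreal (CC F (demand_rate * K) * T) \<le> occupation F i T +
    ennreal K * expected_dispatches i T + ennreal (CC F (demand_rate * K) / demand_rate) * expected_unfinished i T"
proof (cases "demand_rate = 0")
  case True
  \<comment> \<open>Without demand there are no cycles to use; a block of length one with zero setup
    already bounds the cost rate at every position.\<close>
  have "CC F 0 \<le> F x" for x
    using CC_le[of F 0 1 x] F by simp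
  then have "ennreal (CC F 0) \<le> (\<integral>\<^sup>+\<omega>. ennreal (F (inv_position P i t \<omega>)) \<partial>M)" for t
    using nn_integral_mono[of M "\<lambda>_. ennreal (CC F 0)" "\<lambda>\<omega>. ennreal (F (inv_position P i t \<omega>))"]
    by (simp add: emeasure_space_1 ennreal_leI)
  then have "(\<integral>\<^sup>+t\<in>{0..T}. ennreal (CC F 0) \<partial>lborel) \<le> occupation F i T"
    unfolding occupation_def by (intro nn_integral_mono mult_right_mono) auto
  moreover have "(\<integral>\<^sup>+t\<in>{0..T}. ennreal (CC F 0) \<partial>lborel) = ennreal (CC F 0 * T)"
    using T CC_nonneg[of F 0] F by (subst nn_integral_cmult_indicator) (auto simp: ennreal_mult)
  ultimately show ?thesis using True by (simp add: add_increasing2)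
next
  case False
  then have pos: "0 < demand_rate" using params(1)[OF valid] by simp
  let ?C = "CC F (demand_rate * K)"
  have C: "0 \<le> ?C" using pos K F by (intro CC_nonneg) auto
  \<comment> \<open>The dispatch cost on the path is \<open>demand_rate * K\<close>; dividing the
    inequality by \<open>demand_rate\<close> restores the setup charge \<open>K\<close> and the
    weight 1 of the occupation cost.\<close>
  have "ennreal (?C * (demand_rate * T)) \<le> ennreal demand_rate * occupation F i T +
    ennreal (demand_rate * K) * expected_dispatches i T + ennreal ?C * expected_unfinished i T"
    using pos K F by (intro cycle_bound T C CC_block) auto
  then have "ennreal (1 / demand_rate) * ennreal (?C * (demand_rate * T)) \<le> ennreal (1 / demand_rate) * (ennreal demand_rate * occupation F i T +
    ennreal (demand_rate * K) * expected_dispatches i T + ennreal ?C * expected_unfinished i T)"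
    by (rule mult_left_mono) simp
  also have "\<dots> = occupation F i T + ennreal K * expected_dispatches i T +
      ennreal (?C / demand_rate) * expected_unfinished i T"
    using pos K C by (simp add: distrib_left mult.assoc[symmetric] ennreal_mult[symmetric])
  finally show ?thesis
    using pos C T by (simp add: ennreal_mult[symmetric])
qed

end

section \<open>Inventory costs and the lower bound\<close>

lemma nn_integral_shift:
  fixes k :: "real \<Rightarrow> ennreal"
  assumes "(\<lambda>t. k t * indicator {a + c..b + c} t) \<in> borel_measurable borel"
  shows "(\<integral>\<^sup>+t\<in>{a + c..b + c}. k t \<partial>lborel) = (\<integral>\<^sup>+t\<in>{a..b}. k (t + c) \<partial>lborel)"
    and "(\<lambda>t. k (t + c) * indicator {a..b} t) \<in> borel_measurable borel"
proof -
  have "(\<lambda>t. k (t + c) * indicator {a + c..b + c} (t + c)) \<in> borel_measurable borel"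
    by (rule measurable_compose[OF _ assms]) simp
  then show "(\<lambda>t. k (t + c) * indicator {a..b} t) \<in> borel_measurable borel"
    by (simp add: indicator_def)
  have "(\<integral>\<^sup>+t\<in>{a + c..b + c}. k t \<partial>lborel) =
      ennreal \<bar>1\<bar> * (\<integral>\<^sup>+t. k (c + 1 * t) * indicator {a + c..b + c} (c + 1 * t) \<partial>lborel)"
    by (rule nn_integral_real_affine[OF assms]) simp
  also have "\<dots> = (\<integral>\<^sup>+t\<in>{a..b}. k (t + c) \<partial>lborel)"
    by (auto simp: indicator_def add.commute intro!: nn_integral_cong)
  finally show "(\<integral>\<^sup>+t\<in>{a + c..b + c}. k t \<partial>lborel) = (\<integral>\<^sup>+t\<in>{a..b}. k (t + c) \<partial>lborel)" .
qed

text \<open>Little's law on one path: a unit dispatched in \<open>{0<..T - L}\<close> spends its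
  full lead time \<open>L\<close> in the pipeline before \<open>T\<close>. The proof compares the
  integrals of \<open>U t - U 0\<close> over \<open>{0..T}\<close> and of its shift by
  \<open>L\<close>.\<close>

lemma pipeline_integral_ge:
  fixes U :: "real \<Rightarrow> int"
  assumes U: "mono U" and "0 \<le> L" "L \<le> T" and meas: "U \<in> borel \<rightarrow>\<^sub>M count_space UNIV"
  shows "ennreal (L * (U (T - L) - U 0)) \<le> (\<integral>\<^sup>+t\<in>{0..T}. ennreal (real_of_int (U t - U (t - L))) \<partial>lborel)"
proof -
  let ?v = "\<lambda>t. ennreal (real_of_int (U t - U 0))"
  let ?A = "\<integral>\<^sup>+t\<in>{0..T}. ennreal (real_of_int (U t - U (t - L))) \<partial>lborel"
  have v: "?v \<in> borel_measurable borel"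
    by (rule measurable_compose[OF meas]) simp
  have U': "(\<lambda>t. U (t - L)) \<in> borel \<rightarrow>\<^sub>M count_space UNIV"
    by (rule measurable_compose[OF _ meas]) simp
  have p: "(\<lambda>t. ennreal (real_of_int (U t - U (t - L)))) \<in> borel_measurable borel"
    by (rule measurable_count_space2[OF meas U']) simp
  have vL: "(\<lambda>t. ?v (t - L)) \<in> borel_measurable borel"
    by (rule measurable_compose[OF U']) simp
  let ?I = "\<integral>\<^sup>+t\<in>{0..T - L}. ?v t \<partial>lborel"
  have shift: "(\<integral>\<^sup>+t\<in>{0 + L..(T - L) + L}. ?v (t - L) \<partial>lborel) = ?I"
  proof -
    have "(\<lambda>t. ?v (t - L) * indicator {0 + L..(T - L) + L} t) \<in> borel_measurable borel"
      using vL by (intro borel_measurable_times_ennreal) simp_all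
    from nn_integral_shift(1)[OF this] show ?thesis by simp
  qed
  \<comment> \<open>Finiteness of \<open>?I\<close> permits its cancellation from both sides of the
    final \<open>ennreal\<close> inequality.\<close>
  have "?I \<le> (\<integral>\<^sup>+t. ennreal (real_of_int (U (T - L) - U 0)) * indicator {0..T - L} t \<partial>lborel)"
    using monoD[OF U] by (intro nn_integral_mono) (auto simp: indicator_def intro!: ennreal_leI)
  also have "\<dots> < \<infinity>"
    using assms(3) by (subst nn_integral_cmult_indicator) (auto simp: ennreal_mult_less_top)
  finally have fin: "?I \<noteq> \<infinity>" by simp
  have vnn: "0 \<le> real_of_int (U (T - L) - U 0)"
    using monoD[OF U, of 0 "T - L"] assms(3) by simp
  have "?I + ennreal (L * (U (T - L) - U 0)) =
      ?I + (\<integral>\<^sup>+t. ennreal (real_of_int (U (T - L) - U 0)) * indicator {T - L<..T} t \<partial>lborel)"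
    using assms(2) vnn by (subst nn_integral_cmult_indicator) (auto simp: ennreal_mult' mult.commute)
  also have "\<dots> = (\<integral>\<^sup>+t. ?v t * indicator {0..T - L} t +
      ennreal (real_of_int (U (T - L) - U 0)) * indicator {T - L<..T} t \<partial>lborel)"
    using v by (intro nn_integral_add[symmetric] borel_measurable_times_ennreal) simp_all
  also have "\<dots> \<le> (\<integral>\<^sup>+t. ?v (t - L) * indicator {0 + L..(T - L) + L} t +
      ennreal (real_of_int (U t - U (t - L))) * indicator {0..T} t \<partial>lborel)"
  proof (rule nn_integral_mono)
    fix t
    have "?v t * indicator {0..T - L} t +
        ennreal (real_of_int (U (T - L) - U 0)) * indicator {T - L<..T} t \<le> ?v t * indicator {0..T} t"
      using monoD[OF U, of "T - L" t] assms(2,3) by (auto simp: indicator_def intro!: ennreal_leI)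
    also have "\<dots> \<le> ?v (t - L) * indicator {0 + L..(T - L) + L} t +
        ennreal (real_of_int (U t - U (t - L))) * indicator {0..T} t"
    proof (cases "t \<in> {0..T}")
      case True
      show ?thesis
      proof (cases "L \<le> t")
        case True
        have "?v t = ?v (t - L) + ennreal (real_of_int (U t - U (t - L)))"
          using monoD[OF U, of 0 "t - L"] monoD[OF U, of "t - L" t] True assms(2)
          by (subst ennreal_plus[symmetric]) auto
        then show ?thesis using True by (simp add: indicator_def)
      next
        case False
        then show ?thesis
          using monoD[OF U, of "t - L" 0] by (auto simp: indicator_def intro!: ennreal_leI)
      qed
    qed simp
    finally show "?v t * indicator {0..T - L} t +
        ennreal (real_of_int (U (T - L) - U 0)) * indicator {T - L<..T} t \<le>
        ?v (t - L) * indicator {0 + L..(T - L) + L} t +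
        ennreal (real_of_int (U t - U (t - L))) * indicator {0..T} t" .
  qed
  also have "\<dots> = ?I + ?A"
    unfolding shift[symmetric]
    using vL p by (intro nn_integral_add borel_measurable_times_ennreal) simp_all
  finally show ?thesis
    using fin by (simp add: ennreal_add_left_cancel_le)
qed

context admissible_policy
begin

abbreviation "L1 \<equiv> lead S Stage1"
abbreviation "L2 \<equiv> lead S Stage2"

lemmas param = params[OF valid]

text \<open>For \<open>d = 0\<close> this is the inventory position and for \<open>d\<close> the
  lead time it is the inventory level. For Stage 2 and \<open>d = L1 + L2\<close> it counts only
  orders at least \<open>L1 + L2\<close> old: the echelon 2 position at \<open>t - (L1 + L2)\<close>
  minus the demand since then.\<close>

abbreviation stock :: "stage \<Rightarrow> real \<Rightarrow> real \<Rightarrow> 'w \<Rightarrow> int" where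
  "stock i d t \<omega> \<equiv> offset P i \<omega> + dispatched P i (t - d) \<omega> - demand P t \<omega>"

lemma stock_joint:
  "(\<lambda>z. offset P i (snd z) + dispatched P i (fst z - d) (snd z) - demand P (max 0 (fst z)) (snd z))
    \<in> borel \<Otimes>\<^sub>M M \<rightarrow>\<^sub>M count_space UNIV"
  using inv_level_joint[of i "- d" 0] by simp

lemma feasible:
  assumes "\<omega> \<in> space M"
  shows "mono (\<lambda>t. dispatched P i t \<omega>)" "0 \<le> t \<Longrightarrow> stock Stage1 0 t \<omega> \<le> stock Stage2 L2 t \<omega>"
  using admissible assms
  by (auto simp: admissible_def feasible_paths_def inv_position_def inv_level_def)

lemma dispatched_mono:
  assumes "\<omega> \<in> space M" "s \<le> t"
  shows "dispatched P i s \<omega> \<le> dispatched P i t \<omega>"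
  using monoD[OF feasible(1)[OF assms(1)] assms(2)] .

lemma demand_mono:
  assumes "\<omega> \<in> space M" "0 \<le> s" "s \<le> t"
  shows "demand P s \<omega> \<le> demand P t \<omega>"
  using mono_onD[OF sample_path.demand_mono[OF sample_path[OF assms(1)]], of s t] assms by simp

definition expected_pipeline :: "real \<Rightarrow> ennreal" where
  "expected_pipeline T =
    (\<integral>\<^sup>+t\<in>{0..T}. (\<integral>\<^sup>+\<omega>. ennreal (real_of_int (dispatched P Stage1 t \<omega> - dispatched P Stage1 (t - L1) \<omega>)) \<partial>M) \<partial>lborel)"

lemma pipeline_joint:
  "(\<lambda>z. f (dispatched P Stage1 (fst z) (snd z) - dispatched P Stage1 (fst z - L1) (snd z)))
    \<in> borel_measurable (borel \<Otimes>\<^sub>M M)" for f :: "int \<Rightarrow> ennreal"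
  using dispatched_joint_shift[of Stage1 "- L1"]
  by (intro measurable_count_space2[OF dispatched_joint, where h="\<lambda>x y. f (x - y)"]) simp_all

abbreviation mean_dispatched :: "real \<Rightarrow> real" where
  "mean_dispatched t \<equiv> \<integral>\<omega>. real_of_int (dispatched P Stage1 t \<omega>) \<partial>M"

lemma mean_rate_dispatched:
  "0 \<le> t \<Longrightarrow> integrable M (\<lambda>\<omega>. real_of_int (dispatched P Stage1 t \<omega>))"
  "((\<lambda>T. mean_dispatched T / T) \<longlongrightarrow> demand_rate) at_top"
  using admissible by (auto simp: admissible_def asymptotic_conditions_def mean_rate_def)

lemma expected_pipeline_ge:
  assumes "L1 \<le> T"
  shows "ennreal (L1 * (mean_dispatched (T - L1) - mean_dispatched 0)) \<le> expected_pipeline T"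
proof -
  let ?U = "dispatched P Stage1"
  have "expected_pipeline T = (\<integral>\<^sup>+\<omega>. (\<integral>\<^sup>+t\<in>{0..T}. ennreal (real_of_int (?U t \<omega> - ?U (t - L1) \<omega>)) \<partial>lborel) \<partial>M)"
    unfolding expected_pipeline_def
    by (rule nn_integral_swap(1)[OF pipeline_joint[of "\<lambda>x. ennreal (real_of_int x)"], symmetric]) auto
  also have "\<dots> \<ge> (\<integral>\<^sup>+\<omega>. ennreal (L1 * (?U (T - L1) \<omega> - ?U 0 \<omega>)) \<partial>M)"
  proof (rule nn_integral_mono)
    fix \<omega> assume \<omega>: "\<omega> \<in> space M"
    show "ennreal (L1 * (?U (T - L1) \<omega> - ?U 0 \<omega>)) \<le>
        (\<integral>\<^sup>+t\<in>{0..T}. ennreal (real_of_int (?U t \<omega> - ?U (t - L1) \<omega>)) \<partial>lborel)"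
    proof (rule pipeline_integral_ge[OF feasible(1)[OF \<omega>] _ assms])
      show "(\<lambda>t. ?U t \<omega>) \<in> borel \<rightarrow>\<^sub>M count_space UNIV"
        using measurable_compose[OF measurable_Pair2'[OF \<omega>] dispatched_joint] by simp
    qed (rule param)
  qed
  also have "(\<integral>\<^sup>+\<omega>. ennreal (L1 * (?U (T - L1) \<omega> - ?U 0 \<omega>)) \<partial>M) =
      ennreal (\<integral>\<omega>. L1 * (?U (T - L1) \<omega> - ?U 0 \<omega>) \<partial>M)"
    using assms param mean_rate_dispatched(1)[of "T - L1"] mean_rate_dispatched(1)[of 0]
    by (intro nn_integral_eq_integral AE_I2) (auto intro!: mult_nonneg_nonneg dispatched_mono)
  also have "(\<integral>\<omega>. L1 * (?U (T - L1) \<omega> - ?U 0 \<omega>) \<partial>M) =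
      L1 * (mean_dispatched (T - L1) - mean_dispatched 0)"
    using assms mean_rate_dispatched(1)[of "T - L1"] mean_rate_dispatched(1)[of 0] by simp
  finally show ?thesis .
qed

lemma expected_pipeline_scale:
  assumes "0 \<le> c"
  shows "(\<integral>\<^sup>+t\<in>{0..T}. (\<integral>\<^sup>+\<omega>. ennreal (c * real_of_int (dispatched P Stage1 t \<omega> -
    dispatched P Stage1 (t - L1) \<omega>)) \<partial>M) \<partial>lborel) = ennreal c * expected_pipeline T"
proof -
  let ?q = "\<lambda>t \<omega>. ennreal (real_of_int (dispatched P Stage1 t \<omega> - dispatched P Stage1 (t - L1) \<omega>))"
  have "(\<integral>\<^sup>+\<omega>. ennreal (c * real_of_int (dispatched P Stage1 t \<omega> - dispatched P Stage1 (t - L1) \<omega>)) \<partial>M) =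
      ennreal c * (\<integral>\<^sup>+\<omega>. ?q t \<omega> \<partial>M)" for t
  proof -
    have "?q t \<in> borel_measurable M"
      by (rule measurable_count_space2[OF measurable_info[OF info_measurable(3)] measurable_info[OF info_measurable(3)]]) simp
    then show ?thesis
      using assms by (subst nn_integral_cmult[symmetric]) (simp_all only: ennreal_mult')
  qed
  then have "(\<integral>\<^sup>+t\<in>{0..T}. (\<integral>\<^sup>+\<omega>. ennreal (c * real_of_int (dispatched P Stage1 t \<omega> -
      dispatched P Stage1 (t - L1) \<omega>)) \<partial>M) \<partial>lborel) =
      (\<integral>\<^sup>+t. ennreal c * ((\<integral>\<^sup>+\<omega>. ?q t \<omega> \<partial>M) * indicator {0..T} t) \<partial>lborel)"
    by (simp only: mult.assoc)
  also have "\<dots> = ennreal c * expected_pipeline T"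
    unfolding expected_pipeline_def
    using nn_integral_swap(4)[OF pipeline_joint[of "\<lambda>x. ennreal (real_of_int x)"], of "{0..T}" ?q]
    by (intro nn_integral_cmult) simp
  finally show ?thesis .
qed

section \<open>Two decompositions of the inventory cost rate\<close>

lemma cost_rate_eq:
  "cost_rate S P t \<omega> = h1 S * max (stock Stage1 L1 t \<omega>) 0 +
    h2 S * (stock Stage2 L2 t \<omega> + max (- stock Stage1 L1 t \<omega>) 0) +
    pc S * max (- stock Stage1 L1 t \<omega>) 0"
  by (simp add: cost_rate_def backlog_def inv_level_def)

text \<open>The three parts of a decomposition live on different time windows, because each is tied
  to a position some lead time earlier. One pointwise inequality with indicators and three
  applications of Tonelli serve both decompositions.\<close>

lemma exp_inv_cost_ge:
  assumes meas: "ha \<in> borel_measurable (borel \<Otimes>\<^sub>M M)" "hb \<in> borel_measurable (borel \<Otimes>\<^sub>M M)"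
      "hc \<in> borel_measurable (borel \<Otimes>\<^sub>M M)"
    and [measurable]: "A \<in> sets borel" "B \<in> sets borel" "C \<in> sets borel"
    and a: "\<forall>t\<in>A. \<forall>\<omega>\<in>space M. a t \<omega> = ha (t, \<omega>)"
    and b: "\<forall>t\<in>B. \<forall>\<omega>\<in>space M. b t \<omega> = hb (t, \<omega>)"
    and c: "\<forall>t\<in>C. \<forall>\<omega>\<in>space M. c t \<omega> = hc (t, \<omega>)"
    and le: "\<And>t \<omega>. \<omega> \<in> space M \<Longrightarrow> a t \<omega> * indicator A t + b t \<omega> * indicator B t + c t \<omega> * indicator C t
      \<le> ennreal (cost_rate S P t \<omega>) * indicator {0..T} t"
  shows "(\<integral>\<^sup>+t\<in>A. (\<integral>\<^sup>+\<omega>. a t \<omega> \<partial>M) \<partial>lborel) + (\<integral>\<^sup>+t\<in>B. (\<integral>\<^sup>+\<omega>. b t \<omega> \<partial>M) \<partial>lborel) +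
    (\<integral>\<^sup>+t\<in>C. (\<integral>\<^sup>+\<omega>. c t \<omega> \<partial>M) \<partial>lborel) \<le> exp_inv_cost S P 0 T"
proof -
  note A = nn_integral_swap[OF meas(1) assms(4) a]
  note B = nn_integral_swap[OF meas(2) assms(5) b]
  note C = nn_integral_swap[OF meas(3) assms(6) c]
  have "(\<integral>\<^sup>+t\<in>A. (\<integral>\<^sup>+\<omega>. a t \<omega> \<partial>M) \<partial>lborel) + (\<integral>\<^sup>+t\<in>B. (\<integral>\<^sup>+\<omega>. b t \<omega> \<partial>M) \<partial>lborel) +
      (\<integral>\<^sup>+t\<in>C. (\<integral>\<^sup>+\<omega>. c t \<omega> \<partial>M) \<partial>lborel) =
      (\<integral>\<^sup>+\<omega>. (\<integral>\<^sup>+t\<in>A. a t \<omega> \<partial>lborel) \<partial>M) + (\<integral>\<^sup>+\<omega>. (\<integral>\<^sup>+t\<in>B. b t \<omega> \<partial>lborel) \<partial>M) +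
      (\<integral>\<^sup>+\<omega>. (\<integral>\<^sup>+t\<in>C. c t \<omega> \<partial>lborel) \<partial>M)"
    by (simp only: A(1) B(1) C(1))
  also have "\<dots> = (\<integral>\<^sup>+\<omega>. ((\<integral>\<^sup>+t\<in>A. a t \<omega> \<partial>lborel) + (\<integral>\<^sup>+t\<in>B. b t \<omega> \<partial>lborel)) +
      (\<integral>\<^sup>+t\<in>C. c t \<omega> \<partial>lborel) \<partial>M)"
    using A(3) B(3) C(3) by (simp add: nn_integral_add)
  also have "\<dots> \<le> exp_inv_cost S P 0 T"
    unfolding exp_inv_cost_def
  proof (rule nn_integral_mono)
    fix \<omega> assume \<omega>: "\<omega> \<in> space M"
    have "((\<integral>\<^sup>+t\<in>A. a t \<omega> \<partial>lborel) + (\<integral>\<^sup>+t\<in>B. b t \<omega> \<partial>lborel)) + (\<integral>\<^sup>+t\<in>C. c t \<omega> \<partial>lborel) =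
        (\<integral>\<^sup>+t. a t \<omega> * indicator A t + b t \<omega> * indicator B t + c t \<omega> * indicator C t \<partial>lborel)"
      using A(2)[OF \<omega>] B(2)[OF \<omega>] C(2)[OF \<omega>] by (simp add: nn_integral_add)
    also have "\<dots> \<le> (\<integral>\<^sup>+t\<in>{0..T}. ennreal (cost_rate S P t \<omega>) \<partial>lborel)"
      using \<omega> by (intro nn_integral_mono le)
    finally show "((\<integral>\<^sup>+t\<in>A. a t \<omega> \<partial>lborel) + (\<integral>\<^sup>+t\<in>B. b t \<omega> \<partial>lborel)) + (\<integral>\<^sup>+t\<in>C. c t \<omega> \<partial>lborel) \<le>
        (\<integral>\<^sup>+t\<in>{0..T}. ennreal (cost_rate S P t \<omega>) \<partial>lborel)" .
  qed
  finally show ?thesis .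
qed

text \<open>At \<open>t + L1\<close> exactly the shipments dispatched up to \<open>t\<close> have
  arrived, so the level is the position at \<open>t\<close> minus the independent demand in
  between.\<close>

lemma expected_phi_stage1:
  assumes "0 \<le> t" "0 \<le> a" "0 \<le> b"
  shows "(\<integral>\<^sup>+\<omega>. ennreal (phi a b (stock Stage1 L1 (t + L1) \<omega>)) \<partial>M) =
    (\<integral>\<^sup>+\<omega>. ennreal (exp_phi (D1 S) a b (inv_position P Stage1 t \<omega>)) \<partial>M)"
proof -
  have "(\<integral>\<^sup>+\<omega>. ennreal (phi a b (stock Stage1 L1 (t + L1) \<omega>)) \<partial>M) =
      (\<integral>\<^sup>+\<omega>. (\<lambda>x d. ennreal (phi a b (real_of_int x - real_of_int d))) (inv_position P Stage1 t \<omega>)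
        (demand P (t + L1) \<omega> - demand P t \<omega>) \<partial>M)"
    by (intro nn_integral_cong) (simp add: inv_position_def algebra_simps)
  also have "\<dots> = (\<integral>\<^sup>+\<omega>. (\<integral>\<^sup>+n. ennreal (phi a b (real_of_int (inv_position P Stage1 t \<omega>) - real_of_int (int n)))
      \<partial>measure_pmf (poisson (demand_rate * L1))) \<partial>M)"
    using assms param by (intro nn_integral_independent_increment inv_position_info) auto
  also have "\<dots> = (\<integral>\<^sup>+\<omega>. ennreal (exp_phi (D1 S) a b (inv_position P Stage1 t \<omega>)) \<partial>M)"
    using nn_integral_phi[OF assms(2,3) integrable_lead_demand(1)[OF valid]] by (simp add: D1_def)
  finally show ?thesis .
qed

text \<open>The demand over \<open>L1 + L2\<close> is integrated out in two pieces, the later one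
  first: given the information at \<open>t + L1\<close> it is a \<open>D2\<close> increment, then
  given that at \<open>t\<close> a \<open>D1\<close> increment. This produces the conditioned form
  of \<open>F2\<close>.\<close>

lemma expected_phi_stage2:
  assumes t: "0 \<le> t" and ab: "0 \<le> a" "0 \<le> b"
  shows "(\<integral>\<^sup>+\<omega>. ennreal (phi a b (stock Stage2 (L1 + L2) (t + (L1 + L2)) \<omega>)) \<partial>M) =
    (\<integral>\<^sup>+\<omega>. ennreal (measure_pmf.expectation (D1 S) (\<lambda>d. exp_phi (D2 S) a b (inv_position P Stage2 t \<omega> - real d))) \<partial>M)"
proof -
  define X where "X \<omega> = offset P Stage2 \<omega> + dispatched P Stage2 t \<omega> - demand P (t + L1) \<omega>" for \<omega>
  have tL: "0 \<le> t + L1" using t param by simp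
  have X: "X \<in> info P (t + L1) \<rightarrow>\<^sub>M count_space UNIV"
  proof -
    have 1: "dispatched P Stage2 t \<in> info P (t + L1) \<rightarrow>\<^sub>M count_space UNIV"
      using param by (intro info_mono[OF _ info_measurable(3)]) simp
    have 2: "(\<lambda>\<omega>. offset P Stage2 \<omega> + dispatched P Stage2 t \<omega>) \<in> info P (t + L1) \<rightarrow>\<^sub>M count_space UNIV"
      by (rule measurable_count_space2[OF info_measurable(2)[OF tL] 1]) simp
    show ?thesis
      unfolding X_def[abs_def] by (rule measurable_count_space2[OF 2 info_measurable(1)[OF tL]]) simp
  qed
  have "(\<integral>\<^sup>+\<omega>. ennreal (phi a b (stock Stage2 (L1 + L2) (t + (L1 + L2)) \<omega>)) \<partial>M) =
      (\<integral>\<^sup>+\<omega>. (\<lambda>x d. ennreal (phi a b (real_of_int x - real_of_int d))) (X \<omega>)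
        (demand P ((t + L1) + L2) \<omega> - demand P (t + L1) \<omega>) \<partial>M)"
    by (intro nn_integral_cong) (simp add: X_def algebra_simps)
  also have "\<dots> = (\<integral>\<^sup>+\<omega>. (\<integral>\<^sup>+n. ennreal (phi a b (real_of_int (X \<omega>) - real_of_int (int n)))
      \<partial>measure_pmf (poisson (demand_rate * L2))) \<partial>M)"
    using param by (intro nn_integral_independent_increment X tL) auto
  also have "\<dots> = (\<integral>\<^sup>+\<omega>. ennreal (exp_phi (D2 S) a b (X \<omega>)) \<partial>M)"
    using nn_integral_phi[OF ab integrable_lead_demand(2)[OF valid]] by (simp add: D2_def)
  also have "\<dots> = (\<integral>\<^sup>+\<omega>. (\<lambda>x d. ennreal (exp_phi (D2 S) a b (real_of_int x - real_of_int d)))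
      (inv_position P Stage2 t \<omega>) (demand P (t + L1) \<omega> - demand P t \<omega>) \<partial>M)"
    by (intro nn_integral_cong) (simp add: X_def inv_position_def algebra_simps)
  also have "\<dots> = (\<integral>\<^sup>+\<omega>. (\<integral>\<^sup>+n. ennreal (exp_phi (D2 S) a b (real_of_int (inv_position P Stage2 t \<omega>) - real_of_int (int n)))
      \<partial>measure_pmf (poisson (demand_rate * L1))) \<partial>M)"
    using param t by (intro nn_integral_independent_increment inv_position_info) auto
  also have "\<dots> = (\<integral>\<^sup>+\<omega>. ennreal (measure_pmf.expectation (D1 S)
      (\<lambda>d. exp_phi (D2 S) a b (inv_position P Stage2 t \<omega> - real d))) \<partial>M)"
    using expectation_pair_phi(1)[OF ab integrable_lead_demand(1)[OF valid] integrable_lead_demand(2)[OF valid]]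
    by (simp add: D1_def nn_integral_eq_integral exp_phi_nonneg ab)
  finally show ?thesis .
qed

text \<open>
  Echelon decomposition: the cost splits into a Stage 1 part with rates \<open>h1 S + \<eta> * h2 S\<close>, \<open>\<zeta> * p\<close>,
  the holding cost \<open>\<eta> * h2 S\<close> of the units in transit to Stage 1, and an echelon 2 part.
\<close>

lemma inventory_cost_split:
  assumes T: "L1 + L2 \<le> T" and \<eta>: "0 \<le> \<eta>" "\<eta> \<le> 1" "0 \<le> \<zeta>" "\<zeta> \<le> 1"
  shows "occupation (F1 S \<eta> \<zeta>) Stage1 (T - L1) + ennreal (\<eta> * h2 S) * expected_pipeline T +
    occupation (F2 S \<eta> \<zeta>) Stage2 (T - (L1 + L2)) \<le> exp_inv_cost S P 0 T"
proof -
  let ?a = "\<lambda>t \<omega>. ennreal (phi (h1 S + \<eta> * h2 S) (\<zeta> * pc S) (stock Stage1 L1 t \<omega>))"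
  let ?b = "\<lambda>t \<omega>. ennreal (\<eta> * h2 S * real_of_int (dispatched P Stage1 t \<omega> - dispatched P Stage1 (t - L1) \<omega>))"
  let ?c = "\<lambda>t \<omega>. ennreal (phi ((1 - \<eta>) * h2 S) ((1 - \<zeta>) * pc S) (stock Stage2 (L1 + L2) t \<omega>))"
  note nn = param \<eta>
  have ma: "(\<lambda>z. ennreal (phi (h1 S + \<eta> * h2 S) (\<zeta> * pc S) (real_of_int (offset P Stage1 (snd z) +
      dispatched P Stage1 (fst z - L1) (snd z) - demand P (max 0 (fst z)) (snd z)))))
      \<in> borel_measurable (borel \<Otimes>\<^sub>M M)"
    by (rule measurable_compose[OF stock_joint]) simp
  have mb: "(\<lambda>z. ennreal (\<eta> * h2 S * real_of_int (dispatched P Stage1 (fst z) (snd z) -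
      dispatched P Stage1 (fst z - L1) (snd z)))) \<in> borel_measurable (borel \<Otimes>\<^sub>M M)"
    by (rule pipeline_joint)
  have mc: "(\<lambda>z. ennreal (phi ((1 - \<eta>) * h2 S) ((1 - \<zeta>) * pc S) (real_of_int (offset P Stage2 (snd z) +
      dispatched P Stage2 (fst z - (L1 + L2)) (snd z) - demand P (max 0 (fst z)) (snd z)))))
      \<in> borel_measurable (borel \<Otimes>\<^sub>M M)"
    by (rule measurable_compose[OF stock_joint]) simp
  have ea: "\<forall>t\<in>{0 + L1..(T - L1) + L1}. \<forall>\<omega>\<in>space M. ?a t \<omega> = ennreal (phi (h1 S + \<eta> * h2 S) (\<zeta> * pc S) (real_of_int (offset P Stage1 (snd (t, \<omega>)) +
      dispatched P Stage1 (fst (t, \<omega>) - L1) (snd (t, \<omega>)) - demand P (max 0 (fst (t, \<omega>))) (snd (t, \<omega>)))))"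
    using order.trans[OF param(2)[of Stage1]] by simp
  have ec: "\<forall>t\<in>{0 + (L1 + L2)..(T - (L1 + L2)) + (L1 + L2)}. \<forall>\<omega>\<in>space M. ?c t \<omega> = ennreal (phi ((1 - \<eta>) * h2 S) ((1 - \<zeta>) * pc S) (real_of_int (offset P Stage2 (snd (t, \<omega>)) +
      dispatched P Stage2 (fst (t, \<omega>) - (L1 + L2)) (snd (t, \<omega>)) - demand P (max 0 (fst (t, \<omega>))) (snd (t, \<omega>)))))"
    using order.trans[OF add_nonneg_nonneg[OF param(2)[of Stage1] param(2)[of Stage2]]] by simp
  have "(\<integral>\<^sup>+t\<in>{0 + L1..(T - L1) + L1}. (\<integral>\<^sup>+\<omega>. ?a t \<omega> \<partial>M) \<partial>lborel) + (\<integral>\<^sup>+t\<in>{0..T}. (\<integral>\<^sup>+\<omega>. ?b t \<omega> \<partial>M) \<partial>lborel) +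
    (\<integral>\<^sup>+t\<in>{0 + (L1 + L2)..(T - (L1 + L2)) + (L1 + L2)}. (\<integral>\<^sup>+\<omega>. ?c t \<omega> \<partial>M) \<partial>lborel) \<le> exp_inv_cost S P 0 T"
  proof (rule exp_inv_cost_ge[OF ma mb mc _ _ _ ea _ ec])
    fix t \<omega> assume \<omega>: "\<omega> \<in> space M"
    show "?a t \<omega> * indicator {0 + L1..(T - L1) + L1} t + ?b t \<omega> * indicator {0..T} t +
        ?c t \<omega> * indicator {0 + (L1 + L2)..(T - (L1 + L2)) + (L1 + L2)} t
        \<le> ennreal (cost_rate S P t \<omega>) * indicator {0..T} t"
    proof (cases "t \<in> {0..T}")
      case False
      then show ?thesis using param(2)[of Stage1] param(2)[of Stage2] by (auto simp: indicator_def)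
    next
      case True
      define x y z where "x = real_of_int (stock Stage1 L1 t \<omega>)"
        and "y = real_of_int (stock Stage2 L2 t \<omega>)"
        and "z = real_of_int (stock Stage2 (L1 + L2) t \<omega>)"
      define q where "q = real_of_int (dispatched P Stage1 t \<omega> - dispatched P Stage1 (t - L1) \<omega>)"
      have q: "0 \<le> q" using dispatched_mono[OF \<omega>, of "t - L1" t] param by (simp add: q_def)
      \<comment> \<open>\<open>x + q\<close> is the Stage 1 position, so this is material
        feasibility.\<close>
      have xy: "x + q \<le> y"
        using feasible(2)[OF \<omega>, of t] True by (simp add: x_def y_def q_def)
      have zy: "z \<le> y"
        using dispatched_mono[OF \<omega>, of "t - (L1 + L2)" "t - L2" Stage2] param(2)[of Stage1]
        by (simp add: y_def z_def)
      have cost: "cost_rate S P t \<omega> = h1 S * max x 0 + h2 S * (y + max (- x) 0) + pc S * max (- x) 0"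
        by (simp add: cost_rate_eq x_def y_def of_int_max)
      define zz where "zz = (if L1 + L2 \<le> t then phi ((1 - \<eta>) * h2 S) ((1 - \<zeta>) * pc S) z else 0)"
      \<comment> \<open>Material feasibility at \<open>t - L1\<close>, with the demand up to
        \<open>t\<close> subtracted on both sides.\<close>
      have xz: "x \<le> z" if "L1 + L2 \<le> t"
      proof -
        have t: "0 \<le> t - L1" using that param(2)[of Stage2] by simp
        have "stock Stage1 0 (t - L1) \<omega> \<le> stock Stage2 L2 (t - L1) \<omega>"
          by (rule feasible(2)[OF \<omega> t])
        then show ?thesis by (simp add: x_def z_def diff_diff_add)
      qed
      \<comment> \<open>The surplus of \<open>z\<close> is at most the echelon 2 inventory
        \<open>y + max (- x) 0\<close> and its deficit at most the backlog; the shares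
        \<open>1 - \<eta>\<close> and \<open>1 - \<zeta>\<close> pay for them.\<close>
      have zz: "zz \<le> (1 - \<eta>) * h2 S * (y + max (- x) 0) + (1 - \<zeta>) * pc S * max (- x) 0"
      proof (cases "L1 + L2 \<le> t")
        case True
        have "max z 0 \<le> y + max (- x) 0" using zy xy q by linarith
        moreover have "max (- z) 0 \<le> max (- x) 0" using xz[OF True] by linarith
        ultimately show ?thesis
          using True nn unfolding zz_def phi_def by (auto intro!: add_mono mult_left_mono)
      next
        case False
        have "0 \<le> y + max (- x) 0" using xy q by linarith
        then show ?thesis using False nn by (auto simp: zz_def)
      qed
      \<comment> \<open>The remaining share \<open>\<eta>\<close> of the echelon 2 inventory covers
        the stock on hand at Stage 1 and the units in transit to it.\<close>
      have "\<eta> * h2 S * (max x 0 + q) \<le> \<eta> * h2 S * (y + max (- x) 0)"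
        using xy nn by (intro mult_left_mono) auto
      then have main: "phi (h1 S + \<eta> * h2 S) (\<zeta> * pc S) x + \<eta> * h2 S * q + zz \<le> cost_rate S P t \<omega>"
        using zz unfolding cost by (simp add: phi_def algebra_simps)
      have nonneg: "0 \<le> phi (h1 S + \<eta> * h2 S) (\<zeta> * pc S) x" "0 \<le> \<eta> * h2 S * q" "0 \<le> zz"
        using nn q by (auto simp: zz_def phi_nonneg)
      have "?a t \<omega> * indicator {0 + L1..(T - L1) + L1} t + ?b t \<omega> * indicator {0..T} t +
          ?c t \<omega> * indicator {0 + (L1 + L2)..(T - (L1 + L2)) + (L1 + L2)} t \<le>
          ennreal (phi (h1 S + \<eta> * h2 S) (\<zeta> * pc S) x) + ennreal (\<eta> * h2 S * q) + ennreal zz"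
        using True by (intro add_mono) (auto simp: indicator_def zz_def x_def z_def q_def)
      also have "\<dots> = ennreal (phi (h1 S + \<eta> * h2 S) (\<zeta> * pc S) x + \<eta> * h2 S * q + zz)"
        using nonneg by simp
      also have "\<dots> \<le> ennreal (cost_rate S P t \<omega>) * indicator {0..T} t"
        using main True by (simp add: ennreal_leI)
      finally show ?thesis .
    qed
  qed simp_all
  moreover have "(\<integral>\<^sup>+t\<in>{0 + L1..(T - L1) + L1}. (\<integral>\<^sup>+\<omega>. ?a t \<omega> \<partial>M) \<partial>lborel) = occupation (F1 S \<eta> \<zeta>) Stage1 (T - L1)"
  proof -
    have "(\<integral>\<^sup>+t\<in>{0 + L1..(T - L1) + L1}. (\<integral>\<^sup>+\<omega>. ?a t \<omega> \<partial>M) \<partial>lborel) =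
        (\<integral>\<^sup>+t\<in>{0..T - L1}. (\<integral>\<^sup>+\<omega>. ?a (t + L1) \<omega> \<partial>M) \<partial>lborel)"
      by (rule nn_integral_shift(1)) (rule nn_integral_swap(4)[OF ma _ ea], simp_all)
    also have "\<dots> = occupation (F1 S \<eta> \<zeta>) Stage1 (T - L1)"
      unfolding occupation_def
    proof (rule nn_integral_cong)
      fix t
      show "(\<integral>\<^sup>+\<omega>. ?a (t + L1) \<omega> \<partial>M) * indicator {0..T - L1} t =
          (\<integral>\<^sup>+\<omega>. ennreal (F1 S \<eta> \<zeta> (inv_position P Stage1 t \<omega>)) \<partial>M) * indicator {0..T - L1} t"
        using expected_phi_stage1[of t "h1 S + \<eta> * h2 S" "\<zeta> * pc S"] nn
        by (cases "t \<in> {0..T - L1}") (simp_all add: F1_eq[OF valid])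
    qed
    finally show ?thesis .
  qed
  moreover have "(\<integral>\<^sup>+t\<in>{0 + (L1 + L2)..(T - (L1 + L2)) + (L1 + L2)}. (\<integral>\<^sup>+\<omega>. ?c t \<omega> \<partial>M) \<partial>lborel) =
      occupation (F2 S \<eta> \<zeta>) Stage2 (T - (L1 + L2))"
  proof -
    have "(\<integral>\<^sup>+t\<in>{0 + (L1 + L2)..(T - (L1 + L2)) + (L1 + L2)}. (\<integral>\<^sup>+\<omega>. ?c t \<omega> \<partial>M) \<partial>lborel) =
        (\<integral>\<^sup>+t\<in>{0..T - (L1 + L2)}. (\<integral>\<^sup>+\<omega>. ?c (t + (L1 + L2)) \<omega> \<partial>M) \<partial>lborel)"
      by (rule nn_integral_shift(1)) (rule nn_integral_swap(4)[OF mc _ ec], simp_all)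
    also have "\<dots> = occupation (F2 S \<eta> \<zeta>) Stage2 (T - (L1 + L2))"
      unfolding occupation_def
    proof (rule nn_integral_cong)
      fix t
      show "(\<integral>\<^sup>+\<omega>. ?c (t + (L1 + L2)) \<omega> \<partial>M) * indicator {0..T - (L1 + L2)} t =
          (\<integral>\<^sup>+\<omega>. ennreal (F2 S \<eta> \<zeta> (inv_position P Stage2 t \<omega>)) \<partial>M) * indicator {0..T - (L1 + L2)} t"
      proof (cases "t \<in> {0..T - (L1 + L2)}")
        case True
        then have "0 \<le> t" "0 \<le> (1 - \<eta>) * h2 S" "0 \<le> (1 - \<zeta>) * pc S" using nn by auto
        from expected_phi_stage2[OF this] show ?thesis
          unfolding F2_eq[OF valid \<eta>(2,4)] by simp
      qed simp
    qed
    finally show ?thesis .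
  qed
  moreover have "(\<integral>\<^sup>+t\<in>{0..T}. (\<integral>\<^sup>+\<omega>. ?b t \<omega> \<partial>M) \<partial>lborel) = ennreal (\<eta> * h2 S) * expected_pipeline T"
    using nn by (intro expected_pipeline_scale) simp
  ultimately show ?thesis by simp
qed

text \<open>The Stage 2 position at \<open>t - L2\<close> is known and its stock available at
  \<open>t\<close> is that position minus a \<open>D2\<close> demand. Replacing the actual Stage 1
  position by the near-optimal base stock costs at most \<open>\<epsilon>\<close>, and the average
  is then at least \<open>V0\<close>. The term \<open>H0 S\<close> on the right is the constant
  contained in \<open>G0\<close>.\<close>

lemma V0_le_expected:
  assumes t: "L2 \<le> t" and \<epsilon>: "0 < \<epsilon>"
  shows "ennreal (V0 S) \<le> (\<integral>\<^sup>+\<omega>. ennreal (phi (h1 S + h2 S) (pc S) (stock Stage1 L1 (t + L1) \<omega>)) \<partial>M) +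
    (\<integral>\<^sup>+\<omega>. ennreal (h2 S * real_of_int (stock Stage2 L2 t \<omega> - stock Stage1 0 t \<omega>)) \<partial>M) + ennreal (H0 S + \<epsilon>)"
proof -
  have t0: "0 \<le> t" "0 \<le> t - L2" using t order.trans[OF param(2) t] by auto
  obtain R where R:
    "\<And>x z. z \<le> x \<Longrightarrow> G0 S (min x R) + h2 S * max (x - R) 0 \<le> G0 S z + h2 S * (x - z) + \<epsilon>"
    "\<And>y. ennreal (V0 S) \<le>
      (\<integral>\<^sup>+d. ennreal (G0 S (min (y - real d) R) + h2 S * max (y - real d - R) 0) \<partial>measure_pmf (D2 S))"
    by (rule near_optimal_base_stock[OF valid \<epsilon>]) (rule that)
  define f where "f x = G0 S (min x R) + h2 S * max (x - R) 0" for x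
  let ?e = "\<lambda>\<omega>. exp_phi (D1 S) (h1 S + h2 S) (pc S) (inv_position P Stage1 t \<omega>)"
  let ?d = "\<lambda>\<omega>. h2 S * real_of_int (stock Stage2 L2 t \<omega> - stock Stage1 0 t \<omega>)"
  have "ennreal (V0 S) = (\<integral>\<^sup>+\<omega>. ennreal (V0 S) \<partial>M)"
    by (simp add: emeasure_space_1)
  also have "\<dots> \<le> (\<integral>\<^sup>+\<omega>. (\<integral>\<^sup>+n. ennreal (f (real_of_int (inv_position P Stage2 (t - L2) \<omega>) - real_of_int (int n)))
      \<partial>measure_pmf (poisson (demand_rate * L2))) \<partial>M)"
    using R(2) by (intro nn_integral_mono) (simp add: f_def D2_def)
  also have "\<dots> = (\<integral>\<^sup>+\<omega>. (\<lambda>x d. ennreal (f (real_of_int x - real_of_int d))) (inv_position P Stage2 (t - L2) \<omega>)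
      (demand P ((t - L2) + L2) \<omega> - demand P (t - L2) \<omega>) \<partial>M)"
    using t0 param by (intro nn_integral_independent_increment[symmetric] inv_position_info) auto
  also have "\<dots> = (\<integral>\<^sup>+\<omega>. ennreal (f (stock Stage2 L2 t \<omega>)) \<partial>M)"
    by (intro nn_integral_cong) (simp add: inv_position_def algebra_simps)
  also have "\<dots> \<le> (\<integral>\<^sup>+\<omega>. ennreal (?e \<omega>) + ennreal (?d \<omega>) + ennreal (H0 S + \<epsilon>) \<partial>M)"
  proof (rule nn_integral_mono)
    fix \<omega> assume \<omega>: "\<omega> \<in> space M"
    have le: "stock Stage1 0 t \<omega> \<le> stock Stage2 L2 t \<omega>"
      by (rule feasible(2)[OF \<omega> t0(1)])
    have "f (stock Stage2 L2 t \<omega>) \<le> G0 S (inv_position P Stage1 t \<omega>) +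
        h2 S * (real_of_int (stock Stage2 L2 t \<omega>) - real_of_int (inv_position P Stage1 t \<omega>)) + \<epsilon>"
      unfolding f_def using le by (intro R(1)) (simp add: inv_position_def)
    also have "\<dots> = ?e \<omega> + ?d \<omega> + (H0 S + \<epsilon>)"
      by (simp add: G0_eq[OF valid] inv_position_def)
    finally have "ennreal (f (stock Stage2 L2 t \<omega>)) \<le> ennreal (?e \<omega> + ?d \<omega> + (H0 S + \<epsilon>))"
      by (rule ennreal_leI)
    also have "\<dots> = ennreal (?e \<omega>) + ennreal (?d \<omega>) + ennreal (H0 S + \<epsilon>)"
    proof -
      have "0 \<le> ?e \<omega>" "0 \<le> ?d \<omega>" "0 \<le> H0 S + \<epsilon>"
        using le param \<epsilon> by (auto intro!: exp_phi_nonneg mult_nonneg_nonneg)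
      then show ?thesis by (simp only: ennreal_plus add_nonneg_nonneg)
    qed
    finally show "ennreal (f (stock Stage2 L2 t \<omega>)) \<le> ennreal (?e \<omega>) + ennreal (?d \<omega>) + ennreal (H0 S + \<epsilon>)" .
  qed
  also have "\<dots> = (\<integral>\<^sup>+\<omega>. ennreal (?e \<omega>) \<partial>M) + (\<integral>\<^sup>+\<omega>. ennreal (?d \<omega>) \<partial>M) + ennreal (H0 S + \<epsilon>)"
  proof -
    have e: "(\<lambda>\<omega>. ennreal (?e \<omega>)) \<in> borel_measurable M"
      by (rule measurable_compose[OF measurable_info[OF inv_position_info[OF t0(1)]]]) simp
    have st: "stock i d t \<in> M \<rightarrow>\<^sub>M count_space UNIV" for i d
      using measurable_compose[OF measurable_Pair1' stock_joint, of t i d] t0(1) by simp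
    have d: "(\<lambda>\<omega>. ennreal (?d \<omega>)) \<in> borel_measurable M"
      by (rule measurable_count_space2[OF st st]) simp
    show ?thesis
      using e d by (simp add: nn_integral_add emeasure_space_1 del: of_int_diff)
  qed
  also have "(\<integral>\<^sup>+\<omega>. ennreal (?e \<omega>) \<partial>M) =
      (\<integral>\<^sup>+\<omega>. ennreal (phi (h1 S + h2 S) (pc S) (stock Stage1 L1 (t + L1) \<omega>)) \<partial>M)"
    using t0 param by (intro expected_phi_stage1[symmetric]) auto
  finally show ?thesis .
qed

text \<open>The cost rate splits exactly into Stage 1 cost, holding cost in transit and holding cost
  on the stock kept at Stage 2. The first, seen \<open>L1\<close> later, and the last together
  dominate \<open>V0\<close> up to \<open>H0 S + \<epsilon>\<close>; the transit term later
  compensates \<open>H0 S\<close>.\<close>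

lemma inventory_cost_ge_V0:
  assumes T: "L1 + L2 \<le> T" and \<epsilon>: "0 < \<epsilon>"
  shows "ennreal (V0 S * (T - (L1 + L2))) + ennreal (h2 S) * expected_pipeline T \<le>
    exp_inv_cost S P 0 T + ennreal ((H0 S + \<epsilon>) * (T - (L1 + L2)))"
proof -
  let ?a = "\<lambda>t \<omega>. ennreal (phi (h1 S + h2 S) (pc S) (stock Stage1 L1 t \<omega>))"
  let ?b = "\<lambda>t \<omega>. ennreal (h2 S * real_of_int (dispatched P Stage1 t \<omega> - dispatched P Stage1 (t - L1) \<omega>))"
  let ?c = "\<lambda>t \<omega>. ennreal (h2 S * real_of_int (stock Stage2 L2 t \<omega> - stock Stage1 0 t \<omega>))"
  \<comment> \<open>A time \<open>t\<close> in \<open>?J\<close> needs the Stage 2 position at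
    \<open>t - L2 \<ge> 0\<close> and the Stage 1 cost at \<open>t + L1 \<le> T\<close>.\<close>
  let ?J = "{L2..T - L1}" and ?J' = "{L2 + L1..(T - L1) + L1}"
  have ma: "(\<lambda>z. ennreal (phi (h1 S + h2 S) (pc S) (real_of_int (offset P Stage1 (snd z) +
      dispatched P Stage1 (fst z - L1) (snd z) - demand P (max 0 (fst z)) (snd z)))))
      \<in> borel_measurable (borel \<Otimes>\<^sub>M M)"
    by (rule measurable_compose[OF stock_joint]) simp
  have mb: "(\<lambda>z. ennreal (h2 S * real_of_int (dispatched P Stage1 (fst z) (snd z) -
      dispatched P Stage1 (fst z - L1) (snd z)))) \<in> borel_measurable (borel \<Otimes>\<^sub>M M)"
    by (rule pipeline_joint)
  have mc: "(\<lambda>z. ennreal (h2 S * real_of_int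
      ((offset P Stage2 (snd z) + dispatched P Stage2 (fst z - L2) (snd z) - demand P (max 0 (fst z)) (snd z)) -
       (offset P Stage1 (snd z) + dispatched P Stage1 (fst z - 0) (snd z) - demand P (max 0 (fst z)) (snd z)))))
      \<in> borel_measurable (borel \<Otimes>\<^sub>M M)"
    by (rule measurable_count_space2[OF stock_joint stock_joint, where h="\<lambda>x y. ennreal (h2 S * real_of_int (x - y))"]) simp
  have ea: "\<forall>t\<in>?J'. \<forall>\<omega>\<in>space M. ?a t \<omega> = ennreal (phi (h1 S + h2 S) (pc S) (real_of_int (offset P Stage1 (snd (t, \<omega>)) +
      dispatched P Stage1 (fst (t, \<omega>) - L1) (snd (t, \<omega>)) - demand P (max 0 (fst (t, \<omega>))) (snd (t, \<omega>)))))"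
    using order.trans[OF add_nonneg_nonneg[OF param(2)[of Stage2] param(2)[of Stage1]]] by simp
  have ec: "\<forall>t\<in>?J. \<forall>\<omega>\<in>space M. ?c t \<omega> = ennreal (h2 S * real_of_int
      ((offset P Stage2 (snd (t, \<omega>)) + dispatched P Stage2 (fst (t, \<omega>) - L2) (snd (t, \<omega>)) - demand P (max 0 (fst (t, \<omega>))) (snd (t, \<omega>))) -
       (offset P Stage1 (snd (t, \<omega>)) + dispatched P Stage1 (fst (t, \<omega>) - 0) (snd (t, \<omega>)) - demand P (max 0 (fst (t, \<omega>))) (snd (t, \<omega>)))))"
    using order.trans[OF param(2)[of Stage2]] by simp
  have cost: "(\<integral>\<^sup>+t\<in>?J'. (\<integral>\<^sup>+\<omega>. ?a t \<omega> \<partial>M) \<partial>lborel) + (\<integral>\<^sup>+t\<in>{0..T}. (\<integral>\<^sup>+\<omega>. ?b t \<omega> \<partial>M) \<partial>lborel) +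
    (\<integral>\<^sup>+t\<in>?J. (\<integral>\<^sup>+\<omega>. ?c t \<omega> \<partial>M) \<partial>lborel) \<le> exp_inv_cost S P 0 T"
  proof (rule exp_inv_cost_ge[OF ma mb mc _ _ _ ea _ ec])
    fix t \<omega> assume \<omega>: "\<omega> \<in> space M"
    show "?a t \<omega> * indicator ?J' t + ?b t \<omega> * indicator {0..T} t + ?c t \<omega> * indicator ?J t
        \<le> ennreal (cost_rate S P t \<omega>) * indicator {0..T} t"
    proof (cases "t \<in> {0..T}")
      case False
      then show ?thesis using param(2)[of Stage1] param(2)[of Stage2] by (auto simp: indicator_def)
    next
      case True
      define x y q where "x = real_of_int (stock Stage1 L1 t \<omega>)"
        and "y = real_of_int (stock Stage2 L2 t \<omega> - stock Stage1 0 t \<omega>)"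
        and "q = real_of_int (dispatched P Stage1 t \<omega> - dispatched P Stage1 (t - L1) \<omega>)"
      have q: "0 \<le> q" using dispatched_mono[OF \<omega>, of "t - L1" t] param by (simp add: q_def)
      have y: "0 \<le> y" using feasible(2)[OF \<omega>, of t] True by (simp add: y_def)
      \<comment> \<open>Stock at Stage 2 and units in transit telescope, since \<open>x + q\<close>
        is the Stage 1 position.\<close>
      have "real_of_int (stock Stage2 L2 t \<omega>) = y + x + q"
        by (simp add: x_def y_def q_def)
      then have "cost_rate S P t \<omega> = h1 S * max x 0 + h2 S * (y + x + q + max (- x) 0) + pc S * max (- x) 0"
        by (simp add: cost_rate_eq x_def of_int_max)
      also have "\<dots> = phi (h1 S + h2 S) (pc S) x + h2 S * q + h2 S * y"
      proof -
        have "x + max (- x) 0 = max x 0" by simp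
        then have "y + x + q + max (- x) 0 = y + q + max x 0" by simp
        then show ?thesis by (simp only: phi_def) (simp add: algebra_simps)
      qed
      finally have main: "cost_rate S P t \<omega> = phi (h1 S + h2 S) (pc S) x + h2 S * q + h2 S * y" .
      have nonneg: "0 \<le> phi (h1 S + h2 S) (pc S) x" "0 \<le> h2 S * q" "0 \<le> h2 S * y"
        using param q y by (auto simp: phi_nonneg)
      have "?a t \<omega> * indicator ?J' t + ?b t \<omega> * indicator {0..T} t + ?c t \<omega> * indicator ?J t \<le>
          ennreal (phi (h1 S + h2 S) (pc S) x) + ennreal (h2 S * q) + ennreal (h2 S * y)"
        unfolding x_def y_def q_def by (intro add_mono) (simp_all add: indicator_def)
      also have "\<dots> = ennreal (cost_rate S P t \<omega>) * indicator {0..T} t"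
        using nonneg True by (simp add: main)
      finally show ?thesis .
    qed
  qed simp_all
  let ?A = "\<lambda>t. \<integral>\<^sup>+\<omega>. ?a t \<omega> \<partial>M" and ?C = "\<lambda>t. \<integral>\<^sup>+\<omega>. ?c t \<omega> \<partial>M"
  have mA: "(\<lambda>t. ?A t * indicator ?J' t) \<in> borel_measurable borel"
    by (rule nn_integral_swap(4)[OF ma _ ea]) simp
  have mC: "(\<lambda>t. ?C t * indicator ?J t) \<in> borel_measurable borel"
    by (rule nn_integral_swap(4)[OF mc _ ec]) simp
  have int: "(\<integral>\<^sup>+t. ennreal v * indicator ?J t \<partial>lborel) = ennreal (v * (T - (L1 + L2)))" for v
  proof -
    have "emeasure lborel ?J = ennreal (T - (L1 + L2))"
      using T by (simp add: algebra_simps)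
    then show ?thesis
      using T by (subst nn_integral_cmult_indicator) (simp_all add: ennreal_mult'' diff_diff_add)
  qed
  have "ennreal (V0 S * (T - (L1 + L2))) = (\<integral>\<^sup>+t. ennreal (V0 S) * indicator ?J t \<partial>lborel)"
    by (simp only: int)
  also have "\<dots> \<le> (\<integral>\<^sup>+t. ?A (t + L1) * indicator ?J t + ?C t * indicator ?J t + ennreal (H0 S + \<epsilon>) * indicator ?J t \<partial>lborel)"
  proof (rule nn_integral_mono)
    fix t
    show "ennreal (V0 S) * indicator ?J t \<le>
        ?A (t + L1) * indicator ?J t + ?C t * indicator ?J t + ennreal (H0 S + \<epsilon>) * indicator ?J t"
      unfolding distrib_right[symmetric]
      using V0_le_expected[OF _ \<epsilon>, of t] by (cases "t \<in> ?J") (simp_all del: of_int_diff)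
  qed
  also have "\<dots> = (\<integral>\<^sup>+t\<in>?J. ?A (t + L1) \<partial>lborel) + (\<integral>\<^sup>+t\<in>?J. ?C t \<partial>lborel) +
      (\<integral>\<^sup>+t. ennreal (H0 S + \<epsilon>) * indicator ?J t \<partial>lborel)"
    using nn_integral_shift(2)[OF mA] mC by (simp add: nn_integral_add del: of_int_diff)
  also have "\<dots> = (\<integral>\<^sup>+t\<in>?J'. ?A t \<partial>lborel) + (\<integral>\<^sup>+t\<in>?J. ?C t \<partial>lborel) + ennreal ((H0 S + \<epsilon>) * (T - (L1 + L2)))"
    by (simp only: int nn_integral_shift(1)[OF mA])
  finally have "ennreal (V0 S * (T - (L1 + L2))) + ennreal (h2 S) * expected_pipeline T \<le>
      (\<integral>\<^sup>+t\<in>?J'. ?A t \<partial>lborel) + (\<integral>\<^sup>+t\<in>?J. ?C t \<partial>lborel) + ennreal ((H0 S + \<epsilon>) * (T - (L1 + L2))) +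
      ennreal (h2 S) * expected_pipeline T"
    by (rule add_right_mono)
  also have "\<dots> = ((\<integral>\<^sup>+t\<in>?J'. ?A t \<partial>lborel) + (\<integral>\<^sup>+t\<in>{0..T}. (\<integral>\<^sup>+\<omega>. ?b t \<omega> \<partial>M) \<partial>lborel) +
      (\<integral>\<^sup>+t\<in>?J. ?C t \<partial>lborel)) + ennreal ((H0 S + \<epsilon>) * (T - (L1 + L2)))"
    unfolding expected_pipeline_scale[OF param(4)] by (simp only: ac_simps)
  also have "\<dots> \<le> exp_inv_cost S P 0 T + ennreal ((H0 S + \<epsilon>) * (T - (L1 + L2)))"
    by (rule add_right_mono[OF cost])
  finally show ?thesis .
qed

section \<open>Setup costs and the passage to long-run averages\<close>

lemma num_dispatches_mono:
  assumes "\<omega> \<in> space M" "T \<le> T'"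
  shows "num_dispatches P i T \<omega> \<le> num_dispatches P i T' \<omega>"
  unfolding num_dispatches_def
  using sample_path.finite_dispatches[OF sample_path[OF assms(1)], where i=i and a=0 and b=T'] assms(2)
  by (intro card_mono) auto

lemma expected_dispatches_mono: "T \<le> T' \<Longrightarrow> expected_dispatches i T \<le> expected_dispatches i T'"
  unfolding expected_dispatches_def by (intro nn_integral_mono of_nat_mono num_dispatches_mono)

lemma exp_total_cost_eq:
  assumes "0 < T"
  shows "exp_total_cost S P T = exp_inv_cost S P 0 T +
    (ennreal (setup_cost S Stage1) * expected_dispatches Stage1 T +
     ennreal (setup_cost S Stage2) * expected_dispatches Stage2 T)"
proof -
  have mcost: "(\<lambda>z. ennreal (h1 S * real_of_int (max (offset P Stage1 (snd z) + dispatched P Stage1 (fst z - L1) (snd z) - demand P (max 0 (fst z)) (snd z)) 0) +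
      h2 S * real_of_int ((offset P Stage2 (snd z) + dispatched P Stage2 (fst z - L2) (snd z) - demand P (max 0 (fst z)) (snd z)) +
        max (- (offset P Stage1 (snd z) + dispatched P Stage1 (fst z - L1) (snd z) - demand P (max 0 (fst z)) (snd z))) 0) +
      pc S * real_of_int (max (- (offset P Stage1 (snd z) + dispatched P Stage1 (fst z - L1) (snd z) - demand P (max 0 (fst z)) (snd z))) 0)))
      \<in> borel_measurable (borel \<Otimes>\<^sub>M M)"
    by (rule measurable_count_space2[OF stock_joint stock_joint,
      where h="\<lambda>x y. ennreal (h1 S * real_of_int (max x 0) + h2 S * real_of_int (y + max (- x) 0) + pc S * real_of_int (max (- x) 0))"]) simp
  have [measurable]: "(\<lambda>\<omega>. \<integral>\<^sup>+t\<in>{0..T}. ennreal (cost_rate S P t \<omega>) \<partial>lborel) \<in> borel_measurable M"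
    by (rule nn_integral_swap(3)[OF mcost]) (auto simp: cost_rate_eq)
  note [measurable] = num_dispatches_measurable[OF assms]
  show ?thesis
    unfolding exp_total_cost_def exp_inv_cost_def expected_dispatches_def
    by (simp add: nn_integral_add nn_integral_cmult)
qed

text \<open>\<open>stage_cost_bound\<close> is applied to each echelon on its shortened horizon with
  setup charge \<open>setup_cost S i / u\<close>; dispatches are then counted up to
  \<open>T\<close>, and the occupation costs are absorbed by
  \<open>inventory_cost_split\<close>.\<close>

lemma setup_cost_bound:
  assumes T: "L1 + L2 < T" and u: "0 < u" and \<eta>: "0 \<le> \<eta>" "\<eta> \<le> 1" "0 \<le> \<zeta>" "\<zeta> \<le> 1"
    and c1: "c1 = CC (F1 S \<eta> \<zeta>) (scaled_setup S Stage1 / u)"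
    and c2: "c2 = CC (F2 S \<eta> \<zeta>) (scaled_setup S Stage2 / u)"
  shows "ennreal (c1 * (T - L1)) + ennreal (c2 * (T - (L1 + L2))) + ennreal (\<eta> * h2 S) * expected_pipeline T \<le>
    exp_inv_cost S P 0 T + (ennreal (setup_cost S Stage1 / u) * expected_dispatches Stage1 T +
     ennreal (setup_cost S Stage2 / u) * expected_dispatches Stage2 T) +
    (ennreal (c1 / demand_rate) * expected_unfinished Stage1 (T - L1) +
     ennreal (c2 / demand_rate) * expected_unfinished Stage2 (T - (L1 + L2)))"
proof -
  have T1: "0 < T - L1" "0 < T - (L1 + L2)" "T - L1 \<le> T" "T - (L1 + L2) \<le> T"
    using T param(2)[of Stage1] param(2)[of Stage2] by auto
  have "ennreal (CC (F1 S \<eta> \<zeta>) (demand_rate * (setup_cost S Stage1 / u)) * (T - L1)) \<le>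
      occupation (F1 S \<eta> \<zeta>) Stage1 (T - L1) + ennreal (setup_cost S Stage1 / u) * expected_dispatches Stage1 (T - L1) +
      ennreal (CC (F1 S \<eta> \<zeta>) (demand_rate * (setup_cost S Stage1 / u)) / demand_rate) * expected_unfinished Stage1 (T - L1)"
    using u param \<eta> by (intro stage_cost_bound F1_nonneg[OF valid] T1) auto
  also have "\<dots> \<le> occupation (F1 S \<eta> \<zeta>) Stage1 (T - L1) + ennreal (setup_cost S Stage1 / u) * expected_dispatches Stage1 T +
      ennreal (CC (F1 S \<eta> \<zeta>) (demand_rate * (setup_cost S Stage1 / u)) / demand_rate) * expected_unfinished Stage1 (T - L1)"
    using T1 by (intro add_mono mult_left_mono expected_dispatches_mono) auto
  finally have 1: "ennreal (c1 * (T - L1)) \<le> occupation (F1 S \<eta> \<zeta>) Stage1 (T - L1) +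
      ennreal (setup_cost S Stage1 / u) * expected_dispatches Stage1 T +
      ennreal (c1 / demand_rate) * expected_unfinished Stage1 (T - L1)"
    by (simp add: c1 scaled_setup_def)
  have "ennreal (CC (F2 S \<eta> \<zeta>) (demand_rate * (setup_cost S Stage2 / u)) * (T - (L1 + L2))) \<le>
      occupation (F2 S \<eta> \<zeta>) Stage2 (T - (L1 + L2)) + ennreal (setup_cost S Stage2 / u) * expected_dispatches Stage2 (T - (L1 + L2)) +
      ennreal (CC (F2 S \<eta> \<zeta>) (demand_rate * (setup_cost S Stage2 / u)) / demand_rate) * expected_unfinished Stage2 (T - (L1 + L2))"
    using u param \<eta> by (intro stage_cost_bound F2_nonneg[OF valid] T1) auto
  also have "\<dots> \<le> occupation (F2 S \<eta> \<zeta>) Stage2 (T - (L1 + L2)) + ennreal (setup_cost S Stage2 / u) * expected_dispatches Stage2 T +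
      ennreal (CC (F2 S \<eta> \<zeta>) (demand_rate * (setup_cost S Stage2 / u)) / demand_rate) * expected_unfinished Stage2 (T - (L1 + L2))"
    using T1 by (intro add_mono mult_left_mono expected_dispatches_mono) auto
  finally have 2: "ennreal (c2 * (T - (L1 + L2))) \<le> occupation (F2 S \<eta> \<zeta>) Stage2 (T - (L1 + L2)) +
      ennreal (setup_cost S Stage2 / u) * expected_dispatches Stage2 T +
      ennreal (c2 / demand_rate) * expected_unfinished Stage2 (T - (L1 + L2))"
    by (simp add: c2 scaled_setup_def)
  have "ennreal (c1 * (T - L1)) + ennreal (c2 * (T - (L1 + L2))) + ennreal (\<eta> * h2 S) * expected_pipeline T \<le>
      (occupation (F1 S \<eta> \<zeta>) Stage1 (T - L1) +
      ennreal (setup_cost S Stage1 / u) * expected_dispatches Stage1 T +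
      ennreal (c1 / demand_rate) * expected_unfinished Stage1 (T - L1)) +
      (occupation (F2 S \<eta> \<zeta>) Stage2 (T - (L1 + L2)) +
      ennreal (setup_cost S Stage2 / u) * expected_dispatches Stage2 T +
      ennreal (c2 / demand_rate) * expected_unfinished Stage2 (T - (L1 + L2))) +
      ennreal (\<eta> * h2 S) * expected_pipeline T"
    by (intro add_mono 1 2 order.refl)
  also have "\<dots> = (occupation (F1 S \<eta> \<zeta>) Stage1 (T - L1) + ennreal (\<eta> * h2 S) * expected_pipeline T +
      occupation (F2 S \<eta> \<zeta>) Stage2 (T - (L1 + L2))) +
      (ennreal (setup_cost S Stage1 / u) * expected_dispatches Stage1 T +
     ennreal (setup_cost S Stage2 / u) * expected_dispatches Stage2 T) +
    (ennreal (c1 / demand_rate) * expected_unfinished Stage1 (T - L1) +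
     ennreal (c2 / demand_rate) * expected_unfinished Stage2 (T - (L1 + L2)))"
    by (simp only: ac_simps)
  also have "\<dots> \<le> exp_inv_cost S P 0 T + (ennreal (setup_cost S Stage1 / u) * expected_dispatches Stage1 T +
     ennreal (setup_cost S Stage2 / u) * expected_dispatches Stage2 T) +
    (ennreal (c1 / demand_rate) * expected_unfinished Stage1 (T - L1) +
     ennreal (c2 / demand_rate) * expected_unfinished Stage2 (T - (L1 + L2)))"
    using T by (intro add_mono order.refl inventory_cost_split \<eta>) simp
  finally show ?thesis .
qed

lemma unfinished_negligible:
  assumes "0 \<le> L"
  shows "\<forall>\<^sub>F T in at_top. expected_unfinished i (T - L) < \<infinity>"
    and "((\<lambda>T. enn2real (expected_unfinished i (T - L)) / T) \<longlongrightarrow> 0) at_top"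
proof -
  have shift: "filterlim (\<lambda>T. T - L) at_top at_top"
    by real_asymp
  have "((\<lambda>T. expected_unfinished i T / ennreal T) \<longlongrightarrow> 0) at_top"
    using admissible by (simp add: admissible_def asymptotic_conditions_def expected_unfinished_def)
  then have lim: "((\<lambda>T. expected_unfinished i (T - L) / ennreal (T - L)) \<longlongrightarrow> 0) at_top"
    by (rule filterlim_compose[OF _ shift])
  \<comment> \<open>An infinite expectation would make the quotient infinite, so smallness of the
    quotient yields finiteness.\<close>
  then have "\<forall>\<^sub>F T in at_top. expected_unfinished i (T - L) / ennreal (T - L) < 1"
    by (rule order_tendstoD(2)) simp
  then show "\<forall>\<^sub>F T in at_top. expected_unfinished i (T - L) < \<infinity>"
  proof eventually_elim
    case (elim T)
    then show ?case
      by (cases "expected_unfinished i (T - L)") (auto simp: ennreal_top_divide)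
  qed
  have "((\<lambda>T. enn2real (expected_unfinished i (T - L) / ennreal (T - L))) \<longlongrightarrow> 0) at_top"
    using tendsto_enn2real[of _ 0] lim by simp
  moreover have "((\<lambda>T. (T - L) / T) \<longlongrightarrow> 1) at_top" by real_asymp
  ultimately have prod: "((\<lambda>T. enn2real (expected_unfinished i (T - L) / ennreal (T - L)) * ((T - L) / T)) \<longlongrightarrow> 0 * 1) at_top"
    by (rule tendsto_mult)
  have "\<forall>\<^sub>F T in at_top. enn2real (expected_unfinished i (T - L) / ennreal (T - L)) * ((T - L) / T) =
      enn2real (expected_unfinished i (T - L)) / T"
    using eventually_gt_at_top[of L]
  proof eventually_elim
    case (elim T)
    then show ?case
      by (cases "expected_unfinished i (T - L)") (auto simp: divide_ennreal ennreal_top_divide)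
  qed
  from Lim_transform_eventually[OF prod this]
  show "((\<lambda>T. enn2real (expected_unfinished i (T - L)) / T) \<longlongrightarrow> 0) at_top"
    by simp
qed

text \<open>The limit is Little's law for units in transit; multiplied by \<open>h2 S\<close> it is
  \<open>H0 S\<close>.\<close>

lemma pipeline_rate:
  "((\<lambda>T. L1 * (mean_dispatched (T - L1) - mean_dispatched 0) / T) \<longlongrightarrow> L1 * demand_rate) at_top"
proof -
  have shift: "filterlim (\<lambda>T. T - L1) at_top at_top"
    by real_asymp
  have "((\<lambda>T. mean_dispatched (T - L1) / (T - L1) * ((T - L1) / T) - mean_dispatched 0 / T) \<longlongrightarrow>
      demand_rate * 1 - 0) at_top"
  proof (intro tendsto_diff tendsto_mult)
    show "((\<lambda>T. mean_dispatched (T - L1) / (T - L1)) \<longlongrightarrow> demand_rate) at_top"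
      by (rule filterlim_compose[OF mean_rate_dispatched(2) shift])
    show "((\<lambda>T. (T - L1) / T) \<longlongrightarrow> 1) at_top" by real_asymp
    show "((\<lambda>T. mean_dispatched 0 / T) \<longlongrightarrow> 0) at_top"
      by (intro tendsto_divide_0[OF tendsto_const] filterlim_at_top_imp_at_infinity filterlim_ident)
  qed
  then have lim: "((\<lambda>T. L1 * (mean_dispatched (T - L1) / (T - L1) * ((T - L1) / T) - mean_dispatched 0 / T)) \<longlongrightarrow>
      L1 * (demand_rate * 1 - 0)) at_top"
    by (rule tendsto_mult_left)
  have "\<forall>\<^sub>F T in at_top. L1 * (mean_dispatched (T - L1) / (T - L1) * ((T - L1) / T) - mean_dispatched 0 / T) =
      L1 * (mean_dispatched (T - L1) - mean_dispatched 0) / T"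
    using eventually_gt_at_top[of L1] eventually_gt_at_top[of 0]
    by eventually_elim (simp add: field_simps)
  from Lim_transform_eventually[OF lim this] show ?thesis by simp
qed

text \<open>The setup bound is weighted by \<open>u\<close>, which turns the charges
  \<open>setup_cost S i / u\<close> back into \<open>setup_cost S i\<close>, and the
  \<open>V0\<close> bound by \<open>1 - u\<close>. The two shares of the inventory cost add up to
  the whole, and division by \<open>T\<close> leaves the limits of both sides.\<close>

lemma long_run_cost_ge_relaxed:
  assumes u: "0 < u" "u \<le> 1" and \<eta>: "0 \<le> \<eta>" "\<eta> \<le> 1" "0 \<le> \<zeta>" "\<zeta> \<le> 1" and \<epsilon>: "0 < \<epsilon>"
  shows "ennreal ((1 - u) * V0 S + u * (\<eta> * H0 S + CC (F1 S \<eta> \<zeta>) (scaled_setup S Stage1 / u) +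
    CC (F2 S \<eta> \<zeta>) (scaled_setup S Stage2 / u)) - (1 - u) * \<epsilon>) \<le> long_run_cost S P"
proof -
  define c1 where "c1 = CC (F1 S \<eta> \<zeta>) (scaled_setup S Stage1 / u)"
  define c2 where "c2 = CC (F2 S \<eta> \<zeta>) (scaled_setup S Stage2 / u)"
  have c: "0 \<le> c1" "0 \<le> c2"
    using u \<eta> param unfolding c1_def c2_def
    by (auto intro!: CC_nonneg F1_nonneg[OF valid] F2_nonneg[OF valid])
  define \<pi> where "\<pi> T = L1 * (mean_dispatched (T - L1) - mean_dispatched 0)" for T
  define r1 where "r1 T = enn2real (expected_unfinished Stage1 (T - L1))" for T
  define r2 where "r2 T = enn2real (expected_unfinished Stage2 (T - (L1 + L2)))" for T
  define W where "W T = T - (L1 + L2)" for T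
  \<comment> \<open>\<open>max (V0 S) 0\<close> is the value that \<open>ennreal (V0 S)\<close>
    retains; with it all summands are nonnegative and \<open>ennreal\<close> distributes over the
    sum.\<close>
  define lhs where "lhs T = u * (c1 * (T - L1) + c2 * W T + \<eta> * h2 S * \<pi> T) +
    (1 - u) * (max (V0 S) 0 * W T + h2 S * \<pi> T)" for T
  define err where "err T = u * (c1 / demand_rate * r1 T + c2 / demand_rate * r2 T) +
    (1 - u) * ((H0 S + \<epsilon>) * W T)" for T
  have LL: "0 \<le> L1" "0 \<le> L1 + L2" using param(2)[of Stage1] param(2)[of Stage2] by simp_all
  have bound: "\<forall>\<^sub>F T in at_top. ennreal ((lhs T - err T) / T) \<le> exp_total_cost S P T / ennreal T"
    using unfinished_negligible(1)[OF LL(1), of Stage1] unfinished_negligible(1)[OF LL(2), of Stage2]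
      eventually_gt_at_top[of "L1 + L2"] eventually_gt_at_top[of 0]
  proof eventually_elim
    case (elim T)
    note fin = elim(1,2) and T = elim(3,4)
    have T1: "0 \<le> T - L1" "0 \<le> W T" "L1 \<le> T" using T param(2)[of Stage2] by (simp_all add: W_def)
    have \<pi>0: "0 \<le> \<pi> T"
    proof -
      have "mean_dispatched 0 \<le> mean_dispatched (T - L1)"
        using T1 mean_rate_dispatched(1) by (intro integral_mono) (auto intro!: dispatched_mono)
      then show ?thesis using LL by (simp add: \<pi>_def)
    qed
    let ?A = "exp_inv_cost S P 0 T" and ?Pi = "expected_pipeline T"
    let ?Z1 = "expected_dispatches Stage1 T" and ?Z2 = "expected_dispatches Stage2 T"
    have Pi: "ennreal (\<pi> T) \<le> ?Pi"
      unfolding \<pi>_def by (rule expected_pipeline_ge[OF T1(3)])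
    have r: "ennreal (r1 T) = expected_unfinished Stage1 (T - L1)"
      "ennreal (r2 T) = expected_unfinished Stage2 (T - (L1 + L2))" "0 \<le> r1 T" "0 \<le> r2 T"
      using fin by (simp_all add: r1_def r2_def)
    have "ennreal (c1 * (T - L1) + c2 * W T + \<eta> * h2 S * \<pi> T) =
        ennreal (c1 * (T - L1)) + ennreal (c2 * W T) + ennreal (\<eta> * h2 S) * ennreal (\<pi> T)"
      using c T1 \<eta> param \<pi>0 by (simp add: ennreal_mult)
    also have "\<dots> \<le> ennreal (c1 * (T - L1)) + ennreal (c2 * W T) + ennreal (\<eta> * h2 S) * ?Pi"
      by (intro add_mono mult_left_mono Pi) auto
    also have "\<dots> \<le> ?A + (ennreal (setup_cost S Stage1 / u) * ?Z1 + ennreal (setup_cost S Stage2 / u) * ?Z2) +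
        (ennreal (c1 / demand_rate) * ennreal (r1 T) + ennreal (c2 / demand_rate) * ennreal (r2 T))"
      unfolding r W_def by (rule setup_cost_bound[OF T(1) u(1) \<eta> c1_def c2_def])
    also have "ennreal (c1 / demand_rate) * ennreal (r1 T) + ennreal (c2 / demand_rate) * ennreal (r2 T) =
        ennreal (c1 / demand_rate * r1 T + c2 / demand_rate * r2 T)"
      using c r(3,4) param by (simp add: ennreal_mult[symmetric])
    finally have "ennreal u * ennreal (c1 * (T - L1) + c2 * W T + \<eta> * h2 S * \<pi> T) \<le>
        ennreal u * (?A + (ennreal (setup_cost S Stage1 / u) * ?Z1 + ennreal (setup_cost S Stage2 / u) * ?Z2) +
          ennreal (c1 / demand_rate * r1 T + c2 / demand_rate * r2 T))"
      by (rule mult_left_mono) simp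
    then have part1: "ennreal (u * (c1 * (T - L1) + c2 * W T + \<eta> * h2 S * \<pi> T)) \<le>
        ennreal u * ?A + (ennreal (setup_cost S Stage1) * ?Z1 + ennreal (setup_cost S Stage2) * ?Z2) +
          ennreal (u * (c1 / demand_rate * r1 T + c2 / demand_rate * r2 T))"
    proof -
      have "ennreal u * (ennreal (setup_cost S i / u) * z) = ennreal (setup_cost S i) * z" for i z
        using u param by (simp add: mult.assoc[symmetric] ennreal_mult[symmetric])
      then have "ennreal u * (?A + (ennreal (setup_cost S Stage1 / u) * ?Z1 + ennreal (setup_cost S Stage2 / u) * ?Z2) +
          ennreal (c1 / demand_rate * r1 T + c2 / demand_rate * r2 T)) =
        ennreal u * ?A + (ennreal (setup_cost S Stage1) * ?Z1 + ennreal (setup_cost S Stage2) * ?Z2) +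
          ennreal u * ennreal (c1 / demand_rate * r1 T + c2 / demand_rate * r2 T)"
        by (simp only: distrib_left)
      moreover have "ennreal (u * x) = ennreal u * ennreal x" for x
        using u by (simp add: ennreal_mult')
      ultimately show ?thesis
        using \<open>ennreal u * _ \<le> _\<close> by (simp only:)
    qed
    have "ennreal (max (V0 S) 0 * W T + h2 S * \<pi> T) = ennreal (V0 S * W T) + ennreal (h2 S) * ennreal (\<pi> T)"
    proof -
      have "ennreal (max (V0 S) 0 * W T) = ennreal (V0 S * W T)"
        using T1(2) by (cases "0 \<le> V0 S") (auto simp: max_def ennreal_neg mult_nonpos_nonneg)
      then show ?thesis using T1 param \<pi>0 by (simp add: ennreal_mult)
    qed
    also have "\<dots> \<le> ennreal (V0 S * W T) + ennreal (h2 S) * ?Pi"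
      by (intro add_mono mult_left_mono Pi) auto
    also have "\<dots> \<le> ?A + ennreal ((H0 S + \<epsilon>) * W T)"
      unfolding W_def using T by (intro inventory_cost_ge_V0 \<epsilon>) simp
    finally have "ennreal (1 - u) * ennreal (max (V0 S) 0 * W T + h2 S * \<pi> T) \<le>
        ennreal (1 - u) * (?A + ennreal ((H0 S + \<epsilon>) * W T))"
      by (rule mult_left_mono) simp
    also have "\<dots> = ennreal (1 - u) * ?A + ennreal (1 - u) * ennreal ((H0 S + \<epsilon>) * W T)"
      by (rule distrib_left)
    finally have "ennreal (1 - u) * ennreal (max (V0 S) 0 * W T + h2 S * \<pi> T) \<le> \<dots>" .
    moreover have "ennreal ((1 - u) * x) = ennreal (1 - u) * ennreal x" for x
      using u by (simp add: ennreal_mult')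
    ultimately have part2: "ennreal ((1 - u) * (max (V0 S) 0 * W T + h2 S * \<pi> T)) \<le>
        ennreal (1 - u) * ?A + ennreal ((1 - u) * ((H0 S + \<epsilon>) * W T))"
      by (simp only:)
    have uA: "ennreal u * ?A + ennreal (1 - u) * ?A = ?A"
      using u by (simp add: distrib_right[symmetric] ennreal_plus[symmetric] del: ennreal_plus)
    have err0: "0 \<le> err T" "0 \<le> u * (c1 / demand_rate * r1 T + c2 / demand_rate * r2 T)"
      "0 \<le> (1 - u) * ((H0 S + \<epsilon>) * W T)"
      using u c r(3,4) param \<epsilon> T1 by (auto simp: err_def intro!: add_nonneg_nonneg mult_nonneg_nonneg)
    have "ennreal (lhs T) = ennreal (u * (c1 * (T - L1) + c2 * W T + \<eta> * h2 S * \<pi> T)) +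
        ennreal ((1 - u) * (max (V0 S) 0 * W T + h2 S * \<pi> T))"
      unfolding lhs_def using u c T1 \<eta> param \<pi>0
      by (intro ennreal_plus add_nonneg_nonneg mult_nonneg_nonneg) auto
    also have "\<dots> \<le> (ennreal u * ?A + (ennreal (setup_cost S Stage1) * ?Z1 + ennreal (setup_cost S Stage2) * ?Z2) +
          ennreal (u * (c1 / demand_rate * r1 T + c2 / demand_rate * r2 T))) +
        (ennreal (1 - u) * ?A + ennreal ((1 - u) * ((H0 S + \<epsilon>) * W T)))"
      by (rule add_mono[OF part1 part2])
    also have "\<dots> = (ennreal u * ?A + ennreal (1 - u) * ?A) +
        (ennreal (setup_cost S Stage1) * ?Z1 + ennreal (setup_cost S Stage2) * ?Z2) +
        (ennreal (u * (c1 / demand_rate * r1 T + c2 / demand_rate * r2 T)) + ennreal ((1 - u) * ((H0 S + \<epsilon>) * W T)))"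
      by (simp only: ac_simps)
    also have "\<dots> = exp_total_cost S P T + ennreal (err T)"
      unfolding uA exp_total_cost_eq[OF T(2)] err_def using err0 by simp
    finally have le: "ennreal (lhs T) \<le> exp_total_cost S P T + ennreal (err T)" .
    \<comment> \<open>The error is moved to the left as a real number when the cost is finite; for
      infinite cost the bound is trivial.\<close>
    have "ennreal (lhs T - err T) \<le> exp_total_cost S P T"
    proof (cases "exp_total_cost S P T")
      case (real x)
      then have "ennreal (lhs T) \<le> ennreal (x + err T)" using le err0 by simp
      then have "lhs T \<le> x + err T" using real err0 by (subst (asm) ennreal_le_iff) auto
      then show ?thesis using real by (simp add: ennreal_leI)
    qed simp
    then have "ennreal (lhs T - err T) / ennreal T \<le> exp_total_cost S P T / ennreal T"
      by (rule divide_right_mono_ennreal)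
    moreover have "ennreal ((lhs T - err T) / T) = ennreal (lhs T - err T) / ennreal T"
      using T by (cases "0 \<le> lhs T - err T")
        (simp_all add: divide_ennreal ennreal_neg divide_nonpos_pos)
    ultimately show ?case by simp
  qed
  define \<tau> where "\<tau> = u * (c1 * 1 + c2 * 1 + \<eta> * h2 S * (L1 * demand_rate)) +
      (1 - u) * (max (V0 S) 0 * 1 + h2 S * (L1 * demand_rate)) -
      (u * (c1 / demand_rate * 0 + c2 / demand_rate * 0) + (1 - u) * ((H0 S + \<epsilon>) * 1))"
  have lims: "((\<lambda>T. (T - L1) / T) \<longlongrightarrow> 1) at_top" "((\<lambda>T. W T / T) \<longlongrightarrow> 1) at_top"
    "((\<lambda>T. \<pi> T / T) \<longlongrightarrow> L1 * demand_rate) at_top"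
    "((\<lambda>T. r1 T / T) \<longlongrightarrow> 0) at_top" "((\<lambda>T. r2 T / T) \<longlongrightarrow> 0) at_top"
  proof -
    show "((\<lambda>T. (T - L1) / T) \<longlongrightarrow> 1) at_top" by real_asymp
    show "((\<lambda>T. W T / T) \<longlongrightarrow> 1) at_top" unfolding W_def by real_asymp
    show "((\<lambda>T. \<pi> T / T) \<longlongrightarrow> L1 * demand_rate) at_top"
      using pipeline_rate by (simp add: \<pi>_def)
    show "((\<lambda>T. r1 T / T) \<longlongrightarrow> 0) at_top" "((\<lambda>T. r2 T / T) \<longlongrightarrow> 0) at_top"
      unfolding r1_def r2_def by (intro unfinished_negligible LL)+
  qed
  have "((\<lambda>T. u * (c1 * ((T - L1) / T) + c2 * (W T / T) + \<eta> * h2 S * (\<pi> T / T)) +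
      (1 - u) * (max (V0 S) 0 * (W T / T) + h2 S * (\<pi> T / T)) -
      (u * (c1 / demand_rate * (r1 T / T) + c2 / demand_rate * (r2 T / T)) +
       (1 - u) * ((H0 S + \<epsilon>) * (W T / T)))) \<longlongrightarrow> \<tau>) at_top"
    unfolding \<tau>_def
    by (intro tendsto_add tendsto_diff tendsto_mult tendsto_const lims)
  moreover have "u * (c1 * ((T - L1) / T) + c2 * (W T / T) + \<eta> * h2 S * (\<pi> T / T)) +
      (1 - u) * (max (V0 S) 0 * (W T / T) + h2 S * (\<pi> T / T)) -
      (u * (c1 / demand_rate * (r1 T / T) + c2 / demand_rate * (r2 T / T)) +
       (1 - u) * ((H0 S + \<epsilon>) * (W T / T))) = (lhs T - err T) / T" for T
  proof -
    define d where "d = T - L1"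
    show ?thesis
      unfolding lhs_def err_def d_def[symmetric]
      by (simp add: add_divide_distrib diff_divide_distrib distrib_left)
  qed
  ultimately have "((\<lambda>T. (lhs T - err T) / T) \<longlongrightarrow> \<tau>) at_top"
    by (simp only:)
  then have "((\<lambda>T. ennreal ((lhs T - err T) / T)) \<longlongrightarrow> ennreal \<tau>) at_top"
    by (rule tendsto_ennrealI)
  then have "ennreal \<tau> = Limsup at_top (\<lambda>T. ennreal ((lhs T - err T) / T))"
    by (intro lim_imp_Limsup[symmetric]) auto
  also have "\<dots> \<le> long_run_cost S P"
    unfolding long_run_cost_def by (rule Limsup_mono[OF bound])
  finally have "ennreal \<tau> \<le> long_run_cost S P" .
  moreover have "(1 - u) * V0 S + u * (\<eta> * H0 S + c1 + c2) - (1 - u) * \<epsilon> \<le> \<tau>"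
  proof -
    \<comment> \<open>The transit costs contribute
      \<open>u * \<eta> * H0 S + (1 - u) * H0 S\<close>, and the second summand cancels the
      \<open>H0 S\<close> in the error term.\<close>
    have "h2 S * (L1 * demand_rate) = H0 S" by (simp add: H0_def)
    then have "\<tau> = (1 - u) * max (V0 S) 0 + u * (\<eta> * H0 S + c1 + c2) - (1 - u) * \<epsilon>"
      unfolding \<tau>_def mult.assoc by (simp add: algebra_simps)
    moreover have "(1 - u) * V0 S \<le> (1 - u) * max (V0 S) 0"
      using u by (intro mult_left_mono) auto
    ultimately show ?thesis by simp
  qed
  ultimately show ?thesis
    unfolding c1_def c2_def by (meson ennreal_leI order.trans)
qed

lemma LB_SP_le_long_run_cost: "ereal (LB_SP S) \<le> enn2ereal (long_run_cost S P)"
proof (cases "long_run_cost S P")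
  case (real c)
  have "LB_SP S \<le> c"
  proof (rule LB_SP_least[OF valid])
    fix u \<eta> \<zeta> :: real
    assume u: "0 < u" "u \<le> 1" and \<eta>: "0 \<le> \<eta>" "\<eta> \<le> 1" "0 \<le> \<zeta>" "\<zeta> \<le> 1"
    let ?\<tau> = "(1 - u) * V0 S + u * (\<eta> * H0 S + CC (F1 S \<eta> \<zeta>) (scaled_setup S Stage1 / u) +
      CC (F2 S \<eta> \<zeta>) (scaled_setup S Stage2 / u))"
    show "?\<tau> \<le> c"
    proof (rule field_le_epsilon)
      fix \<epsilon> :: real assume \<epsilon>: "0 < \<epsilon>"
      have "ennreal (?\<tau> - (1 - u) * \<epsilon>) \<le> ennreal c"
        using long_run_cost_ge_relaxed[OF u \<eta> \<epsilon>] real by simp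
      then have "?\<tau> - (1 - u) * \<epsilon> \<le> c" using real(1) by (simp add: ennreal_le_iff)
      moreover have "(1 - u) * \<epsilon> \<le> \<epsilon>" using u \<epsilon> by (simp add: mult_left_le_one_le)
      ultimately show "?\<tau> \<le> c + \<epsilon>" by linarith
    qed
  qed
  then show ?thesis using real by (simp add: enn2ereal_ennreal)
qed simp

end

theorem proposition2:
  fixes S :: instance_data
  assumes "valid_instance S"
  shows "L_two S \<le> LB_SP S \<and> ereal (LB_SP S) \<le> enn2ereal (opt_cost TYPE('w) S)"
proof
  show "L_two S \<le> LB_SP S" by (rule L_two_le_LB_SP[OF assms])
  have "ereal (LB_SP S) \<le> enn2ereal (long_run_cost S P)" if "admissible S P" for P :: "'w policy"
  proof -
    interpret admissible_policy S P using assms that by unfold_locales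
    show ?thesis by (rule LB_SP_le_long_run_cost)
  qed
  then have "ennreal (LB_SP S) \<le> long_run_cost S P" if "admissible S P" for P :: "'w policy"
    using e2ennreal_mono that by fastforce
  then have "ennreal (LB_SP S) \<le> opt_cost TYPE('w) S"
    unfolding opt_cost_def by (intro INF_greatest) auto
  then have "enn2ereal (ennreal (LB_SP S)) \<le> enn2ereal (opt_cost TYPE('w) S)"
    by (simp only: less_eq_ennreal.rep_eq)
  \<comment> \<open>The passage through \<open>ennreal\<close> raises a negative bound to 0, which
    only strengthens the inequality.\<close>
  moreover have "ereal (LB_SP S) \<le> enn2ereal (ennreal (LB_SP S))"
  proof (cases "0 \<le> LB_SP S")
    case False
    then have "ereal (LB_SP S) \<le> 0" by simp
    then show ?thesis using enn2ereal_nonneg by (rule order.trans)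
  qed (simp add: enn2ereal_ennreal)
  ultimately show "ereal (LB_SP S) \<le> enn2ereal (opt_cost TYPE('w) S)"
    by (rule order.trans[rotated])
qed

end
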